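(* Let $\phi$ be a Ma-Minda function, let $K$ be defined by $1+\frac{zK''(z)}{K'(z)}=\phi(z)$, $K(0)=K'(0)-1=0$, and let $\alpha\in\mathbb{C}$ with $|\alpha|\le1$. Let $f=h+\overline{g}\in\mathcal{HC}(\phi)$ with $h(z)=z+\sum_{n\ge2}a_nz^n$, $g(z)=\sum_{n\ge2}b_nz^n$, and for $0<r<1$ let $S_r$ be the area of $f(\{z:|z|<r\})$. Let $$R'_f(r)=M_K(r)+|\alpha|\int_0^rtM_{K'}(t)\,dt+\int_0^rt(1-|\alpha|^2t^2)(K'(t))^2\,dt,\quad L(1,\alpha)=-K(-1)-|\alpha|\int_0^1tK'(-t)\,dt,$$ and let $r'_f$ be the smallest positive root of $R'_f(r)=L(1,\alpha)$. Then $$M_f(r)+\frac{S_r}{2\pi}\le d(f(0),\partial f(\mathbb{D}))$$ for $|z|=r\le R'_f:=\min\{1/3,r'_f\}$, where $M_f(r)=r+\sum_{n\ge2}(|a_n|+|b_n|)r^n$.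
   Context: $\mathbb{D}=\{z\in\mathbb{C}:|z|<1\}$. A Ma-Minda function is an analytic univalent $\phi:\mathbb{D}\to\mathbb{C}$ such that $\phi(\mathbb{D})$ has positive real part, is symmetric with respect to the real axis, is starlike with respect to $\phi(0)=1$, and $\phi'(0)>0$. $F\prec G$ means $F=G\circ\omega$ for some analytic $\omega:\mathbb{D}\to\mathbb{D}$ with $\omega(0)=0$. $\mathcal{C}(\phi)$ is the class of univalent analytic $f$ on $\mathbb{D}$ with $f(0)=0,f'(0)=1$ and $1+zf''(z)/f'(z)\prec\phi(z)$. For $\alpha\in\mathbb{C}$ with $|\alpha|\le1$, $\mathcal{HC}(\phi)$ is the class of harmonic mappings $f=h+\overline{g}$ on $\mathbb{D}$ with $h(z)=z+\sum_{n\ge2}a_nz^n$, $g(z)=\sum_{n\ge2}b_nz^n$, $h\in\mathcal{C}(\phi)$ and $g'(z)=\alpha zh'(z)$. For analytic $F(z)=\sum_{n\ge0}c_nz^n$, $M_F(r)=\sum_{n\ge0}|c_n|r^n$. $d(f(0),\partial f(\mathbb{D}))$ is the Euclidean distance from $f(0)$ to the boundary of $f(\mathbb{D})$. *)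

theory Defs
  imports "HOL-Analysis.Analysis"
begin

definition unit_disk :: "complex set" where
  "unit_disk = ball 0 1"

definition ma_minda :: "(complex \<Rightarrow> complex) \<Rightarrow> bool" where
  "ma_minda \<phi> \<longleftrightarrow>
     \<phi> holomorphic_on unit_disk \<and> inj_on \<phi> unit_disk \<and>
     (\<forall>z\<in>unit_disk. Re (\<phi> z) > 0) \<and>
     (\<forall>w\<in>\<phi> ` unit_disk. cnj w \<in> \<phi> ` unit_disk) \<and>
     \<phi> 0 = 1 \<and>
     (\<forall>w\<in>\<phi> ` unit_disk. closed_segment 1 w \<subseteq> \<phi> ` unit_disk) \<and>
     deriv \<phi> 0 \<in> \<real> \<and> Re (deriv \<phi> 0) > 0"

definition subordinate :: "(complex \<Rightarrow> complex) \<Rightarrow> (complex \<Rightarrow> complex) \<Rightarrow> bool" where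
  "subordinate F G \<longleftrightarrow>
     (\<exists>\<omega>. \<omega> holomorphic_on unit_disk \<and> \<omega> ` unit_disk \<subseteq> unit_disk \<and> \<omega> 0 = 0 \<and>
          (\<forall>z\<in>unit_disk. F z = G (\<omega> z)))"

definition conv_class :: "(complex \<Rightarrow> complex) \<Rightarrow> (complex \<Rightarrow> complex) \<Rightarrow> bool" where
  "conv_class \<phi> f \<longleftrightarrow>
     f holomorphic_on unit_disk \<and> inj_on f unit_disk \<and> f 0 = 0 \<and> deriv f 0 = 1 \<and>
     subordinate (\<lambda>z. 1 + z * deriv (deriv f) z / deriv f z) \<phi>"

text \<open>The class HC(phi) (with parameter alpha), for f = h + conj g.
  g(z) = sum_{n>=2} b_n z^n is encoded by g holomorphic with g 0 = 0
  (g'(0) = 0 then follows from g' = alpha z h').\<close>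
definition HC_class :: "(complex \<Rightarrow> complex) \<Rightarrow> complex \<Rightarrow>
    (complex \<Rightarrow> complex) \<Rightarrow> (complex \<Rightarrow> complex) \<Rightarrow> bool" where
  "HC_class \<phi> \<alpha> h g \<longleftrightarrow>
     conv_class \<phi> h \<and> g holomorphic_on unit_disk \<and> g 0 = 0 \<and>
     (\<forall>z\<in>unit_disk. deriv g z = \<alpha> * z * deriv h z)"

definition harm :: "(complex \<Rightarrow> complex) \<Rightarrow> (complex \<Rightarrow> complex) \<Rightarrow> complex \<Rightarrow> complex" where
  "harm h g = (\<lambda>z. h z + cnj (g z))"

definition taylor_coeff :: "(complex \<Rightarrow> complex) \<Rightarrow> nat \<Rightarrow> complex" where
  "taylor_coeff F n = (deriv ^^ n) F 0 / fact n"

definition majorant :: "(complex \<Rightarrow> complex) \<Rightarrow> real \<Rightarrow> real" where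
  "majorant F r = (\<Sum>n. norm (taylor_coeff F n) * r ^ n)"

definition harm_majorant :: "(complex \<Rightarrow> complex) \<Rightarrow> (complex \<Rightarrow> complex) \<Rightarrow> real \<Rightarrow> real" where
  "harm_majorant h g r =
     r + (\<Sum>n. (norm (taylor_coeff h (n + 2)) + norm (taylor_coeff g (n + 2))) * r ^ (n + 2))"

end

theory Submission
  imports Defs "HOL-Complex_Analysis.Complex_Analysis"
begin

text \<open>
  Write \<open>q = \<phi> - 1\<close>, \<open>Q = ln K'\<close> and \<open>P = ln h'\<close>, so that \<open>z Q' = q\<close> is starlike and \<open>z P' = q \<circ> \<omega>\<close>.
  Then \<open>Q\<close> is convex and \<open>P\<close> is subordinate to \<open>Q\<close>. Since \<open>Q\<close> is symmetric, this gives
  \<open>K'(-r) \<le> |h'(z)| \<le> K'(r)\<close> for \<open>|z| = r\<close>. Moreover \<open>h'\<close> is subordinate to \<open>K'\<close>, so that Bohr's inequality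
  bounds the majorant series of \<open>h'\<close> by that of \<open>K'\<close> for \<open>r \<le> 1/3\<close>; integrating bounds \<open>M_f\<close>. The upper bound
  of the Jacobian gives the area, and the lower bound of \<open>|h'| - |g'|\<close> along lifts of segments gives the
  distance of an omitted value from 0. As \<open>h(D)\<close> is convex, \<open>f \<circ> h\<^sup>-\<^sup>1\<close> is the identity plus the conjugate of a
  contraction; hence \<open>f\<close> is univalent and not onto the plane, so that \<open>f(D)\<close> has a boundary.
\<close>

subsection \<open>Convexity of images\<close>

text \<open>Univalence of \<open>q\<close> is given, but that of \<open>Q\<close> is not, although
  an inverse of \<open>Q\<close> is needed both for the subordination and for the convexity of image
  discs. It is gained through a chain of inequalities: starlikeness of \<open>q\<close> yields
  \<open>Re (1 + z Q''/Q') > 0\<close>, which yields \<open>Re (Q / (z Q')) > 0\<close>, which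
  yields injectivity. Nothing is known on the unit circle. Therefore the extremal arguments run on
  closed discs of radius less than 1, typically at a point of least modulus where a claim would
  first fail, and only the Schwarz lemma and one-sided derivatives are used there.\<close>

lemma not_local_max_if_second_deriv_pos:
  fixes v v' :: "real \<Rightarrow> real"
  assumes "a < t0" "t0 < b"
    and d1: "\<And>t. a < t \<Longrightarrow> t < b \<Longrightarrow> (v has_real_derivative v' t) (at t)"
    and d2: "(v' has_real_derivative l) (at t0)"
    and "v' t0 = 0" "l > 0"
  shows "\<exists>t. a < t \<and> t < b \<and> v t > v t0"
proof -
  obtain d where d: "d > 0" "\<And>h. h > 0 \<Longrightarrow> h < d \<Longrightarrow> v' t0 < v' (t0 + h)"
    using has_real_derivative_pos_inc_right[of v' l t0 UNIV] d2 \<open>l > 0\<close> by auto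
  define e where "e = min d (b - t0) / 2"
  have e: "e > 0" "e < d" "t0 + e < b" using d assms by (auto simp: e_def min_def field_simps)
  have "v t0 < v (t0 + e)"
  proof (rule DERIV_pos_imp_increasing_open[of t0 "t0 + e" v])
    show "\<exists>y. (v has_real_derivative y) (at x) \<and> 0 < y" if "t0 < x" "x < t0 + e" for x
      using d1[of x] d(2)[of "x - t0"] that e assms by (intro exI[of _ "v' x"]) auto
    show "continuous_on {t0..t0 + e} v"
      by (intro continuous_at_imp_continuous_on ballI DERIV_isCont[OF d1]) (use e assms in auto)
  qed (use e in auto)
  then show ?thesis using e assms by (intro exI[of _ "t0 + e"]) auto
qed

text \<open>Follow \<open>\<gamma> = G \<circ> p\<close> along the segment. Where
  \<open>|\<gamma>|\<^sup>2\<close> is critical, \<open>\<gamma>'\<close> is orthogonal to \<gamma>,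
  so \<open>\<gamma>' = i k \<gamma>\<close> with k real, and the second derivative is \<open>2
  k\<^sup>2 |\<gamma>|\<^sup>2 Re (1 + \<gamma> F''(\<gamma>) / F'(\<gamma>)) > 0\<close>. Hence
  there is no interior maximum. The segment must lie in the image beforehand;
  \<open>convex_image_cball\<close> removes this restriction.\<close>

lemma inverse_norm_quasiconvex:
  fixes F G :: "complex \<Rightarrow> complex"
  assumes hF: "F holomorphic_on ball 0 1" and inj: "inj_on F (ball 0 1)"
    and pos: "\<And>z. z \<in> ball 0 1 \<Longrightarrow> Re (1 + z * deriv (deriv F) z / deriv F z) > 0"
    and G: "\<And>z. z \<in> ball 0 1 \<Longrightarrow> G (F z) = z"
    and seg: "closed_segment a b \<subseteq> F ` ball 0 1" and w: "w \<in> closed_segment a b"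
  shows "norm (G w) \<le> max (norm (G a)) (norm (G b))"
proof (cases "a = b")
  case True
  then show ?thesis using w by simp
next
  case False
  define c where "c = b - a"
  have c: "c \<noteq> 0" using False by (simp add: c_def)
  define p where "p = (\<lambda>t::real. a + of_real t * c)"
  have pseg: "p t \<in> F ` ball 0 1" if "0 \<le> t" "t \<le> 1" for t
  proof -
    have "p t \<in> closed_segment a b" using that
      by (auto simp: p_def c_def closed_segment_def scaleR_conv_of_real algebra_simps intro!: exI[of _ t])
    then show ?thesis using seg by auto
  qed
  have dFG: "(G has_field_derivative inverse (deriv F (G x))) (at x)" and Gin: "G x \<in> ball 0 1" 
     and FG: "F (G x) = x"
    if "x \<in> F ` ball 0 1" for x
  proof -
    obtain z where z: "z \<in> ball 0 1" "x = F z" using \<open>x \<in> F ` ball 0 1\<close> by blast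
    have "(G has_field_derivative inverse (deriv F z)) (at (F z))"
    proof (rule has_field_derivative_inverse_strong[where f = F and S = "ball 0 1"])
      show "(F has_field_derivative deriv F z) (at z)"
        using hF z holomorphic_derivI by blast
      show "deriv F z \<noteq> 0"
        using holomorphic_injective_imp_regular[OF hF _ inj] z by auto
    qed (use z G hF in \<open>auto intro: holomorphic_on_imp_continuous_on\<close>)
    then show "(G has_field_derivative inverse (deriv F (G x))) (at x)" "G x \<in> ball 0 1" "F (G x) = x"
      using z G by auto
  qed
  define \<gamma> where "\<gamma> = (\<lambda>t. G (p t))"
  define \<gamma>1 where "\<gamma>1 = (\<lambda>t. c / deriv F (\<gamma> t))"
  have \<gamma>_in: "\<gamma> t \<in> ball 0 1" and nz: "deriv F (\<gamma> t) \<noteq> 0" if "0 \<le> t" "t \<le> 1" for t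
    using Gin[OF pseg[OF that]] holomorphic_injective_imp_regular[OF hF _ inj, of "\<gamma> t"]
    by (auto simp: \<gamma>_def)
  have d\<gamma>: "(\<gamma> has_vector_derivative \<gamma>1 t) (at t)" if "0 \<le> t" "t \<le> 1" for t
  proof -
    have "(p has_vector_derivative c) (at t)"
      unfolding p_def by (auto intro!: derivative_eq_intros)
    from field_vector_diff_chain_at[OF this dFG[OF pseg[OF that]]]
    show ?thesis by (simp add: \<gamma>_def \<gamma>1_def o_def divide_inverse mult.commute)
  qed
  have hF': "deriv F holomorphic_on ball 0 1" using hF by (intro holomorphic_deriv) auto
  define \<gamma>2 where "\<gamma>2 = (\<lambda>t. - (deriv (deriv F) (\<gamma> t) / deriv F (\<gamma> t)) * (\<gamma>1 t)\<^sup>2)"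
  have d\<gamma>1: "(\<gamma>1 has_vector_derivative \<gamma>2 t) (at t)" if "0 \<le> t" "t \<le> 1" for t
  proof -
    have "((\<lambda>z. c / deriv F z) has_field_derivative - c * deriv (deriv F) (\<gamma> t) / (deriv F (\<gamma> t))\<^sup>2) (at (\<gamma> t))"
      using nz[OF that] \<gamma>_in[OF that] 
      by (auto intro!: derivative_eq_intros holomorphic_derivI[OF hF'] simp: power2_eq_square)
    from field_vector_diff_chain_at[OF d\<gamma>[OF that] this]
    show ?thesis by (simp add: \<gamma>1_def \<gamma>2_def o_def power2_eq_square mult_ac)
  qed
  define v where "v = (\<lambda>t. (norm (\<gamma> t))\<^sup>2)"
  define v1 where "v1 = (\<lambda>t. 2 * (\<gamma> t \<bullet> \<gamma>1 t))"
  have dv: "(v has_real_derivative v1 t) (at t)" if "0 \<le> t" "t \<le> 1" for t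
    unfolding v_def v1_def power2_norm_eq_inner has_real_derivative_iff_has_vector_derivative
    using d\<gamma>[OF that] unfolding has_vector_derivative_def
    by (auto intro!: derivative_eq_intros simp: inner_commute)
  have dv1: "(v1 has_real_derivative 2 * (\<gamma> t \<bullet> \<gamma>2 t + \<gamma>1 t \<bullet> \<gamma>1 t)) (at t)" if "0 \<le> t" "t \<le> 1" for t
    unfolding v1_def has_real_derivative_iff_has_vector_derivative
    using d\<gamma>[OF that] d\<gamma>1[OF that] unfolding has_vector_derivative_def
    by (auto intro!: derivative_eq_intros simp: inner_commute algebra_simps)
  have contv: "continuous_on {0..1} v"
    by (intro continuous_at_imp_continuous_on ballI DERIV_isCont[OF dv]) auto
  obtain t0 where t0: "t0 \<in> {0..1}" "\<And>t. t \<in> {0..1} \<Longrightarrow> v t \<le> v t0"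
    using continuous_attains_sup[OF _ _ contv] by auto
  have key: "v t0 \<le> max (v 0) (v 1)"
  proof (rule ccontr)
    assume neg: "\<not> ?thesis"
    then have int: "0 < t0" "t0 < 1" using t0 by (auto simp: less_le max_def split: if_splits)
    \<comment> \<open>A maximum above both end values is positive, so the point z below is nonzero
      and k can be formed.\<close>
    have "0 \<le> v 0" "v 0 \<le> max (v 0) (v 1)" by (auto simp: v_def)
    then have vpos: "v t0 > 0" using neg by linarith
    have z0: "v1 t0 = 0"
    proof (rule DERIV_local_max[of v _ t0 "min t0 (1 - t0)"])
      show "\<forall>y. \<bar>t0 - y\<bar> < min t0 (1 - t0) \<longrightarrow> v y \<le> v t0"
        by (intro allI impI t0(2)) (auto simp: abs_if split: if_splits)
    qed (use dv int in auto)
    define z where "z = \<gamma> t0"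
    define d where "d = \<gamma>1 t0"
    define m where "m = deriv (deriv F) z / deriv F z"
    have zin: "z \<in> ball 0 1" and znz: "z \<noteq> 0" using \<gamma>_in int vpos by (auto simp: z_def v_def)
    have dnz: "d \<noteq> 0" using c nz int by (auto simp: d_def \<gamma>1_def)
    have crit: "Re z * Re d + Im z * Im d = 0" using z0 by (simp add: v1_def z_def d_def inner_complex_def)
    \<comment> \<open>k is the coordinate of d in the tangential direction \<open>i z\<close>; by
      \<open>crit\<close> the radial coordinate vanishes.\<close>
    define k where "k = (Re z * Im d - Im z * Re d) / (norm z)\<^sup>2"
    have nz2: "(norm z)\<^sup>2 \<noteq> 0" using znz by simp
    then have kN: "k * (norm z)\<^sup>2 = Re z * Im d - Im z * Re d" by (simp add: k_def)
    have d_eq: "d = \<i> * of_real k * z"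
    proof (rule complex_eqI)
      have "Re d * ((Re z)\<^sup>2 + (Im z)\<^sup>2) = - (Re z * Im d - Im z * Re d) * Im z"
        using crit by algebra
      then have "Re d * (norm z)\<^sup>2 = - k * Im z * (norm z)\<^sup>2"
        unfolding kN[symmetric] by (simp add: cmod_power2)
      then have "Re d = - k * Im z" using mult_right_cancel[OF nz2] by blast
      then show "Re d = Re (\<i> * of_real k * z)" by simp
      have "Im d * ((Re z)\<^sup>2 + (Im z)\<^sup>2) = (Re z * Im d - Im z * Re d) * Re z"
        using crit by algebra
      then have "Im d * (norm z)\<^sup>2 = k * Re z * (norm z)\<^sup>2"
        unfolding kN[symmetric] by (simp add: cmod_power2)
      then have "Im d = k * Re z" using mult_right_cancel[OF nz2] by blast
      then show "Im d = Im (\<i> * of_real k * z)" by simp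
    qed
    have knz: "k \<noteq> 0" using d_eq dnz by auto
    have g2: "\<gamma>2 t0 = of_real (k\<^sup>2) * (m * z) * z"
    proof -
      have "\<gamma>2 t0 = - m * d\<^sup>2" by (simp add: \<gamma>2_def m_def z_def d_def)
      then show ?thesis by (simp add: d_eq power_mult_distrib power2_eq_square mult_ac)
    qed
    have "z \<bullet> \<gamma>2 t0 + d \<bullet> d = k\<^sup>2 * (norm z)\<^sup>2 * Re (1 + z * m)"
      unfolding g2 d_eq cmod_power2 by (simp add: inner_complex_def power2_eq_square algebra_simps)
    moreover have "Re (1 + z * m) > 0" using pos[OF zin] by (simp add: m_def)
    ultimately have "2 * (\<gamma> t0 \<bullet> \<gamma>2 t0 + \<gamma>1 t0 \<bullet> \<gamma>1 t0) > 0"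
      using knz znz by (simp add: z_def d_def)
    from not_local_max_if_second_deriv_pos[of 0 t0 1 v v1, OF int _ dv1 z0 this] dv int
    obtain t where "0 < t" "t < 1" "v t > v t0" by auto
    then show False using t0(2)[of t] by auto
  qed
  obtain t where t: "0 \<le> t" "t \<le> 1" "w = (1 - t) *\<^sub>R a + t *\<^sub>R b"
    using w by (auto simp: closed_segment_def)
  then have wp: "w = p t" by (simp add: p_def c_def scaleR_conv_of_real algebra_simps)
  have "v t \<le> max (v 0) (v 1)" using t0(2)[of t] key t by auto
  moreover have "v t = (norm (G w))\<^sup>2" "v 0 = (norm (G a))\<^sup>2" "v 1 = (norm (G b))\<^sup>2"
    by (auto simp: v_def \<gamma>_def wp p_def c_def)
  ultimately show ?thesis
    by (simp add: le_max_iff_disj power2_le_iff_abs_le)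
qed

text \<open>Continuity method: the end points are shrunk to \<open>u z1\<close> and
  \<open>u z2\<close>. By \<open>inverse_norm_quasiconvex\<close> a segment inside the image of
  \<open>ball 0 r\<close> already lies in the image of \<open>cball 0 s\<close>, so while u grows
  from 0 to 1 it cannot pass from the smaller closed image to a position leaving the larger open
  one.\<close>

lemma convex_image_cball:
  fixes F :: "complex \<Rightarrow> complex"
  assumes hF: "F holomorphic_on ball 0 1" and inj: "inj_on F (ball 0 1)"
    and pos: "\<And>z. z \<in> ball 0 1 \<Longrightarrow> Re (1 + z * deriv (deriv F) z / deriv F z) > 0"
    and s: "0 < s" "s < 1"
  shows "convex (F ` cball 0 s)"
proof -
  \<comment> \<open>Any radius strictly between s and 1 works: it separates the closed condition
    defining \<open>A\<close> from the closed condition defining \<open>B\<close>.\<close>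
  define r where "r = (s + 1) / 2"
  have r: "s < r" "r < 1" using s by (auto simp: r_def)
  obtain G where G: "\<And>z. z \<in> ball 0 1 \<Longrightarrow> G (F z) = z"
    using holomorphic_has_inverse[OF hF open_ball inj] by metis
  have contF: "continuous_on (ball 0 1) F" using hF holomorphic_on_imp_continuous_on by blast
  have "closed_segment (F z1) (F z2) \<subseteq> F ` cball 0 s" if z: "z1 \<in> cball 0 s" "z2 \<in> cball 0 s" for z1 z2
  proof -
    define H where "H = (\<lambda>(u::real, t::real). (1 - t) *\<^sub>R F (u *\<^sub>R z1) + t *\<^sub>R F (u *\<^sub>R z2))"
    have in_s: "u *\<^sub>R z \<in> cball 0 s" if "u \<in> {0..1}" "z \<in> cball 0 s" for u and z :: complex
      using that mult_mono[of u 1 "norm z" s] by auto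
    have contH: "continuous_on ({0..1} \<times> {0..1}) H"
    proof -
      have "continuous_on ({0..1} \<times> {0..1}) (\<lambda>x. F (fst x *\<^sub>R z))" if "z \<in> cball 0 s" for z
        by (rule continuous_on_compose2[OF contF])
           (use in_s that s in \<open>auto intro!: continuous_intros simp: subset_iff dest!: in_s[OF _ that]\<close>)
      then show ?thesis using z unfolding H_def case_prod_beta by (intro continuous_intros) auto
    qed
    have clF: "closed (F ` cball 0 s)"
      by (intro compact_imp_closed compact_continuous_image continuous_on_subset[OF contF]) (use s in auto)
    have opF: "open (F ` ball 0 r)"
      by (rule open_mapping_thm3) (use r inj hF in \<open>auto intro: inj_on_subset holomorphic_on_subset\<close>)
    define A where "A = {u\<in>{0..1}. \<forall>t\<in>{0..1}. H (u, t) \<in> F ` cball 0 s}"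
    define B where "B = {u\<in>{0..1}. \<exists>t\<in>{0..1}. H (u, t) \<notin> F ` ball 0 r}"
    have clA: "closed A"
    proof -
      have "A = (\<Inter>t\<in>{0..1}. {0..1} \<inter> (\<lambda>u. H (u, t)) -` (F ` cball 0 s))"
        by (auto simp: A_def)
      moreover have "closed ({0..1} \<inter> (\<lambda>u. H (u, t)) -` (F ` cball 0 s))" if "t \<in> {0..1}" for t
        by (intro continuous_closed_preimage clF continuous_on_compose2[OF contH])
           (use that in \<open>auto intro!: continuous_intros\<close>)
      ultimately show ?thesis by (simp only:) (intro closed_INT ballI)
    qed
    have clB: "closed B"
    proof -
      \<comment> \<open>\<open>B\<close> is a projection along the compact parameter t, hence closed
        although it is defined by an existential.\<close>
      have "B = fst ` (({0..1} \<times> {0..1}) \<inter> H -` (- (F ` ball 0 r)))"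
      proof (intro subset_antisym subsetI)
        fix u assume "u \<in> B"
        then obtain t where "u \<in> {0..1}" "t \<in> {0..1}" "H (u, t) \<notin> F ` ball 0 r"
          unfolding B_def by blast
        then show "u \<in> fst ` (({0..1} \<times> {0..1}) \<inter> H -` (- (F ` ball 0 r)))"
          by (intro image_eqI[of _ _ "(u, t)"]) (auto simp del: image_iff)
      next
        fix u assume "u \<in> fst ` (({0..1} \<times> {0..1}) \<inter> H -` (- (F ` ball 0 r)))"
        then show "u \<in> B" unfolding B_def by fastforce
      qed
      moreover have "compact (({0..1} \<times> {0..1}) \<inter> H -` (- (F ` ball 0 r)))"
        unfolding compact_eq_bounded_closed
      proof
        show "bounded (({0..1} \<times> {0..1}) \<inter> H -` (- (F ` ball 0 r)))"
          by (intro bounded_Int disjI1 bounded_Times bounded_closed_interval)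
        show "closed (({0..1} \<times> {0..1}) \<inter> H -` (- (F ` ball 0 r)))"
          by (intro continuous_closed_preimage contH closed_Times) (use opF in auto)
      qed
      ultimately show ?thesis
        by (auto intro!: compact_imp_closed compact_continuous_image continuous_intros)
    qed
    have seg_eq: "closed_segment (F (u *\<^sub>R z1)) (F (u *\<^sub>R z2)) = (\<lambda>t. H (u, t)) ` {0..1}" for u
      by (auto simp: H_def closed_segment_def)
    have cover: "{0..1} \<subseteq> A \<union> B"
    proof
      fix u :: real assume u: "u \<in> {0..1}"
      show "u \<in> A \<union> B"
      proof (cases "u \<in> B")
        case False
        then have sub: "closed_segment (F (u *\<^sub>R z1)) (F (u *\<^sub>R z2)) \<subseteq> F ` ball 0 r"
          using u unfolding seg_eq B_def by auto
        also have "\<dots> \<subseteq> F ` ball 0 1" using r by auto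
        finally have sub1: "closed_segment (F (u *\<^sub>R z1)) (F (u *\<^sub>R z2)) \<subseteq> F ` ball 0 1" .
        have "w \<in> F ` cball 0 s" if w: "w \<in> closed_segment (F (u *\<^sub>R z1)) (F (u *\<^sub>R z2))" for w
        proof -
          have "norm (G w) \<le> max (norm (G (F (u *\<^sub>R z1)))) (norm (G (F (u *\<^sub>R z2))))"
            by (rule inverse_norm_quasiconvex[OF hF inj pos G sub1 w])
          moreover have "u *\<^sub>R z1 \<in> cball 0 s" "u *\<^sub>R z2 \<in> cball 0 s" using in_s u z by auto
          ultimately have "norm (G w) \<le> s" using G[of "u *\<^sub>R z1"] G[of "u *\<^sub>R z2"] s by auto
          moreover obtain x where "x \<in> ball 0 1" "w = F x" using subsetD[OF sub1 w] by (rule imageE)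
          ultimately show ?thesis using G[of x] by (intro image_eqI[of _ _ x]) simp_all
        qed
        then have "u \<in> A" using u unfolding seg_eq A_def by auto
        then show ?thesis by auto
      qed auto
    qed
    have "A \<inter> B \<inter> {0..1} = {}" using r by (fastforce simp: A_def B_def)
    from connected_closedD[OF connected_Icc this cover clA clB]
    have "A \<inter> {0..1} = {} \<or> B \<inter> {0..1} = {}" .
    \<comment> \<open>At u = 0 the segment degenerates to the point \<open>F 0\<close>.\<close>
    moreover have "0 \<in> A" using s by (auto simp: A_def H_def scaleR_conv_of_real algebra_simps)
    ultimately have "B \<inter> {0..1} = {}" by auto
    then have "1 \<in> A" using subsetD[OF cover, of 1] by auto
    then show ?thesis using seg_eq[of 1] by (auto simp: A_def)
  qed
  then show ?thesis by (auto simp: convex_contains_segment)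
qed

subsection \<open>Starlike maps and convex primitives\<close>

text \<open>With G the inverse of q, the map \<open>G (t q(z))\<close> is a self-map of the disc
  that fixes 0, and the Schwarz lemma applies.\<close>

lemma starlike_preimage_norm_le:
  fixes q :: "complex \<Rightarrow> complex"
  assumes hol: "q holomorphic_on ball 0 1" and inj: "inj_on q (ball 0 1)" and q0: "q 0 = 0"
    and star: "\<And>z t. z \<in> ball 0 1 \<Longrightarrow> 0 \<le> t \<Longrightarrow> t \<le> 1 \<Longrightarrow> of_real t * q z \<in> q ` ball 0 1"
    and z: "z \<in> ball 0 1" and \<zeta>: "\<zeta> \<in> ball 0 1" and t: "0 \<le> t" "t \<le> 1" and eq: "q \<zeta> = of_real t * q z"
  shows "norm \<zeta> \<le> norm z"
proof -
  obtain G where G: "G holomorphic_on q ` ball 0 1" "\<And>z. z \<in> ball 0 1 \<Longrightarrow> G (q z) = z"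
    using holomorphic_has_inverse[OF hol open_ball inj] by metis
  define w where "w = (\<lambda>z. G (of_real t * q z))"
  have "norm (w z) \<le> norm z"
  proof (rule Schwarz_Lemma(1))
    show "w holomorphic_on ball 0 1"
    proof -
      have "(G \<circ> (\<lambda>z. of_real t * q z)) holomorphic_on ball 0 1"
        by (rule holomorphic_on_compose_gen[OF _ G(1)]) (use star t hol in \<open>auto intro!: holomorphic_intros\<close>)
      then show ?thesis by (simp add: w_def o_def)
    qed
    show "w 0 = 0" using G(2)[of 0] q0 by (simp add: w_def)
    fix x :: complex assume "norm x < 1"
    then obtain y where "y \<in> ball 0 1" "of_real t * q x = q y"
      using star[of x t] t by (auto simp: image_iff)
    then show "norm (w x) < 1" using G(2)[of y] by (simp add: w_def)
  qed (use z in auto)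
  also have "w z = \<zeta>" using G(2)[OF \<zeta>] eq by (simp add: w_def)
  finally show ?thesis .
qed

text \<open>The curve \<open>G (t q(z))\<close> reaches z at t = 1 and has modulus at most
  \<open>|z|\<close> before, so its squared modulus has a nonnegative derivative at 1. That
  derivative is \<open>2 |q/q'|\<^sup>2 Re (z q'/q)\<close>.\<close>

lemma starlike_map_Re_nonneg:
  fixes q :: "complex \<Rightarrow> complex"
  assumes hol: "q holomorphic_on ball 0 1" and inj: "inj_on q (ball 0 1)" and q0: "q 0 = 0"
    and star: "\<And>z t. z \<in> ball 0 1 \<Longrightarrow> 0 \<le> t \<Longrightarrow> t \<le> 1 \<Longrightarrow> of_real t * q z \<in> q ` ball 0 1"
    and z: "z \<in> ball 0 1" "z \<noteq> 0"
  shows "Re (z * deriv q z / q z) \<ge> 0"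
proof -
  obtain G where G: "\<And>z. z \<in> ball 0 1 \<Longrightarrow> G (q z) = z"
    using holomorphic_has_inverse[OF hol open_ball inj] by metis
  have qz: "q z \<noteq> 0" using inj_onD[OF inj, of z 0] z q0 by auto
  have q'z: "deriv q z \<noteq> 0" using holomorphic_injective_imp_regular[OF hol _ inj] z by auto
  have dG: "(G has_field_derivative inverse (deriv q z)) (at (q z))"
    by (rule has_field_derivative_inverse_strong[where f = q and S = "ball 0 1"])
       (use z G hol q'z in \<open>auto intro: holomorphic_on_imp_continuous_on holomorphic_derivI\<close>)
  define \<gamma> where "\<gamma> = (\<lambda>t::real. G (of_real t * q z))"
  have d\<gamma>: "(\<gamma> has_vector_derivative q z / deriv q z) (at 1)"
  proof -
    have "((\<lambda>t::real. of_real t * q z) has_vector_derivative q z) (at 1)"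
      by (auto intro!: derivative_eq_intros)
    from field_vector_diff_chain_at[OF this, of G] dG
    show ?thesis by (simp add: \<gamma>_def o_def divide_inverse)
  qed
  define v where "v = (\<lambda>t. \<gamma> t \<bullet> \<gamma> t)"
  have \<gamma>1: "\<gamma> 1 = z" using G z by (simp add: \<gamma>_def)
  have dv: "(v has_real_derivative 2 * (z \<bullet> (q z / deriv q z))) (at 1)"
    unfolding v_def has_real_derivative_iff_has_vector_derivative
    using d\<gamma> unfolding has_vector_derivative_def
    by (auto intro!: derivative_eq_intros simp: inner_commute \<gamma>1)
  have vle: "v t \<le> v 1" if t: "0 \<le> t" "t \<le> 1" for t
  proof -
    obtain y where y: "y \<in> ball 0 1" "of_real t * q z = q y"
      using star[OF z(1) t] by (auto simp: image_iff)
    have "norm y \<le> norm z"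
      by (rule starlike_preimage_norm_le[OF hol inj q0 star z(1) y(1) t]) (use y in auto)
    then show ?thesis using y G[of y] G[OF z(1)]
      by (simp add: v_def \<gamma>_def dot_square_norm)
  qed
  have "z \<bullet> (q z / deriv q z) \<ge> 0"
  proof (rule ccontr)
    assume "\<not> ?thesis"
    then obtain d where d: "d > 0" "\<And>h. h > 0 \<Longrightarrow> h < d \<Longrightarrow> v 1 < v (1 - h)"
      using has_real_derivative_neg_dec_left[of v _ 1 UNIV, OF dv] by auto
    have h: "0 < min d 1 / 2" "min d 1 / 2 < d" "0 \<le> 1 - min d 1 / 2" "1 - min d 1 / 2 \<le> 1"
      using d(1) by (auto simp: min_def)
    from d(2)[OF h(1,2)] vle[OF h(3,4)] show False by simp
  qed
  also have "z \<bullet> (q z / deriv q z) = (norm (q z / deriv q z))\<^sup>2 * Re (z * deriv q z / q z)"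
  proof -
    have *: "z \<bullet> w = (norm w)\<^sup>2 * Re (z / w)" if "w \<noteq> 0" for w
    proof -
      have "(Re w)\<^sup>2 + (Im w)\<^sup>2 \<noteq> 0" using that by (auto simp: complex_eq_iff)
      then show ?thesis by (simp add: Re_divide cmod_power2 inner_complex_def)
    qed
    show ?thesis using *[of "q z / deriv q z"] qz q'z by simp
  qed
  finally show ?thesis using qz q'z
    by (simp add: zero_le_mult_iff)
qed

text \<open>Alexander's relation: \<open>q = z Q'\<close> gives
  \<open>1 + z Q''/Q' = z q'/q\<close>, whose real part is nonnegative by
  \<open>starlike_map_Re_nonneg\<close>.\<close>

lemma starlike_primitive_Re_pos:
  fixes q Q :: "complex \<Rightarrow> complex"
  assumes hol: "q holomorphic_on ball 0 1" and inj: "inj_on q (ball 0 1)"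
    and star: "\<And>z t. z \<in> ball 0 1 \<Longrightarrow> 0 \<le> t \<Longrightarrow> t \<le> 1 \<Longrightarrow> of_real t * q z \<in> q ` ball 0 1"
    and holQ: "Q holomorphic_on ball 0 1"
    and qQ: "\<And>z. z \<in> ball 0 1 \<Longrightarrow> q z = z * deriv Q z"
    and z: "z \<in> ball 0 1"
  shows "deriv Q z \<noteq> 0" "Re (1 + z * deriv (deriv Q) z / deriv Q z) > 0"
proof -
  have holQ': "deriv Q holomorphic_on ball 0 1" by (intro holomorphic_deriv holQ) auto
  have holQ'': "deriv (deriv Q) holomorphic_on ball 0 1" by (intro holomorphic_deriv holQ') auto
  have q0: "q 0 = 0" using qQ[of 0] by simp
  have dq: "deriv q z = deriv Q z + z * deriv (deriv Q) z" if "z \<in> ball 0 1" for z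
  proof -
    have "((\<lambda>z. z * deriv Q z) has_field_derivative deriv Q z + z * deriv (deriv Q) z) (at z)"
      using holomorphic_derivI[OF holQ' _ that] by (auto intro!: derivative_eq_intros)
    then have "(q has_field_derivative deriv Q z + z * deriv (deriv Q) z) (at z)"
      by (rule has_field_derivative_transform_within_open[OF _ open_ball that]) (use qQ in auto)
    then show ?thesis by (rule DERIV_imp_deriv)
  qed
  \<comment> \<open>At 0 the equation \<open>q = z Q'\<close> does not determine
    \<open>Q' 0\<close>; there its derivative gives \<open>Q' 0 = q' 0\<close>, which is nonzero by
    univalence.\<close>
  have Q'nz: "deriv Q z \<noteq> 0" if "z \<in> ball 0 1" for z
  proof (cases "z = 0")
    case True
    then show ?thesis
      using holomorphic_injective_imp_regular[OF hol _ inj, of 0] dq[of 0] by auto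
  next
    case False
    then have "q z \<noteq> 0" using inj_onD[OF inj, of z 0] that q0 by auto
    then show ?thesis using qQ[OF that] by auto
  qed
  then show "deriv Q z \<noteq> 0" using z by auto
  define c where "c = (\<lambda>z. 1 + z * deriv (deriv Q) z / deriv Q z)"
  have holc: "c holomorphic_on ball 0 1"
    unfolding c_def by (intro holomorphic_intros holQ' holQ'' Q'nz)
  have c_ge: "Re (c w) \<ge> 0" if "w \<in> ball 0 1" for w
  proof (cases "w = 0")
    case False
    have "c w = w * deriv q w / q w"
      using dq[OF that] qQ[OF that] Q'nz[OF that] False by (simp add: c_def field_simps)
    then show ?thesis using starlike_map_Re_nonneg[OF hol inj q0 star that False] by simp
  qed (simp add: c_def)
  show "Re (1 + z * deriv (deriv Q) z / deriv Q z) > 0"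
  proof (rule ccontr)
    assume "\<not> ?thesis"
    then have cz: "Re (c z) = 0" using c_ge[OF z] by (simp add: c_def)
    \<comment> \<open>Strictness: a zero of \<open>Re c\<close> maximises
      \<open>|exp (- c)|\<close>, so this function would be constant, against
      \<open>c 0 = 1\<close>.\<close>
    have "(\<lambda>w. exp (- c w)) constant_on ball 0 1"
      by (rule maximum_modulus_principle[of _ _ "ball 0 1" z])
         (use c_ge cz z in \<open>auto intro!: holomorphic_intros holc\<close>)
    then have "exp (- c 0) = exp (- c z)" using z unfolding constant_on_def by (metis centre_in_ball zero_less_one)
    then have "norm (exp (- c 0)) = norm (exp (- c z))" by simp
    then show False using cz by (simp add: c_def)
  qed
qed

text \<open>\<open>D z0\<close> is the radial and \<open>D (i z0)\<close> the tangential derivative.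
  Both extremal arguments in the style of Jack's lemma below start from these two relations.\<close>

lemma boundary_max_derivative:
  fixes u :: "complex \<Rightarrow> real"
  assumes der: "(u has_derivative D) (at z0)"
    and max: "\<And>z. norm z \<le> norm z0 \<Longrightarrow> u z \<le> u z0"
  shows "D z0 \<ge> 0" "D (\<i> * z0) = 0"
proof -
  have lin: "linear D" using der has_derivative_linear by blast
  show "D z0 \<ge> 0"
  proof (rule ccontr)
    assume neg: "\<not> ?thesis"
    have "((\<lambda>t. u (t *\<^sub>R z0)) has_derivative (\<lambda>t. D (t *\<^sub>R z0))) (at 1)"
      by (rule has_derivative_compose[where g = u]) (use der in \<open>auto intro!: derivative_eq_intros\<close>)
    then have "((\<lambda>t. u (t *\<^sub>R z0)) has_real_derivative D z0) (at 1)"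
      unfolding has_field_derivative_def
      by (rule has_derivative_eq_rhs) (auto simp: fun_eq_iff linear_cmul[OF lin])
    then obtain d where d: "d > 0" "\<And>h. h > 0 \<Longrightarrow> h < d \<Longrightarrow> u z0 < u ((1 - h) *\<^sub>R z0)"
      using has_real_derivative_neg_dec_left[of "\<lambda>t. u (t *\<^sub>R z0)" "D z0" 1 UNIV] neg by auto
    define h where "h = min d 1 / 2"
    have h: "h > 0" "h < d" "h < 1" using d by (auto simp: h_def min_def)
    have "norm ((1 - h) *\<^sub>R z0) \<le> norm z0"
      using h by (simp add: mult_left_le_one_le)
    then show False using d(2)[OF h(1,2)] max by fastforce
  qed
  have "((\<lambda>t. u (cis t * z0)) has_derivative (\<lambda>t. D (t *\<^sub>R (\<i> * z0)))) (at 0)"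
    by (rule has_derivative_compose[where g = u])
       (use der in \<open>auto intro!: derivative_eq_intros simp: scaleR_conv_of_real\<close>)
  then have "((\<lambda>t. u (cis t * z0)) has_real_derivative D (\<i> * z0)) (at 0)"
    unfolding has_field_derivative_def
    by (rule has_derivative_eq_rhs) (auto simp: fun_eq_iff linear_cmul[OF lin])
  then show "D (\<i> * z0) = 0"
    by (rule DERIV_local_max[of _ _ 0 1]) (auto intro!: max simp: norm_mult)
qed

text \<open>The factorisation holds for every z, not just in the disc, because \<open>S\<close> is
  the plain quotient off 0; later rewriting is free of side conditions.\<close>

lemma holomorphic_divide_id:
  assumes "F holomorphic_on ball 0 R" "F 0 = 0" "R > 0"
  obtains S where "S holomorphic_on ball 0 R" "\<And>z. F z = z * S z" "S 0 = deriv F 0"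
proof
  have "(\<lambda>z. if z = 0 then deriv F 0 else (F z - F 0) / (z - 0)) holomorphic_on ball 0 R"
    by (rule pole_lemma) (use assms in auto)
  then show "(\<lambda>z. if z = 0 then deriv F 0 else F z / z) holomorphic_on ball 0 R"
    by (rule holomorphic_transform) (use assms in auto)
qed (use assms in auto)

text \<open>\<open>B = Q / (z Q')\<close> solves \<open>z B' = 1 - B c\<close> with
  \<open>c = 1 + z Q''/Q'\<close> and \<open>B 0 = 1\<close>. At a first point z0 where
  \<open>Re B\<close> vanishes, \<open>z0 B'(z0)\<close> is real and nonpositive. The imaginary part
  of the equation then forces \<open>B z0 = 0\<close>, whereupon the equation reads
  \<open>z0 B'(z0) = 1\<close>.\<close>

lemma convex_imp_starlike:
  fixes Q S :: "complex \<Rightarrow> complex"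
  assumes holQ: "Q holomorphic_on ball 0 1"
    and holS: "S holomorphic_on ball 0 1" and S: "\<And>z. Q z = z * S z"
    and nz: "\<And>z. z \<in> ball 0 1 \<Longrightarrow> deriv Q z \<noteq> 0"
    and pos: "\<And>z. z \<in> ball 0 1 \<Longrightarrow> Re (1 + z * deriv (deriv Q) z / deriv Q z) > 0"
    and z: "z \<in> ball 0 1"
  shows "Re (S z / deriv Q z) > 0"
proof (rule ccontr)
  assume neg: "\<not> ?thesis"
  have holQ': "deriv Q holomorphic_on ball 0 1" by (intro holomorphic_deriv holQ) auto
  define B where "B = (\<lambda>z. S z / deriv Q z)"
  have holB: "B holomorphic_on ball 0 1" unfolding B_def by (intro holomorphic_intros holS holQ' nz)
  define c where "c = (\<lambda>z. 1 + z * deriv (deriv Q) z / deriv Q z)"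
  have eqS: "z * (deriv Q z * B z) = Q z" if "z \<in> ball 0 1" for z
    using S[of z] nz[OF that] by (simp add: B_def)
  have dB: "z * deriv B z = 1 - B z * c z" if "z \<in> ball 0 1" for z
  proof -
    have "((\<lambda>z. z * (deriv Q z * B z)) has_field_derivative 
        deriv Q z * B z + z * (deriv (deriv Q) z * B z + deriv Q z * deriv B z)) (at z)"
      using holomorphic_derivI[OF holQ' _ that] holomorphic_derivI[OF holB _ that]
      by (auto intro!: derivative_eq_intros simp: algebra_simps)
    then have "(Q has_field_derivative 
        deriv Q z * B z + z * (deriv (deriv Q) z * B z + deriv Q z * deriv B z)) (at z)"
      by (rule has_field_derivative_transform_within_open[OF _ open_ball that]) (use eqS in auto)
    then have "deriv Q z = deriv Q z * B z + z * (deriv (deriv Q) z * B z + deriv Q z * deriv B z)"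
      using holomorphic_derivI[OF holQ _ that] DERIV_unique by blast
    then show ?thesis using nz[OF that] by (simp add: c_def field_simps)
  qed
  have B0: "B 0 = 1"
  proof -
    have "((\<lambda>z. z * S z) has_field_derivative S 0) (at 0)"
      using holomorphic_derivI[OF holS, of 0] by (auto intro!: derivative_eq_intros)
    then have "(Q has_field_derivative S 0) (at 0)"
      by (rule has_field_derivative_transform_within_open[OF _ open_ball[of 0 1]]) (use S in auto)
    then have "deriv Q 0 = S 0" by (rule DERIV_imp_deriv)
    then show ?thesis using nz[of 0] by (simp add: B_def)
  qed
  define Z where "Z = cball 0 (norm z) \<inter> {w. Re (B w) \<le> 0}"
  have contB: "continuous_on (ball 0 1) B" using holB holomorphic_on_imp_continuous_on by blast
  have sub: "cball 0 (norm z) \<subseteq> ball 0 1" using z by auto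
  have "compact Z"
  proof -
    have "closed (cball 0 (norm z) \<inter> (\<lambda>w. Re (B w)) -` {..0})"
      by (intro continuous_closed_preimage continuous_intros continuous_on_subset[OF contB] sub) auto
    moreover have "Z = cball 0 (norm z) \<inter> (\<lambda>w. Re (B w)) -` {..0}" by (auto simp: Z_def)
    ultimately show ?thesis by (simp add: compact_eq_bounded_closed bounded_Int)
  qed
  moreover have "z \<in> Z" using neg by (simp add: Z_def B_def)
  ultimately obtain z0 where z0: "z0 \<in> Z" "\<And>w. w \<in> Z \<Longrightarrow> norm z0 \<le> norm w"
    using continuous_attains_inf[of Z norm] continuous_on_norm_id by blast
  have z0in: "z0 \<in> ball 0 1" using z0(1) subsetD[OF sub, of z0] by (auto simp: Z_def)
  have z0nz: "z0 \<noteq> 0" using z0 B0 by (auto simp: Z_def)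
  have inner: "Re (B w) \<ge> 0" if "w \<in> cball 0 (norm z0)" for w
  proof -
    have cl: "closure (ball 0 (norm z0)) = cball (0::complex) (norm z0)" using z0nz by simp
    show ?thesis
    proof (rule continuous_ge_on_closure[of "ball 0 (norm z0)" "\<lambda>w. Re (B w)"])
      show "continuous_on (closure (ball 0 (norm z0))) (\<lambda>w. Re (B w))"
        unfolding cl by (intro continuous_intros continuous_on_subset[OF contB]) (use z0in in auto)
      show "w \<in> closure (ball 0 (norm z0))" unfolding cl by (rule that)
      show "0 \<le> Re (B x)" if "x \<in> ball 0 (norm z0)" for x
        using z0(2)[of x] that z0(1) by (force simp: Z_def)
    qed
  qed
  have Re0: "Re (B z0) = 0" using inner[of z0] z0(1) by (auto simp: Z_def)
  have "((\<lambda>w. - Re (B w)) has_derivative (\<lambda>h. - Re (deriv B z0 * h))) (at z0)"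
    using holomorphic_derivI[OF holB _ z0in] unfolding has_field_derivative_def
    by (auto intro!: derivative_eq_intros)
  note bm = boundary_max_derivative[OF this]
  have "- Re (deriv B z0 * z0) \<ge> 0" by (rule bm(1)) (use inner Re0 in auto)
  moreover have "- Re (deriv B z0 * (\<i> * z0)) = 0" by (rule bm(2)) (use inner Re0 in auto)
  ultimately have d: "Re (z0 * deriv B z0) \<le> 0" "Im (z0 * deriv B z0) = 0"
    by (auto simp: algebra_simps)
  have "Im (B z0) * Re (c z0) = 0" using d(2) dB[OF z0in] Re0 by simp
  moreover have "Re (c z0) > 0" using pos[OF z0in] by (simp add: c_def)
  ultimately have "B z0 = 0" using Re0 by (simp add: complex_eq_iff)
  then show False using d(1) dB[OF z0in] by simp
qed

text \<open>Noshiro-Warschawski: the component of W in the direction \<open>c = b - a\<close>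
  increases strictly along the segment from a to b, its derivative being
  \<open>|c|\<^sup>2 Re W'\<close>.\<close>

lemma inj_on_if_Re_deriv_pos:
  fixes W W' :: "complex \<Rightarrow> complex"
  assumes "convex A"
    and der: "\<And>z. z \<in> A \<Longrightarrow> (W has_field_derivative W' z) (at z)"
    and pos: "\<And>z. z \<in> A \<Longrightarrow> Re (W' z) > 0"
  shows "inj_on W A"
proof (rule inj_onI, rule ccontr)
  fix a b assume ab: "a \<in> A" "b \<in> A" "W a = W b" "a \<noteq> b"
  define c where "c = b - a"
  have cnz: "c \<noteq> 0" using ab by (simp add: c_def)
  define p where "p = (\<lambda>t::real. a + of_real t * c)"
  have pin: "p t \<in> A" if "0 \<le> t" "t \<le> 1" for t
  proof -
    have "p t = (1 - t) *\<^sub>R a + t *\<^sub>R b" by (simp add: p_def c_def scaleR_conv_of_real algebra_simps)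
    then show ?thesis using convexD_alt[OF \<open>convex A\<close> ab(1,2) that] by simp
  qed
  have "c \<bullet> W (p 0) < c \<bullet> W (p 1)"
  proof (rule DERIV_pos_imp_increasing[of 0 "1::real" "\<lambda>t. c \<bullet> W (p t)"])
    fix t :: real assume t: "0 \<le> t" "t \<le> 1"
    have "(p has_vector_derivative c) (at t)"
      unfolding p_def by (auto intro!: derivative_eq_intros)
    from field_vector_diff_chain_at[OF this der[OF pin[OF t]]]
    have "((\<lambda>t. W (p t)) has_vector_derivative c * W' (p t)) (at t)" by (simp add: o_def)
    then have "((\<lambda>t. c \<bullet> W (p t)) has_real_derivative c \<bullet> (c * W' (p t))) (at t)"
      unfolding has_real_derivative_iff_has_vector_derivative has_vector_derivative_def
      by (auto intro!: derivative_eq_intros)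
    moreover have "c \<bullet> (c * W' (p t)) = (norm c)\<^sup>2 * Re (W' (p t))"
      unfolding cmod_power2 by (simp add: inner_complex_def power2_eq_square algebra_simps)
    ultimately show "\<exists>y. ((\<lambda>t. c \<bullet> W (p t)) has_real_derivative y) (at t) \<and> y > 0"
      using pos[OF pin[OF t]] cnz by auto
  qed auto
  then show False using ab by (simp add: p_def c_def)
qed

text \<open>In the coordinate \<open>u = ln z\<close>, starlikeness says that \<open>ln (Q (exp u))\<close> has a derivative with
  positive real part on the convex half-plane \<open>Re u < 0\<close>.\<close>

lemma convex_imp_inj:
  fixes Q :: "complex \<Rightarrow> complex"
  assumes holQ: "Q holomorphic_on ball 0 1" and Q0: "Q 0 = 0"
    and nz: "\<And>z. z \<in> ball 0 1 \<Longrightarrow> deriv Q z \<noteq> 0"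
    and pos: "\<And>z. z \<in> ball 0 1 \<Longrightarrow> Re (1 + z * deriv (deriv Q) z / deriv Q z) > 0"
  shows "inj_on Q (ball 0 1)"
proof -
  obtain S where holS: "S holomorphic_on ball 0 1" and S: "\<And>z. Q z = z * S z"
    using holomorphic_divide_id[OF holQ Q0] by auto
  have Bpos: "Re (S z / deriv Q z) > 0" if "z \<in> ball 0 1" for z
    by (rule convex_imp_starlike[OF holQ holS S nz pos that])
  have Snz: "S z \<noteq> 0" if "z \<in> ball 0 1" for z using Bpos[OF that] by auto
  obtain L where holL: "L holomorphic_on ball 0 1" and L: "\<And>z. z \<in> ball 0 1 \<Longrightarrow> S z = exp (L z)"
    using contractible_imp_holomorphic_log[OF holS convex_imp_contractible] Snz by (metis convex_ball)
  have dS: "deriv S z = deriv L z * S z" if "z \<in> ball 0 1" for z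
  proof -
    have "((\<lambda>z. exp (L z)) has_field_derivative exp (L z) * deriv L z) (at z)"
      using holomorphic_derivI[OF holL _ that] by (auto intro!: derivative_eq_intros)
    then have "(S has_field_derivative exp (L z) * deriv L z) (at z)"
      by (rule has_field_derivative_transform_within_open[OF _ open_ball that]) (use L in auto)
    then show ?thesis using L[OF that] by (simp add: DERIV_imp_deriv)
  qed
  have dQ: "deriv Q z = S z + z * deriv S z" if "z \<in> ball 0 1" for z
  proof -
    have "((\<lambda>z. z * S z) has_field_derivative S z + z * deriv S z) (at z)"
      using holomorphic_derivI[OF holS _ that] by (auto intro!: derivative_eq_intros)
    then have "(Q has_field_derivative S z + z * deriv S z) (at z)"
      by (rule has_field_derivative_transform_within_open[OF _ open_ball that]) (use S in auto)
    then show ?thesis by (rule DERIV_imp_deriv)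
  qed
  define H where "H = {u. Re u < 0}"
  have eH: "exp u \<in> ball 0 1" if "u \<in> H" for u using that by (simp add: H_def)
  define W where "W = (\<lambda>u. u + L (exp u))"
  define W' where "W' = (\<lambda>u. 1 + deriv L (exp u) * exp u)"
  have injW: "inj_on W H"
  proof (rule inj_on_if_Re_deriv_pos[of H W W'])
    show "convex H" unfolding H_def using convex_halfspace_Re_lt by blast
    fix u assume u: "u \<in> H"
    show "(W has_field_derivative W' u) (at u)"
      unfolding W_def W'_def
      using holomorphic_derivI[OF holL _ eH[OF u]] 
      by (auto intro!: derivative_eq_intros DERIV_chain2[of L])
    \<comment> \<open>\<open>W' = z Q'/Q\<close> at \<open>z = exp u\<close> is the reciprocal of
      the quantity bounded by \<open>Bpos\<close>, and reciprocals preserve positivity of the real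
      part.\<close>
    have "W' u = inverse (S (exp u) / deriv Q (exp u))"
      using dQ[OF eH[OF u]] dS[OF eH[OF u]] Snz[OF eH[OF u]] by (simp add: W'_def field_simps)
    then show "Re (W' u) > 0" using Bpos[OF eH[OF u]]
      by (simp only: inverse_complex.sel) (intro divide_pos_pos add_pos_nonneg, auto)
  qed
  have expW: "exp (W (Ln z)) = Q z" "Ln z \<in> H" if "z \<in> ball 0 1" "z \<noteq> 0" for z
    using that L S[of z] by (auto simp: W_def exp_add H_def)
  show ?thesis
  proof (rule inj_onI)
    fix z1 z2 assume z: "z1 \<in> ball 0 1" "z2 \<in> ball 0 1" and eq: "Q z1 = Q z2"
    show "z1 = z2"
    proof (cases "z1 = 0 \<or> z2 = 0")
      case True
      then show ?thesis using eq S[of z1] S[of z2] Snz z by auto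
    next
      case False
      then have "exp (W (Ln z1)) = exp (W (Ln z2))" using expW z eq by simp
      then obtain n :: int where n: "W (Ln z1) = W (Ln z2) + (of_int (2 * n) * pi) * \<i>"
        using exp_eq by blast
      \<comment> \<open>\<open>W\<close> commutes with translation by multiples of
        \<open>2 \<pi> i\<close>, so the ambiguity of the logarithm can be moved into the argument,
        where injectivity on the half-plane applies.\<close>
      define u where "u = Ln z2 + (of_int (2 * n) * pi) * \<i>"
      have eu: "exp u = z2" 
      proof -
        have "exp u = exp (Ln z2)" unfolding u_def exp_eq by blast
        then show ?thesis using False by simp
      qed
      have "W (Ln z1) = W u" using n eu False by (simp add: W_def u_def)
      moreover have "u \<in> H" "Ln z1 \<in> H" using expW z False by (auto simp: H_def u_def)
      ultimately have "Ln z1 = u" using injW by (auto dest: inj_onD)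
      then have "exp (Ln z1) = exp u" by simp
      then show ?thesis using eu False by simp
    qed
  qed
qed

subsection \<open>Subordination and growth\<close>

text \<open>\<open>v = G \<circ> P\<close> is meaningful only where \<open>P\<close> takes values of
  \<open>Q\<close>, so \<open>|v z| \<le> |z|\<close> is shown first on discs where it does; a
  first-exit argument makes this the whole disc. The bound is Jack's lemma: where
  \<open>V = v/z\<close> has maximal modulus on a circle and is nonzero, \<open>z v' = m v\<close>
  with a real m at least 1, and so \<open>q (\<omega> z) = m q (v z)\<close>.\<close>

lemma starlike_primitive_subordinate:
  fixes q Q P \<omega> :: "complex \<Rightarrow> complex"
  assumes holq: "q holomorphic_on ball 0 1" and injq: "inj_on q (ball 0 1)"
    and star: "\<And>z t. z \<in> ball 0 1 \<Longrightarrow> 0 \<le> t \<Longrightarrow> t \<le> 1 \<Longrightarrow> of_real t * q z \<in> q ` ball 0 1"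
    and holQ: "Q holomorphic_on ball 0 1" and injQ: "inj_on Q (ball 0 1)" and Q0: "Q 0 = 0"
    and qQ: "\<And>z. z \<in> ball 0 1 \<Longrightarrow> q z = z * deriv Q z"
    and holP: "P holomorphic_on ball 0 1" and P0: "P 0 = 0"
    and qP: "\<And>z. z \<in> ball 0 1 \<Longrightarrow> z * deriv P z = q (\<omega> z)"
    and \<omega>: "\<And>z. z \<in> ball 0 1 \<Longrightarrow> norm (\<omega> z) \<le> norm z"
  obtains v where "v holomorphic_on ball 0 1" "\<And>z. z \<in> ball 0 1 \<Longrightarrow> norm (v z) \<le> norm z"
    "\<And>z. z \<in> ball 0 1 \<Longrightarrow> P z = Q (v z)"
proof -
  have q0: "q 0 = 0" using qQ[of 0] by simp
  obtain G where holG: "G holomorphic_on Q ` ball 0 1" and G: "\<And>z. z \<in> ball 0 1 \<Longrightarrow> G (Q z) = z"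
    using holomorphic_has_inverse[OF holQ open_ball injQ] by metis
  define v where "v = G \<circ> P"
  have holv: "v holomorphic_on ball 0 r" if "P ` ball 0 r \<subseteq> Q ` ball 0 1" "r \<le> 1" for r
    unfolding v_def
    by (rule holomorphic_on_compose_gen[OF _ holG that(1)]) (use holP that in \<open>auto intro: holomorphic_on_subset\<close>)
  have Qv: "Q (v z) = P z" "v z \<in> ball 0 1" if "P z \<in> Q ` ball 0 1" for z
    using that G by (auto simp: v_def)
  have v0: "v 0 = 0" using G[of 0] P0 Q0 by (simp add: v_def)
  have bound: "norm (v z) \<le> norm z" if sub: "P ` ball 0 r \<subseteq> Q ` ball 0 1" and r: "r \<le> 1" and z: "z \<in> ball 0 r" for r z
  proof (cases "z = 0")
    case True
    then show ?thesis using v0 by simp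
  next
    case False
    have "r > 0" using z by (metis ball_eq_empty empty_iff linorder_not_le)
    obtain V where holV: "V holomorphic_on ball 0 r" and V: "\<And>z. v z = z * V z"
      using holomorphic_divide_id[OF holv[OF sub r] v0 \<open>r > 0\<close>] by metis
    have contV: "continuous_on (ball 0 r) V" using holV holomorphic_on_imp_continuous_on by blast
    have subr: "cball 0 (norm z) \<subseteq> ball 0 r" using z by auto
    obtain z0 where z0: "z0 \<in> sphere 0 (norm z)" "\<And>w. w \<in> sphere 0 (norm z) \<Longrightarrow> norm (V w) \<le> norm (V z0)"
    proof -
      have "\<exists>x\<in>sphere 0 (norm z). \<forall>y\<in>sphere 0 (norm z). norm (V y) \<le> norm (V x)"
      proof (rule continuous_attains_sup)
        show "sphere (0::complex) (norm z) \<noteq> {}" by (metis dist_0_norm empty_iff mem_sphere)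
        show "continuous_on (sphere 0 (norm z)) (\<lambda>x. norm (V x))"
          by (intro continuous_intros continuous_on_subset[OF contV]) (use z in auto)
      qed auto
      then show ?thesis using that by blast
    qed
    have z0nz: "z0 \<noteq> 0" using z0(1) False by auto
    have Vmax: "norm (V w) \<le> norm (V z0)" if "w \<in> cball 0 (norm z)" for w
    proof (rule maximum_modulus_frontier[of V "cball 0 (norm z)"])
      show "V holomorphic_on interior (cball 0 (norm z))"
        by (rule holomorphic_on_subset[OF holV]) (use z in auto)
      show "continuous_on (closure (cball 0 (norm z))) V"
        by (rule continuous_on_subset[OF contV]) (use z in auto)
    qed (use z0 that in auto)
    have z0in: "z0 \<in> ball 0 r" "z0 \<in> ball 0 1" using z0(1) z r by auto
    have "norm (V z0) \<le> 1"
    proof (cases "V z0 = 0")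
      case False
      \<comment> \<open>Stationarity of \<open>|V|\<close> along the circle makes
        \<open>z0 V'/V\<close> real, and maximality in the disc makes it nonnegative.\<close>
      define m where "m = 1 + z0 * deriv V z0 / V z0"
      have "((\<lambda>w. V w \<bullet> V w) has_derivative (\<lambda>h. 2 * (V z0 \<bullet> (deriv V z0 * h)))) (at z0)"
        using holomorphic_derivI[OF holV _ z0in(1)] unfolding has_field_derivative_def
        by (auto intro!: derivative_eq_intros simp: inner_commute)
      note bm = boundary_max_derivative[OF this]
      have Vm: "V w \<bullet> V w \<le> V z0 \<bullet> V z0" if "norm w \<le> norm z0" for w
        using Vmax[of w] z0(1) that by (simp add: dot_square_norm)
      have d: "V z0 \<bullet> (deriv V z0 * z0) \<ge> 0" "V z0 \<bullet> (deriv V z0 * (\<i> * z0)) = 0"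
        using bm[OF Vm] by auto
      have den: "(Re (V z0))\<^sup>2 + (Im (V z0))\<^sup>2 > 0" using False
        by (metis complex_neq_0)
      have "Re (z0 * deriv V z0 / V z0) \<ge> 0" "Im (z0 * deriv V z0 / V z0) = 0"
        using d den by (auto simp: Re_divide Im_divide inner_complex_def algebra_simps intro!: divide_nonneg_pos)
      then have m: "m = of_real (Re m)" "Re m \<ge> 1" by (auto simp: m_def complex_eq_iff)
      have dv: "z0 * deriv v z0 = m * v z0"
      proof -
        have "((\<lambda>z. z * V z) has_field_derivative V z0 + z0 * deriv V z0) (at z0)"
          using holomorphic_derivI[OF holV _ z0in(1)] by (auto intro!: derivative_eq_intros)
        then have "deriv v z0 = V z0 + z0 * deriv V z0"
          unfolding V[symmetric] by (rule DERIV_imp_deriv)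
        then show ?thesis using False by (simp add: m_def V field_simps)
      qed
      have Pz0: "P z0 \<in> Q ` ball 0 1" using sub z0in by blast
      note Qv0 = Qv[OF Pz0]
      have "deriv P z0 = deriv Q (v z0) * deriv v z0"
      proof -
        have "((\<lambda>z. Q (v z)) has_field_derivative deriv Q (v z0) * deriv v z0) (at z0)"
          by (rule DERIV_chain2) (use holomorphic_derivI[OF holQ _ Qv0(2)] holomorphic_derivI[OF holv[OF sub r] _ z0in(1)] in auto)
        then have "(P has_field_derivative deriv Q (v z0) * deriv v z0) (at z0)"
          by (rule has_field_derivative_transform_within_open[OF _ open_ball z0in(1)]) (use Qv sub in blast)
        then show ?thesis by (rule DERIV_imp_deriv)
      qed
      then have "z0 * deriv P z0 = deriv Q (v z0) * (z0 * deriv v z0)" by simp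
      also have "\<dots> = m * q (v z0)" unfolding dv using qQ[OF Qv0(2)] by simp
      finally have "q (\<omega> z0) = of_real (Re m) * q (v z0)" using qP[OF z0in(2)] m(1) by simp
      \<comment> \<open>\<open>q (v z0)\<close> thus lies on the segment from 0 to
        \<open>q (\<omega> z0)\<close>, and starlikeness gives
        \<open>|v z0| \<le> |\<omega> z0| \<le> |z0|\<close>.\<close>
      then have eq: "q (v z0) = of_real (1 / Re m) * q (\<omega> z0)" using m(2) by simp
      have "norm (\<omega> z0) \<le> norm z0" using \<omega>[OF z0in(2)] .
      moreover have "norm (v z0) \<le> norm (\<omega> z0)"
        by (rule starlike_preimage_norm_le[OF holq injq q0 star _ Qv0(2) _ _ eq])
           (use m z0in calculation in auto)
      ultimately have "norm z0 * norm (V z0) \<le> norm z0 * 1" by (simp add: V norm_mult)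
      then show ?thesis using z0nz by (simp add: mult_le_cancel_left)
    qed simp
    then have "norm (V z) \<le> 1" using Vmax[of z] by auto
    then show ?thesis by (simp add: V norm_mult mult_left_le)
  qed
  have PQ: "P ` ball 0 1 \<subseteq> Q ` ball 0 1"
  proof (rule ccontr)
    assume "\<not> ?thesis"
    then obtain z where z: "z \<in> ball 0 1" "P z \<notin> Q ` ball 0 1" by blast
    have contP: "continuous_on (ball 0 1) P" using holP holomorphic_on_imp_continuous_on by blast
    have contQ: "continuous_on (ball 0 1) Q" using holQ holomorphic_on_imp_continuous_on by blast
    have opQ: "open (Q ` ball 0 1)" by (rule open_mapping_thm3[OF holQ open_ball injQ])
    \<comment> \<open>At a point z0 of least modulus in \<open>Z\<close>, \<open>P\<close> would
      first leave the range of \<open>Q\<close>. Before it, \<open>P = Q \<circ> v\<close> maps into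
      the compact image of \<open>cball 0 (norm z0)\<close>, so the value at z0 is still in the
      range.\<close>
    define Z where "Z = cball 0 (norm z) \<inter> P -` (- (Q ` ball 0 1))"
    have "closed Z" unfolding Z_def
      by (intro continuous_closed_preimage continuous_on_subset[OF contP]) (use z opQ in auto)
    then have "compact Z" by (simp add: compact_eq_bounded_closed Z_def bounded_Int)
    moreover have "z \<in> Z" using z by (simp add: Z_def)
    ultimately obtain z0 where z0: "z0 \<in> Z" "\<And>w. w \<in> Z \<Longrightarrow> norm z0 \<le> norm w"
      using continuous_attains_inf[of Z norm] continuous_on_norm_id by blast
    have z0nz: "z0 \<noteq> 0"
    proof
      assume "z0 = 0"
      then have "Q 0 \<notin> Q ` ball 0 1" using z0(1) P0 Q0 by (auto simp: Z_def)
      then show False by auto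
    qed
    have z0lt: "norm z0 < 1" using z0(1) z by (auto simp: Z_def)
    have sub: "P ` ball 0 (norm z0) \<subseteq> Q ` ball 0 1"
    proof
      fix y assume "y \<in> P ` ball 0 (norm z0)"
      then obtain w where w: "norm w < norm z0" "y = P w" by auto
      show "y \<in> Q ` ball 0 1"
      proof (rule ccontr)
        assume "y \<notin> Q ` ball 0 1"
        then have "w \<in> Z" using w z0(1) by (auto simp: Z_def)
        then show False using z0(2)[of w] w by simp
      qed
    qed
    have comp: "compact (Q ` cball 0 (norm z0))"
      by (intro compact_continuous_image continuous_on_subset[OF contQ]) (use z0lt in auto)
    have "P ` closure (ball 0 (norm z0)) \<subseteq> Q ` cball 0 (norm z0)"
    proof (rule image_closure_subset)
      show "continuous_on (closure (ball 0 (norm z0))) P"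
        by (rule continuous_on_subset[OF contP]) (use z0lt z0nz in auto)
      show "P ` ball 0 (norm z0) \<subseteq> Q ` cball 0 (norm z0)"
      proof clarify
        fix w :: complex assume w: "w \<in> ball 0 (norm z0)"
        have "norm (v w) \<le> norm w" by (rule bound[OF sub _ w]) (use z0lt in auto)
        then show "P w \<in> Q ` cball 0 (norm z0)"
          using Qv[of w] subsetD[OF sub imageI[OF w]] w by (intro image_eqI[of _ _ "v w"]) auto
      qed
    qed (use comp compact_imp_closed in auto)
    then have "P z0 \<in> Q ` cball 0 (norm z0)" using z0nz by auto
    then have "P z0 \<in> Q ` ball 0 1" using z0lt by auto
    then show False using z0(1) by (auto simp: Z_def)
  qed
  show ?thesis
  proof (rule that[of v])
    show "P z = Q (v z)" if "z \<in> ball 0 1" for z using Qv(1)[of z] subsetD[OF PQ imageI[OF that]] by simp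
  qed (use holv[OF PQ] bound[OF PQ] in auto)
qed

text \<open>\<open>\<psi> = cnj \<circ> \<phi> \<circ> cnj\<close> maps into the range of \<phi> and
  has the same value and derivative at 0. The inverse of \<phi> composed with \<psi> is then a
  self-map of the disc fixing 0 with derivative 1, so it is the identity by the equality case of the
  Schwarz lemma.\<close>

lemma univalent_symmetric_imp_cnj:
  fixes \<phi> :: "complex \<Rightarrow> complex"
  assumes hol: "\<phi> holomorphic_on ball 0 1" and inj: "inj_on \<phi> (ball 0 1)"
    and sym: "\<And>w. w \<in> \<phi> ` ball 0 1 \<Longrightarrow> cnj w \<in> \<phi> ` ball 0 1"
    and real0: "\<phi> 0 \<in> \<real>" "deriv \<phi> 0 \<in> \<real>" and z: "z \<in> ball 0 1"
  shows "\<phi> (cnj z) = cnj (\<phi> z)"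
proof -
  obtain G where holG: "G holomorphic_on \<phi> ` ball 0 1" 
    and G1: "\<And>z. z \<in> ball 0 1 \<Longrightarrow> deriv \<phi> z * deriv G (\<phi> z) = 1" 
    and G: "\<And>z. z \<in> ball 0 1 \<Longrightarrow> G (\<phi> z) = z"
    using holomorphic_has_inverse[OF hol open_ball inj] by metis
  have op: "open (\<phi> ` ball 0 1)" by (rule open_mapping_thm3[OF hol open_ball inj])
  define \<psi> where "\<psi> = cnj \<circ> \<phi> \<circ> cnj"
  have "cnj ` ball 0 1 = ball 0 1"
  proof (intro subset_antisym subsetI)
    fix x :: complex assume "x \<in> ball 0 1"
    then show "x \<in> cnj ` ball 0 1" by (intro image_eqI[of _ _ "cnj x"]) auto
  qed auto
  then have hol\<psi>: "\<psi> holomorphic_on ball 0 1"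
    unfolding \<psi>_def using holomorphic_on_compose_cnj_cnj[of \<phi> "ball 0 1"] hol by simp
  define w where "w = G \<circ> \<psi>"
  have \<psi>im: "\<psi> ` ball 0 1 \<subseteq> \<phi> ` ball 0 1" using sym by (auto simp: \<psi>_def)
  have holw: "w holomorphic_on ball 0 1"
    unfolding w_def by (rule holomorphic_on_compose_gen[OF hol\<psi> holG \<psi>im])
  have \<phi>w: "\<phi> (w x) = \<psi> x" "w x \<in> ball 0 1" if "x \<in> ball 0 1" for x
  proof -
    obtain y where "y \<in> ball 0 1" "\<psi> x = \<phi> y" using \<psi>im \<open>x \<in> ball 0 1\<close> by blast
    then show "\<phi> (w x) = \<psi> x" "w x \<in> ball 0 1" using G by (auto simp: w_def)
  qed
  have \<psi>0: "\<psi> 0 = \<phi> 0" using real0(1) by (auto simp: \<psi>_def Reals_cnj_iff)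
  have d\<psi>: "(\<psi> has_field_derivative deriv \<phi> 0) (at 0)"
  proof -
    have "(\<phi> has_field_derivative deriv \<phi> 0) (at 0)" by (rule holomorphic_derivI[OF hol]) auto
    then have "(\<psi> has_field_derivative cnj (deriv \<phi> 0)) (at 0)"
      unfolding \<psi>_def using has_field_derivative_cnj_cnj[of \<phi> "deriv \<phi> 0" 0] by simp
    then show ?thesis using real0(2) by (simp add: Reals_cnj_iff)
  qed
  have dw: "deriv w 0 = 1"
  proof -
    have "(G has_field_derivative deriv G (\<phi> 0)) (at (\<phi> 0))"
      by (rule holomorphic_derivI[OF holG op]) auto
    then have "(w has_field_derivative deriv G (\<phi> 0) * deriv \<phi> 0) (at 0)"
      unfolding w_def using d\<psi> \<psi>0 by (intro DERIV_chain) auto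
    then show ?thesis using G1[of 0] by (simp add: DERIV_imp_deriv mult.commute)
  qed
  have "\<exists>\<alpha>. (\<forall>z. norm z < 1 \<longrightarrow> w z = \<alpha> * z) \<and> norm \<alpha> = 1"
    by (rule Schwarz_Lemma(3)[OF holw, of 0]) (use \<phi>w G[of 0] \<psi>0 dw in \<open>auto simp: w_def\<close>)
  then obtain a where a: "\<And>z. norm z < 1 \<Longrightarrow> w z = a * z" by auto
  have "((\<lambda>z. a * z) has_field_derivative a) (at 0)" by (auto intro!: derivative_eq_intros)
  then have "(w has_field_derivative a) (at 0)"
    by (rule has_field_derivative_transform_within_open[OF _ open_ball[of 0 1]]) (use a in auto)
  then have "a = 1" using dw DERIV_imp_deriv by blast
  then have "w z = z" using a z by simp
  then have "\<phi> z = \<psi> z" using \<phi>w(1)[OF z] by simp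
  then show ?thesis by (simp add: \<psi>_def)
qed

section \<open>Growth and subordination of derivatives in the convex class\<close>

lemma holomorphic_log_deriv:
  fixes F :: "complex \<Rightarrow> complex"
  assumes hol: "F holomorphic_on ball 0 1" and nz: "\<And>z. z \<in> ball 0 1 \<Longrightarrow> F z \<noteq> 0" and F0: "F 0 = 1"
  obtains Q where "Q holomorphic_on ball 0 1" "Q 0 = 0" "\<And>z. z \<in> ball 0 1 \<Longrightarrow> F z = exp (Q z)"
    "\<And>z. z \<in> ball 0 1 \<Longrightarrow> deriv Q z = deriv F z / F z"
proof -
  obtain L where holL: "L holomorphic_on ball 0 1" and L: "\<And>z. z \<in> ball 0 1 \<Longrightarrow> F z = exp (L z)"
    using contractible_imp_holomorphic_log[OF hol convex_imp_contractible] nz by (metis convex_ball)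
  show ?thesis
  \<comment> \<open>\<open>exp (L 0) = F 0 = 1\<close>, so subtracting \<open>L 0\<close> normalises
    the logarithm without changing its exponential.\<close>
  proof (rule that[of "\<lambda>z. L z - L 0"])
    show "(\<lambda>z. L z - L 0) holomorphic_on ball 0 1" by (intro holomorphic_intros holL)
    show FQ: "F z = exp (L z - L 0)" if "z \<in> ball 0 1" for z
      using L[OF that] L[of 0] F0 by (simp add: exp_diff)
    show "deriv (\<lambda>z. L z - L 0) z = deriv F z / F z" if "z \<in> ball 0 1" for z
    proof -
      have "((\<lambda>z. exp (L z)) has_field_derivative exp (L z) * deriv L z) (at z)"
        using holomorphic_derivI[OF holL _ that] by (auto intro!: derivative_eq_intros)
      then have "(F has_field_derivative exp (L z) * deriv L z) (at z)"
        by (rule has_field_derivative_transform_within_open[OF _ open_ball that]) (use L in auto)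
      then have "deriv F z = F z * deriv L z" using L[OF that] by (simp add: DERIV_imp_deriv)
      moreover have "((\<lambda>z. L z - L 0) has_field_derivative deriv L z) (at z)"
        using holomorphic_derivI[OF holL _ that] by (auto intro!: derivative_eq_intros)
      ultimately show ?thesis using nz[OF that] by (simp add: DERIV_imp_deriv)
    qed
  qed auto
qed

text \<open>The midpoint of \<open>Q z\<close> and \<open>cnj (Q z)\<close> is the real number
  \<open>Re (Q z)\<close>, and it stays in the convex symmetric image of \<open>cball 0 s\<close>.
  Its preimage is fixed by conjugation, hence a real number in [-s, s], and \<open>Q\<close>
  increases along the real axis.\<close>

lemma convex_symmetric_Re_bounds:
  fixes Q :: "complex \<Rightarrow> complex"
  assumes hol: "Q holomorphic_on ball 0 1" and inj: "inj_on Q (ball 0 1)" and Q0: "Q 0 = 0"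
    and pos: "\<And>z. z \<in> ball 0 1 \<Longrightarrow> Re (1 + z * deriv (deriv Q) z / deriv Q z) > 0"
    and cnj: "\<And>z. z \<in> ball 0 1 \<Longrightarrow> Q (cnj z) = cnj (Q z)"
    and d0: "Re (deriv Q 0) > 0"
    and z: "norm z \<le> s" and s: "s < 1"
  shows "Re (Q (of_real (- s))) \<le> Re (Q z)" "Re (Q z) \<le> Re (Q (of_real s))"
proof -
  have s0: "s \<ge> 0" using z norm_ge_zero order_trans by blast
  define f where "f = (\<lambda>x. Re (Q (of_real x)))"
  have Qreal: "Q (of_real x) = of_real (f x)" if "x \<in> {-1<..<1}" for x :: real
  proof -
    have "cnj (Q (of_real x)) = Q (of_real x)" using cnj[of "of_real x"] that by (auto simp: abs_less_iff)
    then show ?thesis by (simp add: f_def complex_eq_iff)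
  qed
  have df: "(f has_real_derivative Re (deriv Q (of_real x))) (at x)" if "x \<in> {-1<..<1}" for x
  proof -
    have "(Q has_field_derivative deriv Q (of_real x)) (at (of_real x))"
      by (rule holomorphic_derivI[OF hol]) (use that in auto)
    then have "((\<lambda>x. Q (of_real x)) has_vector_derivative deriv Q (of_real x)) (at x)"
      by (rule has_vector_derivative_real_field)
    then show ?thesis unfolding f_def has_real_derivative_iff_has_vector_derivative
      by (rule bounded_linear.has_vector_derivative[OF bounded_linear_Re])
  qed
  have dnz: "Re (deriv Q (of_real x)) \<noteq> 0" if "x \<in> {-1<..<1}" for x
  proof -
    have "((\<lambda>x. Q (of_real x)) has_vector_derivative deriv Q (of_real x)) (at x)"
      by (rule has_vector_derivative_real_field) (use that holomorphic_derivI[OF hol] in auto)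
    moreover have "((\<lambda>x. Q (of_real x)) has_vector_derivative of_real (Re (deriv Q (of_real x)))) (at x)"
    proof -
      have "((\<lambda>x. complex_of_real (f x)) has_vector_derivative of_real (Re (deriv Q (of_real x)))) (at x)"
        using has_vector_derivative_of_real df[OF that] has_real_derivative_iff_has_vector_derivative by blast
      then show ?thesis
        by (rule has_vector_derivative_transform_within_open[of _ _ _ "{-1<..<1}"])
           (use Qreal that in auto)
    qed
    ultimately have "deriv Q (of_real x) = of_real (Re (deriv Q (of_real x)))"
      using vector_derivative_unique_at by blast
    moreover have "deriv Q (of_real x) \<noteq> 0"
      by (rule holomorphic_injective_imp_regular[OF hol _ inj]) (use that in auto)
    ultimately show ?thesis by auto
  qed
  have contd: "continuous_on {-1<..<1} (\<lambda>x. Re (deriv Q (of_real x)))"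
    by (intro continuous_intros continuous_on_compose2[OF holomorphic_on_imp_continuous_on[OF holomorphic_deriv[OF hol open_ball]]]) auto
  \<comment> \<open>On the real axis \<open>Q'\<close> is real and never 0, so it keeps the sign
    that it has at 0.\<close>
  have dpos: "Re (deriv Q (of_real x)) > 0" if x: "x \<in> {-1<..<1}" for x
  proof (rule ccontr)
    assume "\<not> ?thesis"
    moreover have "connected ((\<lambda>x. Re (deriv Q (of_real x))) ` {-1<..<1})"
      by (intro connected_continuous_image contd) auto
    moreover have "Re (deriv Q (of_real 0)) \<in> (\<lambda>x. Re (deriv Q (of_real x))) ` {-1<..<1}" 
      "Re (deriv Q (of_real x)) \<in> (\<lambda>x. Re (deriv Q (of_real x))) ` {-1<..<1}"
      using x by (intro imageI; simp)+
    ultimately have "0 \<in> (\<lambda>x. Re (deriv Q (of_real x))) ` {-1<..<1}"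
      using d0 unfolding connected_iff_interval by (metis less_eq_real_def not_le of_real_0)
    then show False using dnz by auto
  qed
  have mono: "f a \<le> f b" if "a \<le> b" "a \<in> {-1<..<1}" "b \<in> {-1<..<1}" for a b
  proof (rule DERIV_nonneg_imp_nondecreasing[OF \<open>a \<le> b\<close>])
    fix x assume "a \<le> x" "x \<le> b"
    then have "x \<in> {-1<..<1}" using that by auto
    then show "\<exists>y. (f has_real_derivative y) (at x) \<and> 0 \<le> y" using df dpos less_imp_le by blast
  qed
  have "\<exists>x\<in>{-s..s}. Re (Q z) = f x"
  proof (cases "s = 0")
    case True
    then show ?thesis using z by (auto simp: f_def)
  next
    case False
    then have "convex (Q ` cball 0 s)" using convex_image_cball[OF hol inj pos] s s0 by simp
    moreover have "Q z \<in> Q ` cball 0 s" "cnj (Q z) \<in> Q ` cball 0 s"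
    proof -
      show "Q z \<in> Q ` cball 0 s" using z by auto
      have "cnj (Q z) = Q (cnj z)" using cnj[of z] z s by simp
      then show "cnj (Q z) \<in> Q ` cball 0 s" using z by auto
    qed
    ultimately have "(1/2) *\<^sub>R Q z + (1/2) *\<^sub>R cnj (Q z) \<in> Q ` cball 0 s"
      by (intro convexD) auto
    moreover have "(1/2) *\<^sub>R Q z + (1/2) *\<^sub>R cnj (Q z) = of_real (Re (Q z))"
      by (simp add: complex_eq_iff)
    ultimately obtain y where y: "y \<in> cball 0 s" "of_real (Re (Q z)) = Q y" by auto
    have "Q (cnj y) = Q y" using cnj[of y] y s by (metis complex_cnj_complex_of_real dist_0_norm le_less_trans mem_ball mem_cball)
    then have "cnj y = y" using inj_onD[OF inj, of "cnj y" y] y s by auto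
    then have "y = of_real (Re y)" by (simp add: complex_eq_iff)
    then have "Re (Q z) = f (Re y)" unfolding f_def by (metis Re_complex_of_real y(2))
    moreover have "Re y \<in> {-s..s}" using y abs_Re_le_cmod[of y] by auto
    ultimately show ?thesis by auto
  qed
  then obtain x where x: "x \<in> {-s..s}" "Re (Q z) = f x" by auto
  show "Re (Q (of_real (- s))) \<le> Re (Q z)" "Re (Q z) \<le> Re (Q (of_real s))"
    using mono[of "-s" x] mono[of x s] x s s0 by (auto simp: f_def)
qed

text \<open>The conclusions share the logarithms \<open>Q\<close> of \<open>K'\<close> and
  \<open>P\<close> of \<open>h'\<close> and the map v with \<open>P = Q \<circ> v\<close>. As
  \<open>Q\<close> is real on the real axis, \<open>K'\<close> is \<open>exp (Re Q)\<close> there,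
  while \<open>|h'(z)| = exp (Re (Q (v z)))\<close> with \<open>|v z| \<le> s\<close>; so the growth
  bounds are those of \<open>convex_symmetric_Re_bounds\<close>.\<close>

lemma ma_minda_convex_class:
  fixes \<phi> K h :: "complex \<Rightarrow> complex"
  assumes phi: "ma_minda \<phi>"
    and K_hol: "K holomorphic_on ball 0 1" and K'_0: "deriv K 0 = 1"
    and K_eq: "\<And>z. z \<in> ball 0 1 \<Longrightarrow> deriv K z \<noteq> 0 \<and> 1 + z * deriv (deriv K) z / deriv K z = \<phi> z"
    and h: "conv_class \<phi> h"
  shows ma_minda_deriv_subordinate: "\<exists>v. v holomorphic_on ball 0 1 \<and> (\<forall>z\<in>ball 0 1. norm (v z) \<le> norm z) \<and>
           (\<forall>z\<in>ball 0 1. deriv h z = deriv K (v z))"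
    and ma_minda_growth: "\<And>z s. norm z \<le> s \<Longrightarrow> s < 1 \<Longrightarrow> 
        0 < Re (deriv K (of_real (- s))) \<and> Re (deriv K (of_real (- s))) \<le> norm (deriv h z) \<and>
        norm (deriv h z) \<le> Re (deriv K (of_real s))"
    and conv_class_Re_pos: "\<And>z. z \<in> ball 0 1 \<Longrightarrow> Re (1 + z * deriv (deriv h) z / deriv h z) > 0"
proof -
  have hol\<phi>: "\<phi> holomorphic_on ball 0 1" and inj\<phi>: "inj_on \<phi> (ball 0 1)"
    and pos\<phi>: "\<And>z. z \<in> ball 0 1 \<Longrightarrow> Re (\<phi> z) > 0"
    and sym\<phi>: "\<And>w. w \<in> \<phi> ` ball 0 1 \<Longrightarrow> cnj w \<in> \<phi> ` ball 0 1"
    and \<phi>0: "\<phi> 0 = 1" 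
    and star\<phi>: "\<And>w. w \<in> \<phi> ` ball 0 1 \<Longrightarrow> closed_segment 1 w \<subseteq> \<phi> ` ball 0 1"
    and d\<phi>: "deriv \<phi> 0 \<in> \<real>" "Re (deriv \<phi> 0) > 0"
    using phi unfolding ma_minda_def unit_disk_def by blast+
  obtain \<omega> where holh: "h holomorphic_on ball 0 1" and injh: "inj_on h (ball 0 1)" and h'0: "deriv h 0 = 1"
    and hol\<omega>: "\<omega> holomorphic_on ball 0 1" and \<omega>im: "\<omega> ` ball 0 1 \<subseteq> ball 0 1" and \<omega>0: "\<omega> 0 = 0"
    and \<omega>: "\<And>z. z \<in> ball 0 1 \<Longrightarrow> 1 + z * deriv (deriv h) z / deriv h z = \<phi> (\<omega> z)"
    using h unfolding conv_class_def subordinate_def unit_disk_def by blast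
  have \<omega>le: "norm (\<omega> z) \<le> norm z" if "z \<in> ball 0 1" for z
    by (rule Schwarz_Lemma(1)[OF hol\<omega> \<omega>0]) (use \<omega>im that in \<open>auto simp: subset_iff\<close>)
  show "Re (1 + z * deriv (deriv h) z / deriv h z) > 0" if "z \<in> ball 0 1" for z
    unfolding \<omega>[OF that] using pos\<phi> \<omega>im that by blast
  have holK': "deriv K holomorphic_on ball 0 1" by (intro holomorphic_deriv K_hol) auto
  have holh': "deriv h holomorphic_on ball 0 1" by (intro holomorphic_deriv holh) auto
  obtain Q where holQ: "Q holomorphic_on ball 0 1" and Q0: "Q 0 = 0" 
    and KQ: "\<And>z. z \<in> ball 0 1 \<Longrightarrow> deriv K z = exp (Q z)"
    and dQ: "\<And>z. z \<in> ball 0 1 \<Longrightarrow> deriv Q z = deriv (deriv K) z / deriv K z"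
    using holomorphic_log_deriv[OF holK' _ K'_0] K_eq by metis
  have h'nz: "deriv h z \<noteq> 0" if "z \<in> ball 0 1" for z
    by (rule holomorphic_injective_imp_regular[OF holh _ injh that]) auto
  obtain P where holP: "P holomorphic_on ball 0 1" and P0: "P 0 = 0" 
    and hP: "\<And>z. z \<in> ball 0 1 \<Longrightarrow> deriv h z = exp (P z)"
    and dP: "\<And>z. z \<in> ball 0 1 \<Longrightarrow> deriv P z = deriv (deriv h) z / deriv h z"
    using holomorphic_log_deriv[OF holh' h'nz h'0] by metis
  define q where "q = (\<lambda>z. \<phi> z - 1)"
  have holq: "q holomorphic_on ball 0 1" unfolding q_def by (intro holomorphic_intros hol\<phi>)
  have injq: "inj_on q (ball 0 1)" using inj\<phi> by (auto simp: q_def inj_on_def)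
  have starq: "of_real t * q z \<in> q ` ball 0 1" if "z \<in> ball 0 1" "0 \<le> t" "t \<le> 1" for z t
  proof -
    have "1 + of_real t * q z \<in> closed_segment 1 (\<phi> z)" using that
      by (auto simp: closed_segment_def q_def scaleR_conv_of_real algebra_simps intro!: exI[of _ t])
    then have "1 + of_real t * q z \<in> \<phi> ` ball 0 1" using star\<phi> that by blast
    then show ?thesis by (auto simp: q_def image_iff algebra_simps)
  qed
  have qQ: "q z = z * deriv Q z" if "z \<in> ball 0 1" for z
    unfolding q_def conjunct2[OF K_eq[OF that], symmetric] dQ[OF that] by simp
  have qP: "z * deriv P z = q (\<omega> z)" if "z \<in> ball 0 1" for z
    unfolding q_def \<omega>[OF that, symmetric] dP[OF that] by simp
  have Qnz: "deriv Q z \<noteq> 0" and Qpos: "Re (1 + z * deriv (deriv Q) z / deriv Q z) > 0" if "z \<in> ball 0 1" for z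
    using starlike_primitive_Re_pos[OF holq injq starq holQ qQ that] by auto
  have injQ: "inj_on Q (ball 0 1)" by (rule convex_imp_inj[OF holQ Q0 Qnz Qpos])
  obtain v where holv: "v holomorphic_on ball 0 1" and v: "\<And>z. z \<in> ball 0 1 \<Longrightarrow> norm (v z) \<le> norm z"
    and Pv: "\<And>z. z \<in> ball 0 1 \<Longrightarrow> P z = Q (v z)"
    by (rule starlike_primitive_subordinate[OF holq injq starq holQ injQ Q0 qQ holP P0 qP \<omega>le])
       (assumption | rule that)+
  have vin: "v z \<in> ball 0 1" if "z \<in> ball 0 1" for z using v[OF that] that by simp
  have hKv: "deriv h z = deriv K (v z)" if "z \<in> ball 0 1" for z
    using hP[OF that] Pv[OF that] KQ[OF vin[OF that]] by simp
  then show "\<exists>v. v holomorphic_on ball 0 1 \<and> (\<forall>z\<in>ball 0 1. norm (v z) \<le> norm z) \<and>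
           (\<forall>z\<in>ball 0 1. deriv h z = deriv K (v z))" using holv v by blast
  have qcnj: "q (cnj z) = cnj (q z)" if "z \<in> ball 0 1" for z
    using univalent_symmetric_imp_cnj[OF hol\<phi> inj\<phi> sym\<phi> _ d\<phi>(1) that] \<phi>0 by (simp add: q_def)
  have dQ0: "deriv Q 0 = deriv \<phi> 0"
  proof -
    have holQ': "deriv Q holomorphic_on ball 0 1" by (intro holomorphic_deriv holQ) auto
    have "((\<lambda>z. z * deriv Q z + 1) has_field_derivative deriv Q 0) (at 0)"
      using holomorphic_derivI[OF holQ' open_ball, of 0] by (auto intro!: derivative_eq_intros)
    then have "(\<phi> has_field_derivative deriv Q 0) (at 0)"
      by (rule has_field_derivative_transform_within_open[OF _ open_ball[of 0 1]]) (use qQ in \<open>auto simp: q_def algebra_simps\<close>)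
    then show ?thesis by (simp add: DERIV_imp_deriv)
  qed
  have Qcnj: "Q (cnj z) = cnj (Q z)" if z: "z \<in> ball 0 1" for z
  proof -
    \<comment> \<open>Symmetry of \<open>q\<close> passes to \<open>Q' = q/z\<close> off 0 and, as
      \<open>\<phi>' 0\<close> is real, also holds at 0. Thus this difference has derivative 0, and
      it vanishes at 0.\<close>
    define D where "D = (\<lambda>z. Q z - (cnj \<circ> Q \<circ> cnj) z)"
    have "(D has_field_derivative 0) (at x within ball 0 1)" if x: "x \<in> ball 0 1" for x
    proof -
      have cx: "cnj x \<in> ball 0 1" using x by simp
      have "(Q has_field_derivative deriv Q (cnj x)) (at (cnj x))"
        by (rule holomorphic_derivI[OF holQ _ cx]) auto
      then have "(cnj \<circ> Q \<circ> cnj has_field_derivative cnj (deriv Q (cnj x))) (at x)"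
        using has_field_derivative_cnj_cnj[of Q "deriv Q (cnj x)" x] by simp
      moreover have "cnj (deriv Q (cnj x)) = deriv Q x"
      proof (cases "x = 0")
        case True
        then show ?thesis using dQ0 d\<phi>(1) by (simp add: Reals_cnj_iff)
      next
        case False
        have "cnj x * deriv Q (cnj x) = cnj (x * deriv Q x)"
          unfolding qQ[OF cx, symmetric] qQ[OF x, symmetric] by (rule qcnj[OF x])
        then show ?thesis using False by (metis complex_cnj_cnj complex_cnj_mult complex_cnj_zero_iff mult_left_cancel)
      qed
      ultimately have "(D has_field_derivative deriv Q x - deriv Q x) (at x)"
        unfolding D_def using holomorphic_derivI[OF holQ open_ball x] by (intro DERIV_diff) (auto simp: o_def)
      then show ?thesis by (simp add: has_field_derivative_at_within)
    qed
    then obtain c where "\<And>x. x \<in> ball 0 1 \<Longrightarrow> D x = c"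
      using has_field_derivative_zero_constant[of "ball 0 1" D] convex_ball by metis
    then have "D (cnj z) = D 0" using z by simp
    then show ?thesis using Q0 by (simp add: D_def)
  qed
  fix z :: complex and s :: real assume z: "norm z \<le> s" and s: "s < 1"
  have s0: "s \<ge> 0" using z norm_ge_zero order_trans by blast
  have ReK: "Re (deriv K (of_real x)) = exp (Re (Q (of_real x)))" if "\<bar>x\<bar> < 1" for x
  proof -
    have xin: "complex_of_real x \<in> ball 0 1" using that by simp
    have "Im (Q (of_real x)) = 0" using Qcnj[OF xin] by (simp add: complex_eq_iff)
    then show ?thesis using KQ[OF xin] by (simp add: Re_exp)
  qed
  have zin: "z \<in> ball 0 1" using z s by simp
  have nv: "norm (v z) \<le> s" using v[OF zin] z by simp
  have "norm (deriv h z) = exp (Re (Q (v z)))"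
    using hP[OF zin] Pv[OF zin] by simp
  moreover have "Re (Q (of_real (- s))) \<le> Re (Q (v z))" "Re (Q (v z)) \<le> Re (Q (of_real s))"
    using convex_symmetric_Re_bounds[OF holQ injQ Q0 Qpos Qcnj _ nv s] dQ0 d\<phi>(2) by auto
  ultimately show "0 < Re (deriv K (of_real (- s))) \<and> Re (deriv K (of_real (- s))) \<le> norm (deriv h z) \<and>
        norm (deriv h z) \<le> Re (deriv K (of_real s))"
    using ReK[of s] ReK[of "-s"] s s0 by simp
qed

subsection \<open>Bohr inequality\<close>

text \<open>Cauchy's formula on the circle of radius r, parametrised over [0, 1]; the case
  \<open>n = 0\<close> is the mean value property.\<close>

lemma has_integral_taylor_coeff:
  fixes f :: "complex \<Rightarrow> complex"
  assumes hol: "f holomorphic_on ball 0 1" and r: "0 < r" "r < 1"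
  shows "((\<lambda>t. f (of_real r * cis (2 * pi * t)) * cis (- (2 * pi * real n * t)))
            has_integral of_real r ^ n * taylor_coeff f n) {0..1}"
proof -
  have "((\<lambda>u. f u / (u - 0) ^ Suc n) has_contour_integral (2 * pi * \<i> / fact n * (deriv ^^ n) f 0)) (circlepath 0 r)"
    by (rule Cauchy_has_contour_integral_higher_derivative_circlepath)
       (use hol r in \<open>auto intro!: holomorphic_on_imp_continuous_on intro: holomorphic_on_subset\<close>)
  then have "((\<lambda>t. f (circlepath 0 r t) / circlepath 0 r t ^ Suc n * vector_derivative (circlepath 0 r) (at t within {0..1}))
      has_integral (2 * pi * \<i> * taylor_coeff f n)) {0..1}"
    unfolding has_contour_integral_def by (simp add: taylor_coeff_def)
  then have "((\<lambda>t. f (circlepath 0 r t) / circlepath 0 r t ^ Suc n * vector_derivative (circlepath 0 r) (at t within {0..1}) * (of_real r ^ n / (2 * pi * \<i>)))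
      has_integral (2 * pi * \<i> * taylor_coeff f n) * (of_real r ^ n / (2 * pi * \<i>))) {0..1}"
    by (rule has_integral_mult_left)
  then have *: "((\<lambda>t. f (circlepath 0 r t) / circlepath 0 r t ^ Suc n * vector_derivative (circlepath 0 r) (at t within {0..1}) * (of_real r ^ n / (2 * pi * \<i>)))
      has_integral of_real r ^ n * taylor_coeff f n) {0..1}"
    by (rule has_integral_eq_rhs) simp
  show ?thesis
  proof (rule has_integral_eq[OF _ *])
    fix t :: real assume t: "t \<in> {0..1}"
    have c: "circlepath 0 r t = of_real r * cis (2 * pi * t)"
      by (simp add: circlepath cis_conv_exp mult_ac)
    have d: "vector_derivative (circlepath 0 r) (at t within {0..1}) = 2 * pi * \<i> * (of_real r * cis (2 * pi * t))"
      using t by (simp add: vector_derivative_circlepath01 cis_conv_exp mult_ac)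
    have "cis (- (2 * pi * real n * t)) = 1 / cis (2 * pi * t) ^ n"
      by (simp add: Complex.DeMoivre cis_divide[symmetric] mult_ac flip: cis_inverse) (simp add: divide_inverse)
    then show "f (circlepath 0 r t) / circlepath 0 r t ^ Suc n * vector_derivative (circlepath 0 r) (at t within {0..1}) * (of_real r ^ n / (2 * pi * \<i>))
      = f (of_real r * cis (2 * pi * t)) * cis (- (2 * pi * real n * t))"
      unfolding d unfolding c using r by (simp add: power_mult_distrib field_simps)
  qed
qed

text \<open>Adding to the Fourier integral of p that of \<open>cnj p\<close>, which is 0 for n > 0,
  replaces p by the nonnegative function \<open>2 Re p\<close>. The integral of the latter is
  \<open>2 Re (p 0)\<close>, and r tends to 1.\<close>

lemma caratheodory_coeff_bound:
  fixes p :: "complex \<Rightarrow> complex"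
  assumes hol: "p holomorphic_on ball 0 1" and pos: "\<And>z. z \<in> ball 0 1 \<Longrightarrow> Re (p z) \<ge> 0" and n: "n > 0"
  shows "norm (taylor_coeff p n) \<le> 2 * Re (p 0)"
proof -
  have bound: "r ^ n * norm (taylor_coeff p n) \<le> 2 * Re (p 0)" if r: "0 < r" "r < 1" for r :: real
  proof -
    define w where "w = (\<lambda>t. complex_of_real r * cis (2 * pi * t))"
    have win: "w t \<in> ball 0 1" for t using r by (simp add: w_def norm_mult)
    have I1: "((\<lambda>t. p (w t) * cis (- (2 * pi * real n * t))) has_integral of_real r ^ n * taylor_coeff p n) {0..1}"
      unfolding w_def by (rule has_integral_taylor_coeff[OF hol r])
    \<comment> \<open>\<open>z ^ n * p z\<close> vanishes at 0, so its mean is 0; conjugated and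
      divided by \<open>r ^ n\<close> it becomes \<open>cnj p\<close> against the same exponential
      as in \<open>I1\<close>.\<close>
    have hol': "(\<lambda>z. z ^ n * p z) holomorphic_on ball 0 1" by (intro holomorphic_intros hol)
    have "((\<lambda>t. w t ^ n * p (w t)) has_integral 0) {0..1}"
      using has_integral_taylor_coeff[OF hol' r, of 0] n
      by (simp add: w_def taylor_coeff_def power_0_left)
    then have "((\<lambda>t. cnj (w t ^ n * p (w t)) / of_real r ^ n) has_integral cnj 0 / of_real r ^ n) {0..1}"
      by (intro has_integral_divide has_integral_linear[OF _ bounded_linear_cnj, unfolded o_def])
    moreover have "cnj (w t ^ n * p (w t)) / of_real r ^ n = cnj (p (w t)) * cis (- (2 * pi * real n * t))" for t
      using r by (simp add: w_def power_mult_distrib Complex.DeMoivre cis_cnj mult_ac)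
    ultimately have I2: "((\<lambda>t. cnj (p (w t)) * cis (- (2 * pi * real n * t))) has_integral 0) {0..1}" by simp
    have I: "((\<lambda>t. of_real (2 * Re (p (w t))) * cis (- (2 * pi * real n * t))) has_integral of_real r ^ n * taylor_coeff p n) {0..1}"
    proof (rule has_integral_eq[OF _ has_integral_add[OF I1 I2, simplified]])
      show "p (w t) * cis (- (2 * pi * real n * t)) + cnj (p (w t)) * cis (- (2 * pi * real n * t))
          = of_real (2 * Re (p (w t))) * cis (- (2 * pi * real n * t))" for t
        by (simp add: complex_add_cnj flip: distrib_right)
    qed
    have I0: "((\<lambda>t. 2 * Re (p (w t))) has_integral 2 * Re (p 0)) {0..1}"
    proof -
      have "((\<lambda>t. p (w t)) has_integral p 0) {0..1}"
        using has_integral_taylor_coeff[OF hol r, of 0] by (simp add: w_def taylor_coeff_def)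
      then have "((\<lambda>t. Re (p (w t))) has_integral Re (p 0)) {0..1}" by (rule has_integral_Re)
      then show ?thesis by (rule has_integral_mult_right)
    qed
    have "norm (integral {0..1} (\<lambda>t. of_real (2 * Re (p (w t))) * cis (- (2 * pi * real n * t)))) \<le> integral {0..1} (\<lambda>t. 2 * Re (p (w t)))"
      by (rule integral_norm_bound_integral)
         (use I I0 pos win in \<open>auto simp: has_integral_integrable norm_mult intro: has_integral_integrable\<close>)
    then show ?thesis unfolding integral_unique[OF I] integral_unique[OF I0]
      using r by (simp add: norm_mult norm_power)
  qed
  have "((\<lambda>r::real. r ^ n * norm (taylor_coeff p n)) \<longlongrightarrow> 1 ^ n * norm (taylor_coeff p n)) (at_left 1)"
    by (intro tendsto_intros)
  moreover have "eventually (\<lambda>r::real. r ^ n * norm (taylor_coeff p n) \<le> 2 * Re (p 0)) (at_left 1)"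
    unfolding eventually_at_left[OF zero_less_one] using bound by (intro exI[of _ 0]) auto
  ultimately show ?thesis using tendsto_upperbound by fastforce
qed

lemma taylor_coeff_eq_fps_nth:
  assumes "f has_fps_expansion F"
  shows "taylor_coeff f n = fps_nth F n"
  using fps_nth_fps_expansion[OF assms] by (simp add: taylor_coeff_def)

lemma has_fps_expansion_disc:
  assumes "f holomorphic_on ball 0 1"
  shows "f has_fps_expansion fps_expansion f 0"
  by (rule has_fps_expansion_fps_expansion[OF _ _ assms]) auto

text \<open>The origin of 1/3: \<open>w = z V\<close> with \<open>|V| \<le> 1\<close> and
  \<open>c = |V 0|\<close>, and the other coefficients of V are at most \<open>2 (1 - c)\<close>. At
  r = 1/3 the powers from the first on sum to 1/2, and \<open>c + 2 (1 - c) / 2 = 1\<close>.\<close>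

lemma sum_norm_taylor_self_map_le:
  fixes w :: "complex \<Rightarrow> complex"
  assumes hol: "w holomorphic_on ball 0 1" and le: "\<And>z. z \<in> ball 0 1 \<Longrightarrow> norm (w z) \<le> norm z"
    and r: "0 \<le> r" "r \<le> 1/3"
  shows "(\<Sum>n\<le>N. norm (taylor_coeff w n) * r ^ n) \<le> r"
proof -
  have w0: "w 0 = 0" using le[of 0] by simp
  obtain V where holV: "V holomorphic_on ball 0 1" and V: "\<And>z. w z = z * V z" and V0: "V 0 = deriv w 0"
    using holomorphic_divide_id[OF hol w0 zero_less_one] by metis
  have Vle: "norm (V z) \<le> 1" if "z \<in> ball 0 1" for z
  proof (cases "z = 0")
    case True
    have "norm (deriv w 0) \<le> 1"
      by (rule Schwarz_Lemma(2)[OF hol w0, of 0]) (use le le_less_trans in \<open>auto simp: dist_norm\<close>)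
    then show ?thesis using True V0 by simp
  next
    case False
    then show ?thesis using le[OF that] by (simp add: V norm_mult)
  qed
  define c where "c = norm (V 0)"
  \<comment> \<open>A unimodular factor that turns \<open>V 0\<close> into c; then
    \<open>1 - a V\<close> has nonnegative real part and the value \<open>1 - c\<close> at
    0.\<close>
  define a where "a = (if V 0 = 0 then 1 else cnj (V 0) / of_real c)"
  have a: "norm a = 1" "a * V 0 = of_real c"
    by (auto simp: a_def c_def norm_divide complex_norm_square power2_eq_square simp flip: complex_norm_square)
       (simp add: complex_norm_square[symmetric] mult.commute power2_eq_square)
  have Vn: "norm (taylor_coeff V n) \<le> 2 * (1 - c)" if n: "n > 0" for n
  proof -
    define p where "p = (\<lambda>z. 1 - a * V z)"
    have holp: "p holomorphic_on ball 0 1" unfolding p_def by (intro holomorphic_intros holV)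
    have "norm (taylor_coeff p n) \<le> 2 * Re (p 0)"
    proof (rule caratheodory_coeff_bound[OF holp _ n])
      fix z :: complex assume z: "z \<in> ball 0 1"
      have "Re (a * V z) \<le> norm (a * V z)" by (rule complex_Re_le_cmod)
      also have "\<dots> \<le> 1" using Vle[OF z] a by (simp add: norm_mult)
      finally show "Re (p z) \<ge> 0" by (simp add: p_def)
    qed
    moreover have "p has_fps_expansion 1 - fps_const a * fps_expansion V 0"
      unfolding p_def by (intro fps_expansion_intros has_fps_expansion_disc holV)
    then have "taylor_coeff p n = - (a * taylor_coeff V n)" using n
      by (simp add: taylor_coeff_eq_fps_nth[OF has_fps_expansion_disc[OF holV]] taylor_coeff_eq_fps_nth)
    ultimately show ?thesis using a by (simp add: norm_mult p_def)
  qed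
  have "w has_fps_expansion fps_X * fps_expansion V 0"
  proof -
    have "(\<lambda>z. z * V z) has_fps_expansion fps_X * fps_expansion V 0"
      by (intro fps_expansion_intros has_fps_expansion_disc holV)
    then show ?thesis by (simp add: V[abs_def])
  qed
  then have wV: "taylor_coeff w n = (if n = 0 then 0 else taylor_coeff V (n - 1))" for n
    by (simp add: taylor_coeff_eq_fps_nth[OF has_fps_expansion_disc[OF holV]] taylor_coeff_eq_fps_nth)
  have c: "0 \<le> c" "c \<le> 1" using Vle[of 0] by (auto simp: c_def)
  \<comment> \<open>The right-hand side is the exact value of c plus \<open>2 (1 - c)\<close> times
    the sum of \<open>(1/3) ^ n\<close> over n from 1 to M.\<close>
  have partial: "(\<Sum>n\<le>M. norm (taylor_coeff V n) * r ^ n) \<le> 1 - (1 - c) * (1/3) ^ M" for M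
  proof (induction M)
    case 0
    then show ?case by (simp add: taylor_coeff_def c_def)
  next
    case (Suc M)
    have "norm (taylor_coeff V (Suc M)) * r ^ Suc M \<le> 2 * (1 - c) * (1/3) ^ Suc M"
      by (intro mult_mono Vn power_mono) (use r c in auto)
    moreover have "(1 - c) * (1/3) ^ Suc M = (1 - c) * (1/3) ^ M / 3"
      "2 * (1 - c) * (1/3) ^ Suc M = 2 * ((1 - c) * (1/3) ^ M) / 3" by simp_all
    ultimately show ?case unfolding sum.atMost_Suc using Suc.IH by linarith
  qed
  show ?thesis
  proof (cases N)
    case 0
    then show ?thesis using r by (simp add: wV)
  next
    case (Suc M)
    have "(\<Sum>n\<le>N. norm (taylor_coeff w n) * r ^ n) = (\<Sum>n\<le>M. norm (taylor_coeff V n) * r ^ Suc n)"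
      unfolding Suc sum.atMost_Suc_shift by (simp add: wV)
    also have "\<dots> = r * (\<Sum>n\<le>M. norm (taylor_coeff V n) * r ^ n)"
      by (simp add: sum_distrib_left mult_ac)
    also have "\<dots> \<le> r * 1"
    proof (intro mult_left_mono)
      have "0 \<le> (1 - c) * (1/3) ^ M" using c by simp
      then show "(\<Sum>n\<le>M. norm (taylor_coeff V n) * r ^ n) \<le> 1" using partial[of M] by linarith
    qed (use r in auto)
    finally show ?thesis by simp
  qed
qed

text \<open>Truncated majorant sums are submultiplicative: the Cauchy product collects the pairs
  with \<open>k + l \<le> N\<close>, and nonnegativity allows all pairs in the square. Truncation
  avoids questions of convergence.\<close>

lemma sum_norm_fps_power_le:
  fixes W :: "complex fps"
  assumes r: "(r::real) \<ge> 0"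
  shows "(\<Sum>m\<le>N. norm (fps_nth (W ^ i) m) * r ^ m) \<le> (\<Sum>m\<le>N. norm (fps_nth W m) * r ^ m) ^ i"
proof (induction i)
  case 0
  have "(\<Sum>m\<le>N. norm (fps_nth (W ^ 0) m) * r ^ m) = (\<Sum>m\<le>N. if m = 0 then 1 else 0)"
    by (intro sum.cong) auto
  then show ?case by simp
next
  case (Suc i)
  define A where "A = (\<lambda>m. norm (fps_nth W m) * r ^ m)"
  define B where "B = (\<lambda>m. norm (fps_nth (W ^ i) m) * r ^ m)"
  have nn: "A m \<ge> 0" "B m \<ge> 0" for m using r by (auto simp: A_def B_def)
  have "(\<Sum>m\<le>N. norm (fps_nth (W ^ Suc i) m) * r ^ m) \<le> (\<Sum>m\<le>N. \<Sum>k\<le>m. A k * B (m - k))"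
  proof (rule sum_mono)
    fix m
    have "norm (fps_nth (W ^ Suc i) m) * r ^ m \<le> (\<Sum>k\<le>m. norm (fps_nth W k * fps_nth (W ^ i) (m - k))) * r ^ m"
      unfolding power_Suc fps_mult_nth atLeast0AtMost by (intro mult_right_mono sum_norm_le) (use r in auto)
    also have "\<dots> = (\<Sum>k\<le>m. A k * B (m - k))"
      unfolding sum_distrib_right
      by (intro sum.cong) (auto simp: A_def B_def norm_mult mult_ac simp flip: power_add)
    finally show "norm (fps_nth (W ^ Suc i) m) * r ^ m \<le> (\<Sum>k\<le>m. A k * B (m - k))" .
  qed
  also have "\<dots> = (\<Sum>(k, l)\<in>{(k, l). k + l \<le> N}. A k * B l)"
    unfolding sum.Sigma[OF finite_atMost ballI[OF finite_atMost]]
    by (rule sum.reindex_bij_witness[of _ "\<lambda>(k, l). (k + l, k)" "\<lambda>(m, k). (k, m - k)"]) auto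
  also have "\<dots> \<le> (\<Sum>(k, l)\<in>{..N} \<times> {..N}. A k * B l)"
    by (rule sum_mono2) (use nn in auto)
  also have "\<dots> = (\<Sum>m\<le>N. A m) * (\<Sum>m\<le>N. B m)"
    by (simp add: sum_product sum.cartesian_product)
  also have "\<dots> \<le> (\<Sum>m\<le>N. A m) * (\<Sum>m\<le>N. A m) ^ i"
    using Suc by (intro mult_left_mono sum_nonneg nn) (simp add: A_def B_def)
  finally show ?case by (simp add: A_def)
qed

text \<open>Expanding \<open>g \<circ> w\<close> in powers of w, the i-th coefficient of g is
  multiplied by the majorant sum of the i-th power of w. That is at most the i-th power of the
  majorant sum of w, hence at most \<open>r ^ i\<close>.\<close>

lemma bohr_subordination:
  fixes f g w :: "complex \<Rightarrow> complex"
  assumes holg: "g holomorphic_on ball 0 1" and holw: "w holomorphic_on ball 0 1" 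
    and le: "\<And>z. z \<in> ball 0 1 \<Longrightarrow> norm (w z) \<le> norm z"
    and f: "\<And>z. z \<in> ball 0 1 \<Longrightarrow> f z = g (w z)"
    and r: "0 \<le> r" "r \<le> 1/3"
  shows "(\<Sum>n\<le>N. norm (taylor_coeff f n) * r ^ n) \<le> (\<Sum>n\<le>N. norm (taylor_coeff g n) * r ^ n)"
proof -
  define W where "W = fps_expansion w 0"
  define G where "G = fps_expansion g 0"
  have w: "w has_fps_expansion W" unfolding W_def by (rule has_fps_expansion_disc[OF holw])
  have g: "g has_fps_expansion G" unfolding G_def by (rule has_fps_expansion_disc[OF holg])
  have w0: "w 0 = 0" using le[of 0] by simp
  have W0: "fps_nth W 0 = 0" using taylor_coeff_eq_fps_nth[OF w, of 0] w0 by (simp add: taylor_coeff_def)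
  have "(g \<circ> w) has_fps_expansion fps_compose G W"
    by (rule has_fps_expansion_compose[OF g w W0])
  moreover have "eventually (\<lambda>z. (g \<circ> w) z = f z) (nhds 0)"
    using eventually_nhds_in_open[of "ball 0 1" "0::complex"] f by (auto elim: eventually_mono)
  ultimately have "f has_fps_expansion fps_compose G W"
    using has_fps_expansion_cong by blast
  then have fn: "taylor_coeff f n = (\<Sum>i\<le>n. fps_nth G i * fps_nth (W ^ i) n)" for n
    using taylor_coeff_eq_fps_nth by (simp add: fps_compose_nth atLeast0AtMost)
  have gn: "taylor_coeff g n = fps_nth G n" for n using taylor_coeff_eq_fps_nth[OF g] .
  \<comment> \<open>Since w vanishes at 0, only \<open>i \<le> n\<close> contribute to the
    coefficient n; this is why both sides can be cut at the same N.\<close>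
  have "(\<Sum>n\<le>N. norm (taylor_coeff f n) * r ^ n) \<le> (\<Sum>n\<le>N. \<Sum>i\<le>N. norm (fps_nth G i) * (norm (fps_nth (W ^ i) n) * r ^ n))"
  proof (rule sum_mono)
    fix n assume n: "n \<in> {..N}"
    have "norm (taylor_coeff f n) * r ^ n \<le> (\<Sum>i\<le>n. norm (fps_nth G i * fps_nth (W ^ i) n)) * r ^ n"
      unfolding fn by (intro mult_right_mono sum_norm_le) (use r in auto)
    also have "\<dots> = (\<Sum>i\<le>n. norm (fps_nth G i) * (norm (fps_nth (W ^ i) n) * r ^ n))"
      unfolding sum_distrib_right by (simp add: norm_mult mult_ac)
    also have "\<dots> \<le> (\<Sum>i\<le>N. norm (fps_nth G i) * (norm (fps_nth (W ^ i) n) * r ^ n))"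
      by (rule sum_mono2) (use n r in auto)
    finally show "norm (taylor_coeff f n) * r ^ n \<le> (\<Sum>i\<le>N. norm (fps_nth G i) * (norm (fps_nth (W ^ i) n) * r ^ n))" .
  qed
  also have "\<dots> = (\<Sum>i\<le>N. norm (fps_nth G i) * (\<Sum>n\<le>N. norm (fps_nth (W ^ i) n) * r ^ n))"
    by (subst sum.swap) (simp add: sum_distrib_left)
  also have "\<dots> \<le> (\<Sum>i\<le>N. norm (fps_nth G i) * r ^ i)"
  proof (intro sum_mono mult_left_mono)
    fix i
    have "(\<Sum>n\<le>N. norm (fps_nth (W ^ i) n) * r ^ n) \<le> (\<Sum>n\<le>N. norm (fps_nth W n) * r ^ n) ^ i"
      by (rule sum_norm_fps_power_le[OF r(1)])
    also have "\<dots> \<le> r ^ i"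
      using sum_norm_taylor_self_map_le[OF holw le r, of N] r
      by (intro power_mono sum_nonneg) (auto simp: taylor_coeff_eq_fps_nth[OF w])
    finally show "(\<Sum>n\<le>N. norm (fps_nth (W ^ i) n) * r ^ n) \<le> r ^ i" .
  qed auto
  finally show ?thesis by (simp add: gn)
qed

section \<open>Differentiation and integration of majorant series\<close>

lemma summable_norm_taylor_coeff:
  assumes hol: "F holomorphic_on ball 0 1" and r: "\<bar>r\<bar> < 1"
  shows "summable (\<lambda>n. norm (taylor_coeff F n) * r ^ n)"
proof -
  have "summable (\<lambda>n. norm (taylor_coeff F n * (of_real r) ^ n))"
  proof (rule abs_summable_in_conv_radius)
    have "F holomorphic_on eball 0 (ereal 1)" using hol by (simp only: eball_ereal)
    from conv_radius_fps_expansion[OF this]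
    have "1 \<le> conv_radius (taylor_coeff F)"
      by (simp add: fps_conv_radius_def fps_expansion_def taylor_coeff_def[abs_def] one_ereal_def)
    moreover have "ereal (norm (complex_of_real r)) < 1" using r by (simp add: one_ereal_def)
    ultimately show "ereal (norm (complex_of_real r)) < conv_radius (taylor_coeff F)"
      by (rule less_le_trans[rotated])
  qed
  then have "summable (\<lambda>n. norm (norm (taylor_coeff F n) * r ^ n))"
    by (simp add: norm_mult norm_power abs_mult power_abs)
  then show ?thesis by (rule summable_norm_cancel)
qed

lemma taylor_coeff_deriv: "taylor_coeff (deriv F) n = of_nat (Suc n) * taylor_coeff F (Suc n)"
  by (simp add: taylor_coeff_def funpow_swap1 del: of_nat_Suc)

lemma majorant_has_derivative:
  assumes hol: "F holomorphic_on ball 0 1" and r: "\<bar>r\<bar> < 1"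
  shows "(majorant F has_real_derivative majorant (deriv F) r) (at r)"
proof -
  obtain s where s: "\<bar>r\<bar> < s" "s < 1" using dense[OF r] by auto
  have "((\<lambda>x. \<Sum>n. norm (taylor_coeff F n) * x ^ n) has_real_derivative
         (\<Sum>n. diffs (\<lambda>n. norm (taylor_coeff F n)) n * r ^ n)) (at r)"
    by (rule termdiffs_strong[of _ s]) (use s summable_norm_taylor_coeff[OF hol, of s] in auto)
  moreover have "diffs (\<lambda>n. norm (taylor_coeff F n)) n = norm (taylor_coeff (deriv F) n)" for n
    by (simp add: diffs_def taylor_coeff_deriv norm_mult del: of_nat_Suc)
  ultimately show ?thesis by (simp add: majorant_def[abs_def])
qed

lemma continuous_on_majorant:
  assumes "F holomorphic_on ball 0 1" "r < 1"
  shows "continuous_on {0..r} (majorant F)"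
  by (intro continuous_at_imp_continuous_on ballI DERIV_isCont[OF majorant_has_derivative[OF assms(1)]])
     (use assms(2) in auto)

lemma majorant_nonneg:
  assumes "F holomorphic_on ball 0 1" "0 \<le> r" "r < 1"
  shows "majorant F r \<ge> 0"
  unfolding majorant_def by (rule suminf_nonneg[OF summable_norm_taylor_coeff]) (use assms in auto)

lemma sum_le_majorant:
  assumes "F holomorphic_on ball 0 1" "0 \<le> r" "r < 1"
  shows "(\<Sum>n\<le>N. norm (taylor_coeff F n) * r ^ n) \<le> majorant F r"
  unfolding majorant_def
  by (rule sum_le_suminf[OF summable_norm_taylor_coeff]) (use assms in auto)

lemma majorant_has_integral:
  assumes "F holomorphic_on ball 0 1" "F 0 = 0" "0 \<le> r" "r < 1"
  shows "(majorant (deriv F) has_integral majorant F r) {0..r}"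
proof -
  have "(majorant (deriv F) has_integral majorant F r - majorant F 0) {0..r}"
  proof (rule fundamental_theorem_of_calculus[OF assms(3)])
    fix x assume "x \<in> {0..r}"
    then show "(majorant F has_vector_derivative majorant (deriv F) x) (at x within {0..r})"
      using majorant_has_derivative[OF assms(1), of x] assms(4)
      by (auto simp: has_real_derivative_iff_has_vector_derivative intro: has_vector_derivative_at_within)
  qed
  moreover have "majorant F 0 = 0"
    using powser_zero[of "\<lambda>n. norm (taylor_coeff F n)"] assms(2) by (simp add: majorant_def taylor_coeff_def)
  ultimately show ?thesis by simp
qed

text \<open>The weight \<open>t ^ k\<close> serves two cases: \<open>k = 0\<close> recovers the
  coefficients of h from those of \<open>h'\<close>, and \<open>k = 1\<close> those of g, whose
  derivative has the additional factor z.\<close>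

lemma sum_power_has_integral:
  fixes a :: "nat \<Rightarrow> real"
  assumes "0 \<le> r"
  shows "((\<lambda>t. t ^ k * (\<Sum>n\<le>N. a n * t ^ n)) has_integral (\<Sum>n\<le>N. a n / real (Suc (n + k)) * r ^ Suc (n + k))) {0..r}"
proof -
  have "((\<lambda>t. t ^ k * (\<Sum>n\<le>N. a n * t ^ n)) has_integral
     (\<Sum>n\<le>N. a n / real (Suc (n + k)) * r ^ Suc (n + k)) - (\<Sum>n\<le>N. a n / real (Suc (n + k)) * 0 ^ Suc (n + k))) {0..r}"
  proof (rule fundamental_theorem_of_calculus[OF assms])
    fix x assume "x \<in> {0..r}"
    have "((\<lambda>x. \<Sum>n\<le>N. a n / real (Suc (n + k)) * x ^ Suc (n + k)) has_real_derivative (\<Sum>n\<le>N. a n * x ^ (n + k))) (at x within {0..r})"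
      by (intro DERIV_sum) (auto intro!: derivative_eq_intros simp del: power_Suc of_nat_Suc)
    then show "((\<lambda>x. \<Sum>n\<le>N. a n / real (Suc (n + k)) * x ^ Suc (n + k)) has_vector_derivative x ^ k * (\<Sum>n\<le>N. a n * x ^ n)) (at x within {0..r})"
      by (simp add: has_real_derivative_iff_has_vector_derivative sum_distrib_left power_add mult_ac)
  qed
  then show ?thesis by simp
qed

text \<open>Bohr's inequality is applied to the derivatives at every t in [0, r] and then
  integrated. Partial sums are compared throughout, and the limit is taken only at the end.\<close>

lemma HC_majorant_le:
  fixes h g K v :: "complex \<Rightarrow> complex"
  assumes holh: "h holomorphic_on ball 0 1" and h0: "h 0 = 0" and h'0: "deriv h 0 = 1"
    and holg: "g holomorphic_on ball 0 1" and g: "\<And>z. z \<in> ball 0 1 \<Longrightarrow> deriv g z = \<alpha> * z * deriv h z"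
    and holK: "K holomorphic_on ball 0 1" and K0: "K 0 = 0"
    and holv: "v holomorphic_on ball 0 1" and v: "\<And>z. z \<in> ball 0 1 \<Longrightarrow> norm (v z) \<le> norm z"
    and hK: "\<And>z. z \<in> ball 0 1 \<Longrightarrow> deriv h z = deriv K (v z)"
    and r: "0 \<le> r" "r \<le> 1/3"
  shows "harm_majorant h g r \<le> majorant K r + norm \<alpha> * integral {0..r} (\<lambda>t. t * majorant (deriv K) t)"
proof -
  have holK': "deriv K holomorphic_on ball 0 1" by (intro holomorphic_deriv holK) auto
  have holh': "deriv h holomorphic_on ball 0 1" by (intro holomorphic_deriv holh) auto
  define a where "a = (\<lambda>n. norm (taylor_coeff (deriv h) n))"
  have a_le: "(\<Sum>n\<le>N. a n * t ^ n) \<le> majorant (deriv K) t" if "t \<in> {0..r}" for t N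
    using bohr_subordination[OF holK' holv v hK, of t N] sum_le_majorant[OF holK', of t N] that r
    by (auto simp: a_def intro: order_trans)
  have ha: "norm (taylor_coeff h (Suc n)) = a n / real (Suc n)" for n
    by (simp add: a_def taylor_coeff_deriv norm_mult del: of_nat_Suc)
  \<comment> \<open>The factor z in \<open>g'\<close> shifts indices by one: coefficient n + 1 of
    \<open>g'\<close> is \<alpha> times coefficient n of \<open>h'\<close>.\<close>
  have ga: "norm (taylor_coeff g (n + 2)) = norm \<alpha> * (a n / real (n + 2))" for n
  proof -
    have "(\<lambda>z. \<alpha> * z * deriv h z) has_fps_expansion fps_const \<alpha> * fps_X * fps_expansion (deriv h) 0"
      by (intro fps_expansion_intros has_fps_expansion_disc holh')
    moreover have "eventually (\<lambda>z. \<alpha> * z * deriv h z = deriv g z) (nhds 0)"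
      using eventually_nhds_in_open[of "ball 0 1" "0::complex"] g by (auto elim: eventually_mono)
    ultimately have "deriv g has_fps_expansion fps_const \<alpha> * fps_X * fps_expansion (deriv h) 0"
      using has_fps_expansion_cong[of "\<lambda>z. \<alpha> * z * deriv h z" "deriv g", OF _ refl] by blast
    then have "taylor_coeff (deriv g) (Suc n) = \<alpha> * taylor_coeff (deriv h) n"
      by (simp add: taylor_coeff_eq_fps_nth taylor_coeff_eq_fps_nth[OF has_fps_expansion_disc[OF holh']] mult.assoc)
    then have "of_nat (n + 2) * taylor_coeff g (n + 2) = \<alpha> * taylor_coeff (deriv h) n"
      unfolding taylor_coeff_deriv[of g] by (simp only: add_2_eq_Suc')
    then have "norm (of_nat (n + 2) * taylor_coeff g (n + 2)) = norm (\<alpha> * taylor_coeff (deriv h) n)" by (rule arg_cong)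
    then have "real (n + 2) * norm (taylor_coeff g (n + 2)) = norm \<alpha> * a n"
      by (simp only: norm_mult norm_of_nat a_def)
    then show ?thesis by (simp add: field_simps)
  qed
  have h_le: "(\<Sum>n\<le>N. norm (taylor_coeff h (Suc n)) * r ^ Suc n) \<le> majorant K r" for N
  proof -
    have "((\<lambda>t. t ^ 0 * (\<Sum>n\<le>N. a n * t ^ n)) has_integral (\<Sum>n\<le>N. norm (taylor_coeff h (Suc n)) * r ^ Suc n)) {0..r}"
      using sum_power_has_integral[OF r(1), where k = 0 and N = N and a = a] by (simp add: ha)
    moreover have "(majorant (deriv K) has_integral majorant K r) {0..r}"
      by (rule majorant_has_integral[OF holK K0 r(1)]) (use r in auto)
    ultimately show ?thesis by (rule has_integral_le) (use a_le in auto)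
  qed
  have g_le: "(\<Sum>n\<le>N. norm (taylor_coeff g (n + 2)) * r ^ (n + 2)) \<le> norm \<alpha> * integral {0..r} (\<lambda>t. t * majorant (deriv K) t)" for N
  proof -
    have "((\<lambda>t. t ^ 1 * (\<Sum>n\<le>N. a n * t ^ n)) has_integral (\<Sum>n\<le>N. a n / real (Suc (n + 1)) * r ^ Suc (n + 1))) {0..r}"
      by (rule sum_power_has_integral[OF r(1)])
    moreover have "((\<lambda>t. t * majorant (deriv K) t) has_integral integral {0..r} (\<lambda>t. t * majorant (deriv K) t)) {0..r}"
      by (intro integrable_integral integrable_continuous_interval continuous_intros continuous_on_majorant holK') (use r in auto)
    ultimately have "(\<Sum>n\<le>N. a n / real (Suc (n + 1)) * r ^ Suc (n + 1)) \<le> integral {0..r} (\<lambda>t. t * majorant (deriv K) t)"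
      by (rule has_integral_le) (use a_le in \<open>auto intro: mult_left_mono\<close>)
    then have "norm \<alpha> * (\<Sum>n\<le>N. a n / real (n + 2) * r ^ (n + 2)) \<le> norm \<alpha> * integral {0..r} (\<lambda>t. t * majorant (deriv K) t)"
      by (intro mult_left_mono) simp_all
    then show ?thesis unfolding ga by (simp add: sum_distrib_left mult_ac)
  qed
  have partial: "r + (\<Sum>n\<le>N. (norm (taylor_coeff h (n + 2)) + norm (taylor_coeff g (n + 2))) * r ^ (n + 2))
      \<le> majorant K r + norm \<alpha> * integral {0..r} (\<lambda>t. t * majorant (deriv K) t)" for N
  proof -
    \<comment> \<open>Summing up to \<open>Suc N\<close> reaches the power N + 2, and the term split
      off is the linear one, equal to r because \<open>h' 0 = 1\<close>.\<close>
    have "(\<Sum>n\<le>Suc N. norm (taylor_coeff h (Suc n)) * r ^ Suc n) = r + (\<Sum>n\<le>N. norm (taylor_coeff h (n + 2)) * r ^ (n + 2))"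
      unfolding sum.atMost_Suc_shift using h'0 by (simp add: taylor_coeff_def)
    then show ?thesis using h_le[of "Suc N"] g_le[of N] by (simp add: distrib_right sum.distrib)
  qed
  have "summable (\<lambda>n. norm (taylor_coeff h (n + 2)) * r ^ (n + 2))"
    "summable (\<lambda>n. norm (taylor_coeff g (n + 2)) * r ^ (n + 2))"
    using summable_norm_taylor_coeff[OF holh, of r] summable_norm_taylor_coeff[OF holg, of r] r
    by (intro summable_ignore_initial_segment; simp)+
  then have sm: "summable (\<lambda>n. (norm (taylor_coeff h (n + 2)) + norm (taylor_coeff g (n + 2))) * r ^ (n + 2))"
    unfolding distrib_right by (rule summable_add)
  have "(\<Sum>n. (norm (taylor_coeff h (n + 2)) + norm (taylor_coeff g (n + 2))) * r ^ (n + 2))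
     \<le> majorant K r + norm \<alpha> * integral {0..r} (\<lambda>t. t * majorant (deriv K) t) - r"
  proof (rule suminf_le_const[OF sm])
    fix n
    have "(\<Sum>i<n. (norm (taylor_coeff h (i + 2)) + norm (taylor_coeff g (i + 2))) * r ^ (i + 2))
       \<le> (\<Sum>i\<le>n. (norm (taylor_coeff h (i + 2)) + norm (taylor_coeff g (i + 2))) * r ^ (i + 2))"
      by (rule sum_mono2) (use r in auto)
    then show "(\<Sum>i<n. (norm (taylor_coeff h (i + 2)) + norm (taylor_coeff g (i + 2))) * r ^ (i + 2))
      \<le> majorant K r + norm \<alpha> * integral {0..r} (\<lambda>t. t * majorant (deriv K) t) - r"
      using partial[of n] by linarith
  qed
  then show ?thesis by (simp add: harm_majorant_def)
qed

subsection \<open>Harmonic mappings with convex analytic part\<close>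

text \<open>The geometry of f depends on \<phi> only through the convexity inequality for h, so
  \<phi> is dropped here.\<close>

locale convex_harmonic =
  fixes h g :: "complex \<Rightarrow> complex" and \<alpha> :: complex
  assumes holh: "h holomorphic_on ball 0 1" and injh: "inj_on h (ball 0 1)"
    and convh: "\<And>z. z \<in> ball 0 1 \<Longrightarrow> Re (1 + z * deriv (deriv h) z / deriv h z) > 0"
    and holg: "g holomorphic_on ball 0 1" 
    and derivg: "\<And>z. z \<in> ball 0 1 \<Longrightarrow> deriv g z = \<alpha> * z * deriv h z"
    and \<alpha>: "norm \<alpha> \<le> 1"
begin

lemma deriv_h_nonzero: "z \<in> ball 0 1 \<Longrightarrow> deriv h z \<noteq> 0"
  using holomorphic_injective_imp_regular[OF holh _ injh] by auto

lemma norm_deriv_g: "z \<in> ball 0 1 \<Longrightarrow> norm (deriv g z) = norm \<alpha> * norm z * norm (deriv h z)"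
  by (simp add: derivg norm_mult)

lemma norm_deriv_g_less: "z \<in> ball 0 1 \<Longrightarrow> norm (deriv g z) < norm (deriv h z)"
proof -
  assume z: "z \<in> ball 0 1"
  have "norm \<alpha> * norm z < 1" using z \<alpha> mult_left_le_one_le[of "norm z" "norm \<alpha>"] by auto
  then show ?thesis using deriv_h_nonzero[OF z] norm_deriv_g[OF z] by simp
qed

text \<open>In the coordinate \<open>w = h z\<close> the function g has derivative
  \<open>g'/h' = \<alpha> z\<close>, of modulus at most s. The mean value inequality needs a convex
  domain, namely the image of \<open>cball 0 s\<close> under h.\<close>

lemma g_contraction:
  assumes s: "0 < s" "s < 1" and z: "z1 \<in> cball 0 s" "z2 \<in> cball 0 s"
  shows "norm (g z1 - g z2) \<le> s * norm (h z1 - h z2)"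
proof -
  obtain H where holH: "H holomorphic_on h ` ball 0 1" 
    and dH: "\<And>z. z \<in> ball 0 1 \<Longrightarrow> deriv h z * deriv H (h z) = 1" 
    and H: "\<And>z. z \<in> ball 0 1 \<Longrightarrow> H (h z) = z"
    using holomorphic_has_inverse[OF holh open_ball injh] by metis
  have oph: "open (h ` ball 0 1)" by (rule open_mapping_thm3[OF holh open_ball injh])
  have der: "((\<lambda>w. g (H w)) has_field_derivative \<alpha> * H w) (at w within h ` cball 0 s)" if w: "w \<in> h ` cball 0 s" for w
  proof -
    have "w \<in> h ` ball 0 1" using w s by auto
    then obtain z where z: "z \<in> ball 0 1" "w = h z" by blast
    have "((\<lambda>w. g (H w)) has_field_derivative deriv g (H w) * deriv H w) (at w)"
      by (rule DERIV_chain2) 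
         (use holomorphic_derivI[OF holg open_ball z(1)] holomorphic_derivI[OF holH oph imageI[OF z(1)]] H z in auto)
    moreover have "deriv g (H w) * deriv H w = \<alpha> * H w"
      using dH[OF z(1)] H[OF z(1)] derivg[OF z(1)] z(2) by (simp add: mult.assoc)
    ultimately show ?thesis by (simp add: has_field_derivative_at_within)
  qed
  have "norm ((\<lambda>w. g (H w)) (h z1) - (\<lambda>w. g (H w)) (h z2)) \<le> s * norm (h z1 - h z2)"
  proof (rule field_differentiable_bound[OF _ der])
    show "convex (h ` cball 0 s)" by (rule convex_image_cball[OF holh injh convh s])
    fix w assume "w \<in> h ` cball 0 s"
    then obtain z where z: "norm z \<le> s" "w = h z" by auto
    then have "norm \<alpha> * norm z \<le> 1 * s" using \<alpha> s by (intro mult_mono) auto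
    then show "norm (\<alpha> * H w) \<le> s" using H[of z] z s by (simp add: norm_mult)
  qed (use z in auto)
  then show ?thesis using H[of z1] H[of z2] z s by simp
qed

lemma g_lipschitz:
  assumes z: "z1 \<in> ball 0 1" "z2 \<in> ball 0 1"
  shows "norm (g z1 - g z2) \<le> norm (h z1 - h z2)"
proof -
  define s where "s = max (1/2) (max (norm z1) (norm z2))"
  have s: "0 < s" "s < 1" using z by (auto simp: s_def)
  have "norm (g z1 - g z2) \<le> s * norm (h z1 - h z2)"
    by (rule g_contraction[OF s]) (auto simp: s_def)
  also have "\<dots> \<le> 1 * norm (h z1 - h z2)" using s by (intro mult_right_mono) auto
  finally show ?thesis by simp
qed

text \<open>Equal values of f give \<open>|h z1 - h z2| = |g z1 - g z2|\<close>, which a contraction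
  with factor s < 1 allows only if both sides are 0.\<close>

lemma inj_harm: "inj_on (harm h g) (ball 0 1)"
proof (rule inj_onI)
  fix z1 z2 assume z: "z1 \<in> ball 0 1" "z2 \<in> ball 0 1" and eq: "harm h g z1 = harm h g z2"
  define s where "s = max (1/2) (max (norm z1) (norm z2))"
  have s: "0 < s" "s < 1" using z by (auto simp: s_def)
  have le: "norm (g z1 - g z2) \<le> s * norm (h z1 - h z2)"
    by (rule g_contraction[OF s]) (auto simp: s_def)
  have "h z1 - h z2 = - cnj (g z1 - g z2)" using eq by (simp add: harm_def algebra_simps)
  then have "norm (h z1 - h z2) = norm (g z1 - g z2)" by (metis complex_mod_cnj norm_minus_cancel)
  then have "(1 - s) * norm (h z1 - h z2) \<le> 0" using le by (simp add: algebra_simps)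
  then have "h z1 = h z2" using s by (simp add: mult_le_0_iff)
  then show "z1 = z2" using injh z by (auto dest: inj_onD)
qed

lemma continuous_on_harm: "continuous_on (ball 0 1) (harm h g)"
  unfolding harm_def using holh holg by (intro continuous_intros holomorphic_on_imp_continuous_on)

lemma open_harm_image:
  assumes "open U" "U \<subseteq> ball 0 1" shows "open (harm h g ` U)"
  by (rule invariance_of_domain) 
     (use assms in \<open>auto intro: continuous_on_subset[OF continuous_on_harm] inj_on_subset[OF inj_harm]\<close>)

text \<open>Otherwise the inverse of h would be a bounded entire function, hence constant.\<close>

lemma h_image_neq_UNIV: "h ` ball 0 1 \<noteq> UNIV"
proof
  assume eq: "h ` ball 0 1 = UNIV"
  obtain H where holH: "H holomorphic_on h ` ball 0 1" and H: "\<And>z. z \<in> ball 0 1 \<Longrightarrow> H (h z) = z"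
    using holomorphic_has_inverse[OF holh open_ball injh] by metis
  have "range H \<subseteq> ball 0 1" using H unfolding eq[symmetric] by auto
  then have "bounded (range H)" using bounded_ball bounded_subset by blast
  then have "H constant_on UNIV"
    using Liouville_theorem[of H] holH eq by simp
  then have "H (h 0) = H (h (1/2))" unfolding constant_on_def by auto
  then show False using H[of 0] H[of "1/2"] by (simp add: norm_divide)
qed

text \<open>Since \<open>g\<close> is 1-Lipschitz as a function of \<open>h\<close>, the map extends continuously to a boundary point
  of the convex domain \<open>h(D)\<close>. The value there is omitted by the strict contraction near each inner point.\<close>

lemma harm_image_neq_UNIV: "harm h g ` ball 0 1 \<noteq> UNIV"
proof
  assume onto: "harm h g ` ball 0 1 = UNIV"
  define \<Omega> where "\<Omega> = h ` ball 0 1"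
  have op\<Omega>: "open \<Omega>" unfolding \<Omega>_def by (rule open_mapping_thm3[OF holh open_ball injh])
  have "\<Omega> \<noteq> {}" "\<Omega> \<noteq> UNIV" using h_image_neq_UNIV by (auto simp: \<Omega>_def)
  then have "frontier \<Omega> \<noteq> {}" using frontier_eq_empty by auto
  then obtain p where p: "p \<in> closure \<Omega>" "p \<notin> \<Omega>"
    using op\<Omega> by (auto simp: frontier_def interior_open)
  obtain y where y: "\<And>n. y n \<in> \<Omega>" "y \<longlonglongrightarrow> p" using p(1) closure_sequential by blast
  have "\<forall>n. \<exists>z. z \<in> ball 0 1 \<and> y n = h z" using y(1) unfolding \<Omega>_def by blast
  then obtain z where z: "\<And>n. z n \<in> ball 0 1" "\<And>n. y n = h (z n)" by metis
  \<comment> \<open>The 1-Lipschitz bound turns convergence of \<open>h (z n)\<close> into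
    convergence of \<open>g (z n)\<close>; \<open>p + cnj p'\<close> is the value of the extension
    at p.\<close>
  have "Cauchy (\<lambda>n. g (z n))"
  proof (rule metric_CauchyI)
    fix e :: real assume "e > 0"
    then obtain M where M: "\<And>m n. m \<ge> M \<Longrightarrow> n \<ge> M \<Longrightarrow> dist (y m) (y n) < e"
      using LIMSEQ_imp_Cauchy[OF y(2)] metric_CauchyD by blast
    show "\<exists>M. \<forall>m\<ge>M. \<forall>n\<ge>M. dist (g (z m)) (g (z n)) < e"
      using M g_lipschitz[OF z(1) z(1)] by (auto simp: dist_norm z(2) intro!: exI[of _ M] le_less_trans[OF g_lipschitz[OF z(1) z(1)]])
  qed
  then obtain p' where p': "(\<lambda>n. g (z n)) \<longlonglongrightarrow> p'" using Cauchy_convergent convergent_def by blast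
  \<comment> \<open>If the extended value is attained at an inner point q, then the increments of h
    and g between q and the boundary point have equal modulus.\<close>
  obtain q where q: "q \<in> ball 0 1" "p + cnj p' = harm h g q" using onto by (metis UNIV_I imageE)
  have eqn: "norm (p - h q) = norm (p' - g q)"
  proof -
    have "p - h q = - cnj (p' - g q)" using q(2) by (simp add: harm_def algebra_simps)
    then show ?thesis by (metis complex_mod_cnj norm_minus_cancel)
  qed
  define s where "s = (norm q + 1) / 2"
  have s: "0 < s" "s < 1" "norm q < s" using q(1) by (auto simp: s_def add_nonneg_pos)
  have "open (h ` ball 0 s)"
    by (rule open_mapping_thm3) (use s injh holh in \<open>auto intro: inj_on_subset holomorphic_on_subset\<close>)
  moreover have "h q \<in> h ` ball 0 s" using s by auto
  ultimately obtain \<delta> where \<delta>: "\<delta> > 0" "cball (h q) \<delta> \<subseteq> h ` ball 0 s"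
    using open_contains_cball by blast
  have sub: "h ` ball 0 s \<subseteq> \<Omega>" using s by (auto simp: \<Omega>_def)
  then have "p \<notin> cball (h q) \<delta>" using p \<delta> by blast
  then have pd: "norm (p - h q) > \<delta>" by (simp add: dist_norm norm_minus_commute)
  have lim: "(\<lambda>n. norm (y n - h q)) \<longlonglongrightarrow> norm (p - h q)" by (intro tendsto_intros y)
  have ev: "eventually (\<lambda>n. norm (g (z n) - g q) \<le> norm (y n - h q) - (1 - s) * \<delta>) sequentially"
    using order_tendstoD(1)[OF lim pd]
  proof eventually_elim
    case (elim n)
    define d where "d = norm (y n - h q)"
    have d: "d > \<delta>" using elim by (simp add: d_def)
    \<comment> \<open>u splits the segment from \<open>h q\<close> to \<open>y n\<close> at distance
      \<delta>. On the first piece g contracts with factor s, on the rest with factor 1, which saves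
      \<open>(1 - s) * \<delta>\<close> uniformly in n.\<close>
    define u where "u = h q + of_real (\<delta> / d) * (y n - h q)"
    have u1: "norm (u - h q) = \<delta>" using d \<delta>(1) by (simp add: u_def norm_mult norm_divide flip: d_def)
    have "y n - u = of_real (1 - \<delta> / d) * (y n - h q)" by (simp add: u_def algebra_simps)
    then have "norm (y n - u) = \<bar>1 - \<delta> / d\<bar> * d" by (simp only: norm_mult norm_of_real d_def)
    also have "\<dots> = d - \<delta>" using d \<delta>(1) by (simp add: field_simps)
    finally have u2: "norm (y n - u) = d - \<delta>" .
    have "u \<in> cball (h q) \<delta>" using u1 by (simp add: dist_norm norm_minus_commute)
    then obtain x where x: "x \<in> ball 0 s" "u = h x" using \<delta>(2) by blast
    have "norm (g x - g q) \<le> s * norm (h x - h q)"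
      by (rule g_contraction[OF s(1,2)]) (use x s in auto)
    then have "norm (g x - g q) \<le> s * \<delta>" using u1 x by simp
    moreover have "norm (g (z n) - g x) \<le> d - \<delta>"
      using g_lipschitz[OF z(1)[of n], of x] x s u2 z(2)[of n] by simp
    moreover have "norm (g (z n) - g q) \<le> norm (g (z n) - g x) + norm (g x - g q)"
      by (metis diff_add_cancel add_diff_eq norm_triangle_ineq)
    ultimately show ?case by (simp add: d_def algebra_simps)
  qed
  have "norm (p' - g q) \<le> norm (p - h q) - (1 - s) * \<delta>"
    by (rule tendsto_le[OF _ _ _ ev]) (auto intro!: tendsto_intros lim p')
  moreover have "(1 - s) * \<delta> > 0" using s \<delta>(1) by simp
  ultimately show False using eqn by linarith
qed

section \<open>Local inverses of f and the size of omitted values\<close>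

lemma harm_has_derivative:
  assumes z: "z \<in> ball 0 1"
  shows "(harm h g has_derivative (\<lambda>v. deriv h z * v + cnj (deriv g z * v))) (at z)"
proof -
  have "(h has_derivative (\<lambda>v. deriv h z * v)) (at z)" "(g has_derivative (\<lambda>v. deriv g z * v)) (at z)"
    using holomorphic_derivI[OF holh open_ball z] holomorphic_derivI[OF holg open_ball z]
    by (auto simp: has_field_derivative_def)
  then show ?thesis unfolding harm_def
    by (auto intro!: derivative_eq_intros bounded_linear.has_derivative[OF bounded_linear_cnj])
qed

text \<open>The differential \<open>a v + b cnj v\<close> is inverted explicitly; its determinant J
  is nonzero because \<open>|b| < |a|\<close>. The estimate is
  \<open>|a x + b cnj x| \<ge> (|a| - |b|) |x|\<close> read at \<open>x = D u\<close>.\<close>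

lemma harm_inverse_has_derivative:
  assumes z: "z \<in> ball 0 1" and G: "\<And>z. z \<in> ball 0 1 \<Longrightarrow> G (harm h g z) = z"
  obtains D where "(G has_derivative D) (at (harm h g z))"
    "\<And>u. (norm (deriv h z) - norm (deriv g z)) * norm (D u) \<le> norm u"
proof -
  define a where "a = deriv h z"
  define b where "b = cnj (deriv g z)"
  define J where "J = (norm a)\<^sup>2 - (norm b)\<^sup>2"
  have ab: "norm b < norm a" using norm_deriv_g_less[OF z] by (simp add: a_def b_def)
  then have "norm a \<noteq> - norm b" using norm_ge_zero[of a] norm_ge_zero[of b] by linarith
  then have J: "J \<noteq> 0" using ab by (simp add: J_def power2_eq_iff)
  have Jc: "of_real J = a * cnj a - b * cnj b" by (simp add: J_def flip: complex_norm_square)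
  define D where "D = (\<lambda>u. (cnj a * u - b * cnj u) / of_real J)"
  have inv: "a * D u + b * cnj (D u) = u" for u
  proof -
    have "a * D u + b * cnj (D u) = (a * (cnj a * u - b * cnj u) + b * (a * cnj u - cnj b * u)) / of_real J"
      by (simp add: D_def add_divide_distrib)
    also have "\<dots> = (of_real J * u) / of_real J" unfolding Jc by (simp add: algebra_simps)
    finally show ?thesis using J by simp
  qed
  have "(G has_derivative D) (at (harm h g z))"
  proof (rule has_derivative_inverse_strong[where S = "ball 0 1" and f = "harm h g"])
    show "(harm h g has_derivative (\<lambda>v. a * v + b * cnj v)) (at z)"
      using harm_has_derivative[OF z] by (simp add: a_def b_def)
    show "(\<lambda>v. a * v + b * cnj v) \<circ> D = id" using inv by (simp add: fun_eq_iff)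
  qed (use z G continuous_on_harm in auto)
  moreover have "(norm (deriv h z) - norm (deriv g z)) * norm (D u) \<le> norm u" for u
  proof -
    have "norm (a * D u) - norm (b * cnj (D u)) \<le> norm (a * D u + b * cnj (D u))"
      by (metis add.commute norm_diff_ineq)
    then show ?thesis unfolding inv by (simp add: norm_mult a_def b_def algebra_simps)
  qed
  ultimately show ?thesis by (rule that)
qed

text \<open>Lift the segment from \<open>0\<close> to \<open>w\<close> until it leaves the image; the modulus of the lift then tends to 1.\<close>

lemma omitted_value_norm_ge:
  fixes \<Lambda> l :: "real \<Rightarrow> real"
  assumes h0: "h 0 = 0" and g0: "g 0 = 0"
    and cont\<Lambda>: "continuous_on {0..<1} \<Lambda>" and \<Lambda>0: "\<Lambda> 0 = 0"
    and d\<Lambda>: "\<And>\<rho>. 0 < \<rho> \<Longrightarrow> \<rho> < 1 \<Longrightarrow> (\<Lambda> has_real_derivative l \<rho>) (at \<rho>)"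
    and l: "\<And>\<rho>. 0 < \<rho> \<Longrightarrow> \<rho> < 1 \<Longrightarrow> l \<rho> \<ge> 0"
    and le: "\<And>z. z \<in> ball 0 1 \<Longrightarrow> z \<noteq> 0 \<Longrightarrow> l (norm z) \<le> norm (deriv h z) - norm (deriv g z)"
    and w: "w \<notin> harm h g ` ball 0 1" and r: "0 < r" "r < 1"
  shows "\<Lambda> r \<le> norm w"
proof -
  let ?f = "harm h g"
  have f0: "?f 0 = 0" by (simp add: harm_def h0 g0)
  have opf: "open (?f ` ball 0 1)" by (rule open_harm_image) auto
  define G where "G = inv_into (ball 0 1) ?f"
  have G: "G (?f z) = z" if "z \<in> ball 0 1" for z
    unfolding G_def by (rule inv_into_f_f[OF inj_harm that])
  have w0: "w \<noteq> 0" using w f0 by (metis centre_in_ball imageI zero_less_one)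
  \<comment> \<open>These are the parameters at which the segment is outside the image. The least of
    them, S, is the first exit, so the lift \<gamma> exists on [0, S).\<close>
  define A where "A = {0..1} \<inter> (\<lambda>s::real. s *\<^sub>R w) -` (- (?f ` ball 0 1))"
  have "closed A" unfolding A_def
    by (intro continuous_closed_preimage continuous_intros) (use opf in auto)
  have "1 \<in> A" using w by (simp add: A_def)
  have bA: "bdd_below A" by (auto simp: A_def)
  define S where "S = Inf A"
  have SA: "S \<in> A" unfolding S_def by (rule closed_contains_Inf) (use \<open>closed A\<close> \<open>1 \<in> A\<close> bA in auto)
  have S1: "S \<le> 1" using SA by (simp add: A_def)
  have Spos: "S > 0"
  proof -
    have "0 \<notin> A" using f0 by (auto simp: A_def image_iff intro!: bexI[of _ 0])
    then show ?thesis using SA by (cases "S = 0") (auto simp: A_def)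
  qed
  have inA: "s *\<^sub>R w \<in> ?f ` ball 0 1" if "0 \<le> s" "s < S" for s
  proof (rule ccontr)
    assume "\<not> ?thesis"
    then have "s \<in> A" using that S1 by (auto simp: A_def)
    then have "S \<le> s" unfolding S_def by (rule cInf_lower[OF _ bA])
    then show False using that by simp
  qed
  define \<gamma> where "\<gamma> = (\<lambda>s. G (s *\<^sub>R w))"
  have \<gamma>in: "\<gamma> s \<in> ball 0 1" and f\<gamma>: "?f (\<gamma> s) = s *\<^sub>R w" if "0 \<le> s" "s < S" for s
    unfolding \<gamma>_def G_def by (rule inv_into_into[OF inA[OF that]], rule f_inv_into_f[OF inA[OF that]])
  have \<gamma>0: "\<gamma> 0 = 0" using G[of 0] f0 by (simp add: \<gamma>_def)
  have \<gamma>nz: "\<gamma> s \<noteq> 0" if "0 < s" "s < S" for s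
    using f\<gamma>[of s] that f0 w0 by auto
  have d\<gamma>: "\<exists>\<gamma>'. (\<gamma> has_vector_derivative \<gamma>') (at s) \<and> (norm (deriv h (\<gamma> s)) - norm (deriv g (\<gamma> s))) * norm \<gamma>' \<le> norm w"
    if s: "0 \<le> s" "s < S" for s
  proof -
    obtain D where D: "(G has_derivative D) (at (?f (\<gamma> s)))"
      "\<And>u. (norm (deriv h (\<gamma> s)) - norm (deriv g (\<gamma> s))) * norm (D u) \<le> norm u"
      using harm_inverse_has_derivative[OF \<gamma>in[OF s] G] by blast
    have "((\<lambda>s. G (s *\<^sub>R w)) has_derivative (\<lambda>t. D (t *\<^sub>R w))) (at s)"
      by (rule has_derivative_compose[where g = G]) 
         (use D(1) f\<gamma>[OF s] in \<open>auto intro!: derivative_eq_intros\<close>)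
    then have "(\<gamma> has_vector_derivative D w) (at s)"
      unfolding has_vector_derivative_def \<gamma>_def
      by (rule has_derivative_eq_rhs) (use has_derivative_linear[OF D(1)] in \<open>auto simp: fun_eq_iff linear_cmul\<close>)
    then show ?thesis using D(2)[of w] by blast
  qed
  have bound: "\<Lambda> (norm (\<gamma> s)) \<le> norm w" if s: "0 < s" "s < S" for s
  proof -
    have cont\<gamma>: "continuous_on {0..s} \<gamma>"
    proof (intro continuous_at_imp_continuous_on ballI)
      fix x assume "x \<in> {0..s}"
      then obtain \<gamma>' where "(\<gamma> has_vector_derivative \<gamma>') (at x)" using d\<gamma>[of x] s by auto
      then show "isCont \<gamma> x" by (rule has_vector_derivative_continuous)
    qed
    \<comment> \<open>The derivative of \<open>\<Lambda> (norm (\<gamma> s))\<close> is at most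
      \<open>l (norm (\<gamma> s)) * norm \<gamma>'\<close>, which the estimate for the inverse
      bounds by \<open>norm w\<close>; hence v increases.\<close>
    define v where "v = (\<lambda>s. s * norm w - \<Lambda> (norm (\<gamma> s)))"
    have "v 0 \<le> v s"
    proof (rule DERIV_nonneg_imp_increasing_open[of 0 s v])
      show "continuous_on {0..s} v" unfolding v_def
        by (intro continuous_intros continuous_on_compose2[OF cont\<Lambda>] cont\<gamma>) (use \<gamma>in s in force)
      fix x assume x: "0 < x" "x < s"
      then have xS: "0 \<le> x" "x < S" using s by auto
      obtain \<gamma>' where \<gamma>': "(\<gamma> has_vector_derivative \<gamma>') (at x)" 
        "(norm (deriv h (\<gamma> x)) - norm (deriv g (\<gamma> x))) * norm \<gamma>' \<le> norm w"
        using d\<gamma>[OF xS] by blast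
      \<comment> \<open>The norm is differentiable only off 0; the start s = 0, where \<gamma>
        vanishes, is covered by continuity of v.\<close>
      have nz: "\<gamma> x \<noteq> 0" using \<gamma>nz x s by auto
      have nb: "0 < norm (\<gamma> x)" "norm (\<gamma> x) < 1" using nz \<gamma>in[OF xS] by auto
      have dn: "((\<lambda>s. norm (\<gamma> s)) has_real_derivative sgn (\<gamma> x) \<bullet> \<gamma>') (at x)"
        using has_derivative_norm[OF nz] \<gamma>'(1)
        unfolding has_vector_derivative_def has_field_derivative_def
        by - (rule has_derivative_eq_rhs, rule has_derivative_compose[where g = norm and f = \<gamma>], assumption, assumption, 
            simp add: fun_eq_iff inner_commute mult.commute)
      have "((\<lambda>s. \<Lambda> (norm (\<gamma> s))) has_real_derivative l (norm (\<gamma> x)) * (sgn (\<gamma> x) \<bullet> \<gamma>')) (at x)"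
        by (rule DERIV_chain2[OF d\<Lambda>[OF nb] dn])
      then have "(v has_real_derivative norm w - l (norm (\<gamma> x)) * (sgn (\<gamma> x) \<bullet> \<gamma>')) (at x)"
        unfolding v_def by (auto intro!: derivative_eq_intros)
      moreover have "l (norm (\<gamma> x)) * (sgn (\<gamma> x) \<bullet> \<gamma>') \<le> norm w"
      proof -
        have "sgn (\<gamma> x) \<bullet> \<gamma>' \<le> norm (sgn (\<gamma> x)) * norm \<gamma>'" by (rule norm_cauchy_schwarz)
        then have "sgn (\<gamma> x) \<bullet> \<gamma>' \<le> norm \<gamma>'" using nz by (simp add: norm_sgn)
        then have "l (norm (\<gamma> x)) * (sgn (\<gamma> x) \<bullet> \<gamma>') \<le> l (norm (\<gamma> x)) * norm \<gamma>'"
          by (intro mult_left_mono l nb)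
        also have "\<dots> \<le> (norm (deriv h (\<gamma> x)) - norm (deriv g (\<gamma> x))) * norm \<gamma>'"
          by (intro mult_right_mono le \<gamma>in xS nz) auto
        finally show ?thesis using \<gamma>'(2) by simp
      qed
      ultimately show "\<exists>y. (v has_real_derivative y) (at x) \<and> 0 \<le> y" by force
    qed (use s in auto)
    then have "\<Lambda> (norm (\<gamma> s)) \<le> s * norm w" by (simp add: v_def \<gamma>0 \<Lambda>0)
    also have "\<dots> \<le> 1 * norm w" using s S1 by (intro mult_right_mono) auto
    finally show ?thesis by simp
  qed
  \<comment> \<open>Otherwise the lift stays in \<open>cball 0 r\<close>, whose image is compact,
    and the exit point \<open>S *\<^sub>R w\<close> would still be attained.\<close>
  have "\<exists>s. 0 < s \<and> s < S \<and> r < norm (\<gamma> s)"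
  proof (rule ccontr)
    assume neg: "\<not> (\<exists>s. 0 < s \<and> s < S \<and> r < norm (\<gamma> s))"
    have small: "\<gamma> s \<in> cball 0 r" if "0 < s" "s < S" for s 
      using neg that by (force simp: not_less)
    have "compact (?f ` cball 0 r)"
      by (intro compact_continuous_image continuous_on_subset[OF continuous_on_harm]) (use r in auto)
    then have cl: "closed (?f ` cball 0 r)" by (rule compact_imp_closed)
    have "(\<lambda>s. s *\<^sub>R w) ` closure {0<..<S} \<subseteq> ?f ` cball 0 r"
    proof (rule image_closure_subset)
      show "(\<lambda>s. s *\<^sub>R w) ` {0<..<S} \<subseteq> ?f ` cball 0 r"
      proof clarify
        fix s assume s: "s \<in> {0<..<S}"
        show "s *\<^sub>R w \<in> ?f ` cball 0 r"
          by (rule image_eqI[of _ _ "\<gamma> s"]) (use f\<gamma>[of s] small[of s] s in auto)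
      qed
    qed (use cl in \<open>auto intro!: continuous_intros\<close>)
    moreover have "S \<in> closure {0<..<S}" using Spos by simp
    ultimately have "S *\<^sub>R w \<in> ?f ` cball 0 r" by blast
    then have "S *\<^sub>R w \<in> ?f ` ball 0 1" using r by auto
    then show False using SA by (auto simp: A_def)
  qed
  then obtain s where s: "0 < s" "s < S" "r < norm (\<gamma> s)" by blast
  have "norm (\<gamma> s) < 1" using \<gamma>in[of s] s by simp
  have "\<Lambda> r \<le> \<Lambda> (norm (\<gamma> s))"
  proof (rule DERIV_nonneg_imp_nondecreasing[of r "norm (\<gamma> s)" \<Lambda>])
    fix x assume "r \<le> x" "x \<le> norm (\<gamma> s)"
    then show "\<exists>y. (\<Lambda> has_real_derivative y) (at x) \<and> 0 \<le> y"
      using d\<Lambda>[of x] l[of x] r \<open>norm (\<gamma> s) < 1\<close> by (intro exI[of _ "l x"]) auto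
  next
    show "r \<le> norm (\<gamma> s)" using s by simp
  qed
  then show ?thesis using bound[OF s(1,2)] by simp
qed

end

subsection \<open>Area\<close>

text \<open>Determinants of matrices and the differentiable change of variables are phrased on
  \<open>real ^ 2\<close>; this map and its inverse carry sets and measures over from the complex
  plane.\<close>

definition vec_of_complex :: "complex \<Rightarrow> real ^ 2" where
  "vec_of_complex z = vector [Re z, Im z]"

definition complex_of_vec :: "real ^ 2 \<Rightarrow> complex" where
  "complex_of_vec x = Complex (x $ 1) (x $ 2)"

lemma vec_of_complex_nth [simp]: "vec_of_complex z $ 1 = Re z" "vec_of_complex z $ 2 = Im z"
  by (simp_all add: vec_of_complex_def)

lemma complex_of_vec_sel [simp]: "Re (complex_of_vec x) = x $ 1" "Im (complex_of_vec x) = x $ 2"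
  by (simp_all add: complex_of_vec_def)

lemma complex_of_vec_inverse [simp]: "vec_of_complex (complex_of_vec x) = x"
  by (simp add: vec_eq_iff forall_2)

lemma vec_of_complex_inverse [simp]: "complex_of_vec (vec_of_complex z) = z"
  by (simp add: complex_eq_iff)

lemma linear_vec_of_complex: "linear vec_of_complex"
  by (rule linearI) (simp_all add: vec_eq_iff forall_2)

lemma linear_complex_of_vec: "linear complex_of_vec"
  by (rule linearI) (simp_all add: complex_eq_iff)

lemmas bounded_linear_vec_of_complex = linear_vec_of_complex[unfolded linear_conv_bounded_linear]
lemmas bounded_linear_complex_of_vec = linear_complex_of_vec[unfolded linear_conv_bounded_linear]

lemma vimage_complex_of_vec: "complex_of_vec -` S = vec_of_complex ` S"
proof (intro subset_antisym subsetI)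
  fix x assume "x \<in> complex_of_vec -` S"
  then show "x \<in> vec_of_complex ` S" by (intro image_eqI[of _ _ "complex_of_vec x"]) auto
qed auto

lemma borel_measurable_complex_of_vec [measurable]: "complex_of_vec \<in> borel \<rightarrow>\<^sub>M borel"
  by (intro borel_measurable_continuous_onI linear_continuous_on bounded_linear_complex_of_vec)

text \<open>Lebesgue measure is determined by its values on boxes, and \<open>complex_of_vec\<close>
  matches boxes with equal side lengths.\<close>

lemma lborel_complex_eq_distr: "lborel = distr lborel borel complex_of_vec"
proof (rule lborel_eqI)
  fix l u :: complex
  assume le: "\<And>b. b \<in> Basis \<Longrightarrow> l \<bullet> b \<le> u \<bullet> b"
  have le': "Re l \<le> Re u" "Im l \<le> Im u" using le[of 1] le[of \<i>] by (auto simp: Basis_complex_def)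
  have basis: "(Basis :: (real ^ 2) set) = {axis 1 1, axis 2 1}"
    by (auto simp: Basis_vec_def) (metis exhaust_2)
  have ne: "axis 1 (1::real) \<noteq> (axis 2 1 :: real ^ 2)" by (simp add: axis_eq_axis)
  have "complex_of_vec -` box l u = box (vec_of_complex l) (vec_of_complex u)"
    by (auto simp: box_def basis Basis_complex_def inner_axis)
  moreover have "emeasure lborel (box (vec_of_complex l) (vec_of_complex u))
      = (\<Prod>b\<in>Basis. (vec_of_complex u - vec_of_complex l) \<bullet> b)"
    by (rule emeasure_lborel_box) (use le' in \<open>auto simp: basis inner_axis\<close>)
  moreover have "(\<Prod>b\<in>Basis. (vec_of_complex u - vec_of_complex l) \<bullet> b) = (\<Prod>b\<in>Basis. (u - l) \<bullet> b)"
    unfolding basis Basis_complex_def using ne by (simp add: inner_axis)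
  ultimately show "emeasure (distr lborel borel complex_of_vec) (box l u) = (\<Prod>b\<in>Basis. (u - l) \<bullet> b)"
    by (subst emeasure_distr) auto
qed auto

lemma measure_vec_of_complex_image:
  assumes S: "S \<in> sets borel"
  shows "vec_of_complex ` S \<in> sets borel" "measure lebesgue (vec_of_complex ` S) = measure lebesgue S"
proof -
  show b: "vec_of_complex ` S \<in> sets borel"
    using measurable_sets[OF borel_measurable_complex_of_vec S] by (simp add: vimage_complex_of_vec)
  have "measure lborel S = measure (distr lborel borel complex_of_vec) S"
    by (subst lborel_complex_eq_distr) simp
  also have "\<dots> = measure lborel (vec_of_complex ` S)"
    using S by (subst measure_distr) (auto simp: vimage_complex_of_vec)
  finally show "measure lebesgue (vec_of_complex ` S) = measure lebesgue S"
    using b S by simp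
qed

text \<open>A uniform bound B of the Jacobian is crude on a disc; sharpness is recovered by applying
  the estimate to thin annuli.\<close>

lemma measure_complex_image_le:
  fixes f a b :: "complex \<Rightarrow> complex"
  assumes S: "S \<in> sets borel" "bounded S" and fS: "f ` S \<in> sets borel"
    and der: "\<And>z. z \<in> S \<Longrightarrow> (f has_derivative (\<lambda>v. a z * v + cnj (b z * v))) (at z)"
    and cont: "continuous_on S a" "continuous_on S b"
    and bound: "\<And>z. z \<in> S \<Longrightarrow> \<bar>(norm (a z))\<^sup>2 - (norm (b z))\<^sup>2\<bar> \<le> B"
  shows "measure lebesgue (f ` S) \<le> B * measure lebesgue S"
proof -
  define F where "F = (\<lambda>x. vec_of_complex (f (complex_of_vec x)))"
  define F' where "F' = (\<lambda>x v. vec_of_complex (a (complex_of_vec x) * complex_of_vec v + cnj (b (complex_of_vec x) * complex_of_vec v)))"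
  define S' where "S' = vec_of_complex ` S"
  have mem: "complex_of_vec x \<in> S" if "x \<in> S'" for x using that by (auto simp: S'_def)
  have S'b: "S' \<in> sets borel" unfolding S'_def by (rule measure_vec_of_complex_image[OF S(1)])
  have "bounded S'" unfolding S'_def by (rule bounded_linear_image[OF S(2) bounded_linear_vec_of_complex])
  then have S'l: "S' \<in> lmeasurable" using S'b by (intro bounded_set_imp_lmeasurable) auto
  have det: "det (matrix (F' x)) = (norm (a (complex_of_vec x)))\<^sup>2 - (norm (b (complex_of_vec x)))\<^sup>2" for x
    unfolding cmod_power2 by (simp add: det_2 matrix_def F'_def axis_def power2_eq_square algebra_simps)
  have contdet: "continuous_on S' (\<lambda>x. \<bar>det (matrix (F' x))\<bar>)"
    unfolding det
    by (intro continuous_intros continuous_on_compose2[OF cont(1)] continuous_on_compose2[OF cont(2)]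
        linear_continuous_on bounded_linear_complex_of_vec) (use mem in auto)
  have "measure lebesgue (F ` S') \<le> B * measure lebesgue S'"
  proof (rule measure_bounded_differentiable_image[OF S'l])
    fix x assume x: "x \<in> S'"
    show "\<bar>det (matrix (F' x))\<bar> \<le> B" unfolding det by (rule bound[OF mem[OF x]])
    have "((\<lambda>y. f (complex_of_vec y)) has_derivative (\<lambda>v. a (complex_of_vec x) * complex_of_vec v + cnj (b (complex_of_vec x) * complex_of_vec v))) (at x)"
      by (rule has_derivative_compose[OF bounded_linear_imp_has_derivative[OF bounded_linear_complex_of_vec] der[OF mem[OF x]]])
    from bounded_linear.has_derivative[OF bounded_linear_vec_of_complex this]
    show "(F has_derivative F' x) (at x within S')"
      unfolding F_def F'_def by (rule has_derivative_at_withinI)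
  next
    show "(\<lambda>x. \<bar>det (matrix (F' x))\<bar>) integrable_on S'"
    proof (rule measurable_bounded_by_integrable_imp_integrable)
      show "(\<lambda>x. \<bar>det (matrix (F' x))\<bar>) \<in> borel_measurable (lebesgue_on S')"
        by (rule continuous_imp_measurable_on_sets_lebesgue[OF contdet]) (use S'l in auto)
      show "(\<lambda>x. B) integrable_on S'" using S'l by (rule integrable_on_const)
      show "norm \<bar>det (matrix (F' x))\<bar> \<le> B" if "x \<in> S'" for x
        using bound[OF mem[OF that]] by (simp add: det)
    qed (use S'l in auto)
  qed
  moreover have "F ` S' = vec_of_complex ` (f ` S)" by (simp add: F_def S'_def image_image)
  ultimately show ?thesis
    using measure_vec_of_complex_image[OF fS] measure_vec_of_complex_image[OF S(1)] by (simp add: S'_def)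
qed

section \<open>Areas of image discs through thin annuli\<close>

lemma measure_disc: "0 \<le> r \<Longrightarrow> measure lebesgue (ball (z::complex) r) = pi * r\<^sup>2"
  using content_ball[of r z] by (simp add: unit_ball_vol_2 mult.commute)

text \<open>\<open>A t - A s\<close> stands for the image area over the annulus
  \<open>s \<le> |z| < t\<close>, whose own area is \<open>\<pi> (t\<^sup>2 - s\<^sup>2)\<close>.
  The claim, with an error proportional to that area, is additive over adjacent intervals and true
  on short ones, so the bisection principle \<open>Bolzano\<close> gives it on [0, r] without
  Riemann sums.\<close>

lemma increment_bound_imp_le_integral:
  fixes A J :: "real \<Rightarrow> real"
  assumes r: "0 \<le> r" and cont: "continuous_on {0..r} J"
    and incr: "\<And>s t B. 0 \<le> s \<Longrightarrow> s \<le> t \<Longrightarrow> t \<le> r \<Longrightarrow> (\<And>x. s \<le> x \<Longrightarrow> x \<le> t \<Longrightarrow> J x \<le> B) \<Longrightarrow>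
        A t - A s \<le> B * (pi * (t\<^sup>2 - s\<^sup>2))"
  shows "A r - A 0 \<le> 2 * pi * integral {0..r} (\<lambda>t. t * J t)"
proof (rule field_le_epsilon)
  fix e :: real assume "e > 0"
  \<comment> \<open>Chosen so that the total error \<open>2 \<epsilon> \<pi> r\<^sup>2\<close> is at
    most e; the summand 1 covers r = 0.\<close>
  define \<epsilon> where "\<epsilon> = e / (2 * pi * (r\<^sup>2 + 1))"
  have \<epsilon>: "\<epsilon> > 0" using \<open>e > 0\<close> by (simp add: \<epsilon>_def add_nonneg_pos)
  have contI: "continuous_on {0..r} (\<lambda>t. t * J t)" by (intro continuous_intros cont)
  define P where "P = (\<lambda>s t. 0 \<le> s \<and> s \<le> t \<and> t \<le> r \<longrightarrow>
      A t - A s \<le> 2 * pi * integral {s..t} (\<lambda>t. t * J t) + 2 * \<epsilon> * (pi * (t\<^sup>2 - s\<^sup>2)))"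
  have "P 0 r"
  proof (rule Bolzano[OF r])
    fix a b c assume P: "P a b" "P b c" and abc: "a \<le> b" "b \<le> c"
    show "P a c"
      unfolding P_def
    proof
      assume ac: "0 \<le> a \<and> a \<le> c \<and> c \<le> r"
      have "(\<lambda>t. t * J t) integrable_on {a..c}"
        by (rule integrable_continuous_interval[OF continuous_on_subset[OF contI]]) (use ac in auto)
      from Henstock_Kurzweil_Integration.integral_combine[OF abc this]
      have I: "integral {a..c} (\<lambda>t. t * J t) = integral {a..b} (\<lambda>t. t * J t) + integral {b..c} (\<lambda>t. t * J t)" by simp
      show "A c - A a \<le> 2 * pi * integral {a..c} (\<lambda>t. t * J t) + 2 * \<epsilon> * (pi * (c\<^sup>2 - a\<^sup>2))"
        using P abc ac unfolding I by (auto simp: P_def algebra_simps)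
    qed
  next
    fix x assume x: "0 \<le> x" "x \<le> r"
    then obtain d where d: "d > 0" "\<And>y. y \<in> {0..r} \<Longrightarrow> dist y x < d \<Longrightarrow> dist (J y) (J x) < \<epsilon>"
      using cont \<epsilon> unfolding continuous_on_iff by (metis atLeastAtMost_iff)
    have "P s t" if st: "s \<le> x" "x \<le> t" "t - s < d" for s t
      unfolding P_def
    proof
      assume b: "0 \<le> s \<and> s \<le> t \<and> t \<le> r"
      have J: "J x - \<epsilon> \<le> J y" "J y \<le> J x + \<epsilon>" if "s \<le> y" "y \<le> t" for y
      proof -
        have "\<bar>y - x\<bar> < d" using that st by linarith
        then have "\<bar>J y - J x\<bar> < \<epsilon>" using d(2)[of y] that b by (simp add: dist_real_def)
        then show "J x - \<epsilon> \<le> J y" "J y \<le> J x + \<epsilon>" by linarith+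
      qed
      have "A t - A s \<le> (J x + \<epsilon>) * (pi * (t\<^sup>2 - s\<^sup>2))"
        by (rule incr) (use b J in auto)
      \<comment> \<open>On a short interval J is within \<epsilon> of \<open>J x\<close>, so the
        upper bound of the increment and the lower bound of \<open>2 \<pi>\<close> times the
        integral differ by \<open>2 \<epsilon>\<close> times the area.\<close>
      moreover have "(J x - \<epsilon>) * ((t\<^sup>2 - s\<^sup>2) / 2) \<le> integral {s..t} (\<lambda>t. t * J t)"
      proof (rule has_integral_le)
        have "((\<lambda>y. (J x - \<epsilon>) * y) has_integral (J x - \<epsilon>) * (t\<^sup>2 / 2) - (J x - \<epsilon>) * (s\<^sup>2 / 2)) {s..t}"
          by (rule fundamental_theorem_of_calculus)
             (use b in \<open>auto intro!: derivative_eq_intros simp flip: has_real_derivative_iff_has_vector_derivative\<close>)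
        then show "((\<lambda>y. y * (J x - \<epsilon>)) has_integral (J x - \<epsilon>) * ((t\<^sup>2 - s\<^sup>2) / 2)) {s..t}"
          by (simp add: algebra_simps diff_divide_distrib)
        show "((\<lambda>t. t * J t) has_integral integral {s..t} (\<lambda>t. t * J t)) {s..t}"
          by (intro integrable_integral integrable_continuous_interval continuous_on_subset[OF contI]) (use b in auto)
        show "y * (J x - \<epsilon>) \<le> y * J y" if "y \<in> {s..t}" for y
          using J[of y] that b by (intro mult_left_mono) auto
      qed
      then have "2 * pi * ((J x - \<epsilon>) * ((t\<^sup>2 - s\<^sup>2) / 2)) \<le> 2 * pi * integral {s..t} (\<lambda>t. t * J t)"
        by (intro mult_left_mono) auto
      ultimately show "A t - A s \<le> 2 * pi * integral {s..t} (\<lambda>t. t * J t) + 2 * \<epsilon> * (pi * (t\<^sup>2 - s\<^sup>2))"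
        by (simp add: algebra_simps)
    qed
    then show "\<exists>d>0. \<forall>a b. a \<le> x \<and> x \<le> b \<and> b - a < d \<longrightarrow> P a b" using d(1) by blast
  qed
  then have "A r - A 0 \<le> 2 * pi * integral {0..r} (\<lambda>t. t * J t) + 2 * \<epsilon> * (pi * r\<^sup>2)"
    using r by (simp add: P_def)
  also have "2 * \<epsilon> * (pi * r\<^sup>2) = e * (r\<^sup>2 / (r\<^sup>2 + 1))"
    by (simp add: \<epsilon>_def)
  also have "\<dots> \<le> e * 1" using \<open>e > 0\<close> by (intro mult_left_mono) (auto simp: divide_le_eq_1 add_nonneg_pos)
  finally show "A r - A 0 \<le> 2 * pi * integral {0..r} (\<lambda>t. t * J t) + e" by simp
qed

context convex_harmonic
begin

text \<open>Univalence makes the area of the image of an annulus the difference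
  \<open>A t - A s\<close>, and the Jacobian \<open>|h'|\<^sup>2 - |g'|\<^sup>2\<close> is
  nonnegative and controlled by J on each circle.\<close>

lemma area_harm_image_le:
  assumes r: "0 \<le> r" "r < 1" and contJ: "continuous_on {0..r} J"
    and J: "\<And>z. z \<in> ball 0 1 \<Longrightarrow> (norm (deriv h z))\<^sup>2 - (norm (deriv g z))\<^sup>2 \<le> J (norm z)"
  shows "measure lebesgue (harm h g ` ball 0 r) \<le> 2 * pi * integral {0..r} (\<lambda>t. t * J t)"
proof -
  let ?f = "harm h g"
  define A where "A = (\<lambda>t. measure lebesgue (?f ` ball 0 t))"
  have lm: "?f ` ball 0 t \<in> lmeasurable" "?f ` ball 0 t \<in> sets borel" if "t \<le> r" for t
  proof -
    have op: "open (?f ` ball 0 t)" by (rule open_harm_image) (use that r in auto)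
    have "compact (?f ` cball 0 t)"
      by (intro compact_continuous_image continuous_on_subset[OF continuous_on_harm]) (use that r in auto)
    then have "bounded (?f ` ball 0 t)"
      by (rule bounded_subset[OF compact_imp_bounded image_mono[OF ball_subset_cball]])
    then show "?f ` ball 0 t \<in> lmeasurable" using op by (rule lmeasurable_open)
    show "?f ` ball 0 t \<in> sets borel" using op by simp
  qed
  have "A r - A 0 \<le> 2 * pi * integral {0..r} (\<lambda>t. t * J t)"
  proof (rule increment_bound_imp_le_integral[OF r(1) contJ])
    fix s t B :: real assume st: "0 \<le> s" "s \<le> t" "t \<le> r"
      and B: "\<And>x. s \<le> x \<Longrightarrow> x \<le> t \<Longrightarrow> J x \<le> B"
    define R where "R = ball 0 t - ball (0::complex) s"
    have R1: "R \<subseteq> ball 0 1" using st r by (auto simp: R_def)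
    have img: "?f ` R = ?f ` ball 0 t - ?f ` ball 0 s"
      unfolding R_def by (rule inj_on_image_set_diff[OF inj_harm]) (use st r in auto)
    have "measure lebesgue (?f ` R) \<le> B * measure lebesgue R"
    proof (rule measure_complex_image_le)
      show "?f ` R \<in> sets borel" unfolding img using lm(2)[of s] lm(2)[of t] st by auto
      show "(?f has_derivative (\<lambda>v. deriv h z * v + cnj (deriv g z * v))) (at z)" if "z \<in> R" for z
        using harm_has_derivative R1 that by blast
      show "continuous_on R (deriv h)" "continuous_on R (deriv g)"
        using holh holg R1
        by (auto intro!: continuous_on_subset[OF holomorphic_on_imp_continuous_on[OF holomorphic_deriv]])
      fix z assume z: "z \<in> R"
      then have zb: "z \<in> ball 0 1" using R1 by blast
      have "(norm (deriv g z))\<^sup>2 \<le> (norm (deriv h z))\<^sup>2"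
        using norm_deriv_g_less[OF zb] by (intro power_mono) auto
      moreover have "J (norm z) \<le> B" using z by (intro B) (auto simp: R_def)
      ultimately show "\<bar>(norm (deriv h z))\<^sup>2 - (norm (deriv g z))\<^sup>2\<bar> \<le> B" using J[OF zb] by linarith
    qed (auto simp: R_def)
    moreover have "measure lebesgue (?f ` R) = A t - A s"
      unfolding img A_def
      by (rule measurable_measure_Diff) (use lm(1) st lm(2)[of s] in \<open>auto intro!: image_mono\<close>)
    moreover have "measure lebesgue R = pi * (t\<^sup>2 - s\<^sup>2)"
    proof -
      have "measure lebesgue R = measure lebesgue (ball (0::complex) t) - measure lebesgue (ball (0::complex) s)"
        unfolding R_def by (rule measurable_measure_Diff) (use st in auto)
      then show ?thesis unfolding measure_disc[OF st(1)] measure_disc[OF order_trans[OF st(1,2)]]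
        by (simp add: algebra_simps)
    qed
    ultimately show "A t - A s \<le> B * (pi * (t\<^sup>2 - s\<^sup>2))" by simp
  qed
  then show ?thesis by (simp add: A_def)
qed

end

text \<open>With \<open>c = norm \<alpha>\<close> the derivative is
  \<open>K'(-\<rho>) (1 - |\<alpha>| \<rho>)\<close>, the lower bound of \<open>|h'| - |g'|\<close>
  on the circle of radius \<rho>, and the limit of \<Lambda> at 1 is
  \<open>L(1, \<alpha>)\<close>.\<close>

lemma radial_lower_bound_deriv:
  fixes K :: "complex \<Rightarrow> complex" and c :: real
  assumes holK: "K holomorphic_on ball 0 1" and K0: "K 0 = 0"
    and \<Lambda>_def: "\<Lambda> = (\<lambda>s. - Re (K (- complex_of_real s)) - c * integral {0..s} (\<lambda>t. t * Re (deriv K (- complex_of_real t))))"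
  shows "\<Lambda> 0 = 0" "continuous_on {0..<1} \<Lambda>"
    "\<And>\<rho>. 0 < \<rho> \<Longrightarrow> \<rho> < 1 \<Longrightarrow> (\<Lambda> has_real_derivative Re (deriv K (- complex_of_real \<rho>)) * (1 - c * \<rho>)) (at \<rho>)"
proof -
  show "\<Lambda> 0 = 0" using K0 by (simp add: \<Lambda>_def)
  have contK': "continuous_on (ball 0 1) (deriv K)"
    using holK by (intro holomorphic_on_imp_continuous_on holomorphic_deriv) auto
  \<comment> \<open>Derivatives within \<open>{0..b}\<close> serve both claims: at inner points they
    become two-sided, and at 0 they still give continuity.\<close>
  have der: "(\<Lambda> has_real_derivative Re (deriv K (- complex_of_real \<rho>)) * (1 - c * \<rho>)) (at \<rho> within {0..b})"
    if \<rho>: "0 \<le> \<rho>" "\<rho> \<le> b" "b < 1" for \<rho> b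
  proof -
    have "continuous_on {0..b} (\<lambda>t. t * Re (deriv K (- complex_of_real t)))"
      by (intro continuous_intros continuous_on_compose2[OF contK']) (use \<rho> in auto)
    then have 1: "((\<lambda>s. integral {0..s} (\<lambda>t. t * Re (deriv K (- complex_of_real t)))) has_real_derivative
        \<rho> * Re (deriv K (- complex_of_real \<rho>))) (at \<rho> within {0..b})"
      by (rule integral_has_real_derivative) (use \<rho> in auto)
    have "(K has_field_derivative deriv K (- complex_of_real \<rho>)) (at (- complex_of_real \<rho>))"
      by (rule holomorphic_derivI[OF holK]) (use \<rho> in auto)
    moreover have "((\<lambda>s. - complex_of_real s) has_vector_derivative - 1) (at \<rho>)"
      by (auto intro!: derivative_eq_intros)
    ultimately have "((\<lambda>s. K (- complex_of_real s)) has_vector_derivative - deriv K (- complex_of_real \<rho>)) (at \<rho>)"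
      using field_vector_diff_chain_at[of "\<lambda>s. - complex_of_real s" "- 1" \<rho> K] by (simp add: o_def)
    from bounded_linear.has_vector_derivative[OF bounded_linear_Re this]
    have 2: "((\<lambda>s. Re (K (- complex_of_real s))) has_real_derivative - Re (deriv K (- complex_of_real \<rho>))) (at \<rho> within {0..b})"
      by (simp add: has_real_derivative_iff_has_vector_derivative has_vector_derivative_at_within)
    show ?thesis unfolding \<Lambda>_def
      by (rule DERIV_cong[OF DERIV_diff[OF DERIV_minus[OF 2] DERIV_cmult[OF 1]]]) (simp add: algebra_simps)
  qed
  show "(\<Lambda> has_real_derivative Re (deriv K (- complex_of_real \<rho>)) * (1 - c * \<rho>)) (at \<rho>)"
    if "0 < \<rho>" "\<rho> < 1" for \<rho>
    using der[of \<rho> "(1 + \<rho>) / 2"] that at_within_Icc_at[of 0 \<rho> "(1 + \<rho>) / 2"] by simp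
  show "continuous_on {0..<1} \<Lambda>"
    unfolding continuous_on_eq_continuous_within
  proof
    fix \<rho> :: real assume \<rho>: "\<rho> \<in> {0..<1}"
    define b where "b = (1 + \<rho>) / 2"
    have b: "\<rho> < b" "b < 1" using \<rho> by (auto simp: b_def)
    have "continuous (at \<rho> within {0..b}) \<Lambda>"
      by (rule DERIV_continuous[OF der]) (use \<rho> b in auto)
    moreover have "at \<rho> within {0..b} = at \<rho> within {0..<1}"
      by (rule at_within_nhd[of _ "{..<b}"]) (use b in auto)
    ultimately show "continuous (at \<rho> within {0..<1}) \<Lambda>" by simp
  qed
qed

text \<open>K is only known inside the disc, so \<open>L\<close> takes \<open>K(-1)\<close> and the
  integral up to 1 together as one radial limit. Passing to real parts loses nothing, since K and
  \<open>K'\<close> are real on the real axis by the symmetry of \<phi>.\<close>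

theorem theorem2p11:
  fixes \<phi> K h g :: "complex \<Rightarrow> complex" and \<alpha> :: complex and L rf :: real
  assumes phi: "ma_minda \<phi>"
    and K_hol: "K holomorphic_on unit_disk"
    and K_0: "K 0 = 0" and K'_0: "deriv K 0 = 1"
    and K_eq: "\<forall>z\<in>unit_disk. deriv K z \<noteq> 0 \<and>
                 1 + z * deriv (deriv K) z / deriv K z = \<phi> z"
    and alpha: "norm \<alpha> \<le> 1"
    and f: "HC_class \<phi> \<alpha> h g"
    and L: "((\<lambda>s. - Re (K (- complex_of_real s))
                  - norm \<alpha> * integral {0..s} (\<lambda>t. t * Re (deriv K (- complex_of_real t))))
             \<longlongrightarrow> L) (at_left 1)"
    and rf: "0 < rf" "rf < 1"
    and rf_root: "majorant K rf + norm \<alpha> * integral {0..rf} (\<lambda>t. t * majorant (deriv K) t)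
                  + integral {0..rf} (\<lambda>t. t * (1 - (norm \<alpha>)\<^sup>2 * t\<^sup>2) * (Re (deriv K (complex_of_real t)))\<^sup>2)
                  = L"
    and rf_least: "\<forall>r. 0 < r \<and> r < rf \<longrightarrow>
                  majorant K r + norm \<alpha> * integral {0..r} (\<lambda>t. t * majorant (deriv K) t)
                  + integral {0..r} (\<lambda>t. t * (1 - (norm \<alpha>)\<^sup>2 * t\<^sup>2) * (Re (deriv K (complex_of_real t)))\<^sup>2)
                  \<noteq> L"
  shows "\<forall>r. 0 < r \<and> r \<le> min (1/3) rf \<longrightarrow>
           harm_majorant h g r + measure lebesgue (harm h g ` ball 0 r) / (2 * pi)
             \<le> infdist (harm h g 0) (frontier (harm h g ` unit_disk))"
proof (intro allI impI)
  fix r :: real assume "0 < r \<and> r \<le> min (1/3) rf"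
  then have r: "0 < r" "r \<le> 1/3" "r \<le> rf" by auto
  note unit_disk_def[simp]
  have holK: "K holomorphic_on ball 0 1" using K_hol by simp
  have K_eq': "deriv K z \<noteq> 0 \<and> 1 + z * deriv (deriv K) z / deriv K z = \<phi> z" if "z \<in> ball 0 1" for z
    using K_eq that by simp
  have h: "conv_class \<phi> h" and holg: "g holomorphic_on ball 0 1" and g0: "g 0 = 0"
    and g: "\<And>z. z \<in> ball 0 1 \<Longrightarrow> deriv g z = \<alpha> * z * deriv h z"
    using f unfolding HC_class_def by auto
  have holh: "h holomorphic_on ball 0 1" and injh: "inj_on h (ball 0 1)" and h0: "h 0 = 0" and h'0: "deriv h 0 = 1"
    using h unfolding conv_class_def by auto
  note growth = ma_minda_growth[OF phi holK K'_0 K_eq' h]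
  interpret convex_harmonic h g \<alpha>
    by unfold_locales (use holh injh conv_class_Re_pos[OF phi holK K'_0 K_eq' h] holg g alpha in auto)
  obtain v where v: "v holomorphic_on ball 0 1" "\<And>z. z \<in> ball 0 1 \<Longrightarrow> norm (v z) \<le> norm z"
    "\<And>z. z \<in> ball 0 1 \<Longrightarrow> deriv h z = deriv K (v z)"
    using ma_minda_deriv_subordinate[OF phi holK K'_0 K_eq' h] by blast
  have holK': "deriv K holomorphic_on ball 0 1" using holK by (intro holomorphic_deriv) auto
  \<comment> \<open>The Jacobian is \<open>(1 - |\<alpha> z|\<^sup>2) |h'|\<^sup>2\<close>;
    replacing \<open>|h'|\<close> by its growth bound gives the integrand of the third term of
    \<open>R'_f\<close>.\<close>
  define J where "J = (\<lambda>t. (1 - (norm \<alpha>)\<^sup>2 * t\<^sup>2) * (Re (deriv K (complex_of_real t)))\<^sup>2)"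
  have contJ: "continuous_on {0..s} J" if "s < 1" for s
    unfolding J_def
    by (intro continuous_intros continuous_on_compose2[OF holomorphic_on_imp_continuous_on[OF holK']]) (use that in auto)
  have factor: "0 \<le> 1 - (norm \<alpha>)\<^sup>2 * t\<^sup>2" if "0 \<le> t" "t < 1" for t :: real
    using mult_mono[of "(norm \<alpha>)\<^sup>2" 1 "t\<^sup>2" 1] that alpha by (simp add: power_le_one)
  have J0: "0 \<le> J t" if "0 \<le> t" "t < 1" for t
    using factor[OF that] by (simp add: J_def)
  define R where "R = (\<lambda>r. majorant K r + norm \<alpha> * integral {0..r} (\<lambda>t. t * majorant (deriv K) t)
      + integral {0..r} (\<lambda>t. t * J t))"
  have area: "measure lebesgue (harm h g ` ball 0 r) / (2 * pi) \<le> integral {0..r} (\<lambda>t. t * J t)"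
  proof -
    have "measure lebesgue (harm h g ` ball 0 r) \<le> 2 * pi * integral {0..r} (\<lambda>t. t * J t)"
    proof (rule area_harm_image_le)
      fix z :: complex assume z: "z \<in> ball 0 1"
      have "(norm (deriv h z))\<^sup>2 - (norm (deriv g z))\<^sup>2 = (1 - (norm \<alpha>)\<^sup>2 * (norm z)\<^sup>2) * (norm (deriv h z))\<^sup>2"
        by (simp add: norm_deriv_g[OF z] power_mult_distrib algebra_simps)
      also have "\<dots> \<le> J (norm z)" unfolding J_def
        by (intro mult_left_mono power_mono factor) (use growth[of z "norm z"] z in auto)
      finally show "(norm (deriv h z))\<^sup>2 - (norm (deriv g z))\<^sup>2 \<le> J (norm z)" .
    qed (use r contJ in auto)
    then show ?thesis by (simp add: field_simps)
  qed
  have "harm_majorant h g r \<le> majorant K r + norm \<alpha> * integral {0..r} (\<lambda>t. t * majorant (deriv K) t)"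
    by (rule HC_majorant_le[OF holh h0 h'0 holg g holK K_0 v]) (use r in auto)
  then have "harm_majorant h g r + measure lebesgue (harm h g ` ball 0 r) / (2 * pi) \<le> R r"
    using area by (simp add: R_def)
  \<comment> \<open>All three terms are nondecreasing in the radius, so the bound is carried from r
    to the root, where it equals \<open>L\<close>.\<close>
  also have "R r \<le> R rf"
  proof -
    have contM: "continuous_on {0..s} (\<lambda>t. t * majorant (deriv K) t)" if "s < 1" for s
      by (intro continuous_intros continuous_on_majorant holK' that)
    have M0: "0 \<le> majorant (deriv K) t" if "0 \<le> t" "t < 1" for t
      by (rule majorant_nonneg[OF holK' that])
    have "majorant K r \<le> majorant K rf"
    proof (rule DERIV_nonneg_imp_nondecreasing[OF r(3)])
      fix x assume "r \<le> x" "x \<le> rf"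
      then show "\<exists>y. (majorant K has_real_derivative y) (at x) \<and> 0 \<le> y"
        using r rf majorant_has_derivative[OF holK, of x] M0[of x]
        by (intro exI[of _ "majorant (deriv K) x"]) auto
    qed
    moreover have "integral {0..r} (\<lambda>t. t * majorant (deriv K) t) \<le> integral {0..rf} (\<lambda>t. t * majorant (deriv K) t)"
      by (rule integral_subset_le) (use r rf contM M0 in \<open>auto intro!: integrable_continuous_interval\<close>)
    moreover have "integral {0..r} (\<lambda>t. t * J t) \<le> integral {0..rf} (\<lambda>t. t * J t)"
      by (rule integral_subset_le)
         (use r rf J0 in \<open>auto intro!: integrable_continuous_interval continuous_intros contJ\<close>)
    ultimately show ?thesis unfolding R_def by (intro add_mono mult_left_mono) auto
  qed
  also have "R rf = L"
    using rf_root by (simp add: R_def J_def mult.assoc)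
  also have "L \<le> infdist (harm h g 0) (frontier (harm h g ` unit_disk))"
  proof -
    have f0: "harm h g 0 = 0" by (simp add: harm_def h0 g0)
    have op: "open (harm h g ` ball 0 1)" by (rule open_harm_image) auto
    \<comment> \<open>\<open>infdist\<close> to the empty set is 0 by convention, which could not
      dominate the positive left-hand side.\<close>
    have ne: "frontier (harm h g ` ball 0 1) \<noteq> {}"
      using harm_image_neq_UNIV unfolding frontier_eq_empty by simp
    define \<Lambda> where "\<Lambda> = (\<lambda>s. - Re (K (- complex_of_real s))
        - norm \<alpha> * integral {0..s} (\<lambda>t. t * Re (deriv K (- complex_of_real t))))"
    note \<Lambda> = radial_lower_bound_deriv[OF holK K_0 \<Lambda>_def]
    have "L \<le> norm w" if w: "w \<in> frontier (harm h g ` ball 0 1)" for w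
    proof -
      \<comment> \<open>The image is open, so its frontier consists of omitted values.\<close>
      have w': "w \<notin> harm h g ` ball 0 1" using w op by (auto simp: frontier_def interior_open)
      have a: "0 \<le> 1 - norm \<alpha> * \<rho>" if "0 \<le> \<rho>" "\<rho> < 1" for \<rho>
        using mult_mono[of "norm \<alpha>" 1 \<rho> 1] that alpha by simp
      have "\<Lambda> s \<le> norm w" if "0 < s" "s < 1" for s
      proof (rule omitted_value_norm_ge[OF h0 g0 \<Lambda>(2,1) \<Lambda>(3) _ _ w' that])
        \<comment> \<open>The growth bound is used at z = 0 here, for the sign of
          \<open>K'(-\<rho>)\<close>.\<close>
        show "0 \<le> Re (deriv K (- complex_of_real \<rho>)) * (1 - norm \<alpha> * \<rho>)" if "0 < \<rho>" "\<rho> < 1" for \<rho>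
          using growth[of 0 \<rho>] a[of \<rho>] that by simp
        show "Re (deriv K (- complex_of_real (norm z))) * (1 - norm \<alpha> * norm z) \<le> norm (deriv h z) - norm (deriv g z)"
          if z: "z \<in> ball 0 1" "z \<noteq> 0" for z
        proof -
          have "Re (deriv K (- complex_of_real (norm z))) * (1 - norm \<alpha> * norm z) \<le> norm (deriv h z) * (1 - norm \<alpha> * norm z)"
            by (intro mult_right_mono a) (use growth[of z "norm z"] z in auto)
          then show ?thesis by (simp add: norm_deriv_g[OF z(1)] algebra_simps)
        qed
      qed
      then have "eventually (\<lambda>s. \<Lambda> s \<le> norm w) (at_left 1)"
        unfolding eventually_at_left[OF zero_less_one] by (intro exI[of _ 0]) auto
      moreover have "(\<Lambda> \<longlongrightarrow> L) (at_left 1)" using L by (simp add: \<Lambda>_def)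
      ultimately show ?thesis by (intro tendsto_upperbound[of \<Lambda> L "at_left 1"]) auto
    qed
    then show ?thesis using ne
      by (simp add: infdist_notempty f0) (intro cINF_greatest, auto)
  qed
  finally show "harm_majorant h g r + measure lebesgue (harm h g ` ball 0 r) / (2 * pi)
      \<le> infdist (harm h g 0) (frontier (harm h g ` unit_disk))" .
qed

end
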